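(* Let $N\ge 2$ be an integer and $\mathcal{B}$ an additive category. Let $\Sigma$ be the suspension functor and $\Theta$ the shift functor of the homotopy category $\mathsf{K}_N(\mathcal{B})$ of $N$-complexes. Then there is a functorial isomorphism $\Sigma^2\simeq\Theta^N$ of functors on $\mathsf{K}_N(\mathcal{B})$.
   Context: An $N$-complex $X=(X^i,d_X^i)_{i\in\mathbb{Z}}$ in $\mathcal{B}$ consists of objects $X^i$ and morphisms $d_X^i:X^i\to X^{i+1}$ with $d_X^{i+N-1}\cdots d_X^{i}=0$ for all $i$; morphisms are families commuting with the $d$'s; $\mathsf{C}_N(\mathcal{B})$ is the resulting category. A morphism $f:X\to Y$ is null-homotopic if there are $s^i:X^i\to Y^{i-N+1}$ with $f^i=\sum_{j=1}^{N}d_Y^{i-1}\cdots d_Y^{i-N+j}\,s^{i+j-1}\,d_X^{i+j-2}\cdots d_X^i$ for all $i$ (empty products are identities). $\mathsf{K}_N(\mathcal{B})$ has the same objects, with morphisms taken modulo null-homotopic ones. It is triangulated, as the stable category of the Frobenius category $\mathsf{C}_N(\mathcal{B})$ whose exact sequences are the term-wise split short exact sequences. For $M\in\mathcal{B}$ and $n\in\mathbb{Z}$ let $\mu_N^n(M)$ be the $N$-complex with $M$ in degrees $n-N+1,\dots,n$, identity maps between these, and $0$ elsewhere. For $X\in\mathsf{C}_N(\mathcal{B})$ let $\lambda_X:X\to\bigoplus_{n\in\mathbb{Z}}\mu_N^n(X^n)$ be the morphism whose $n$-th component in degree $j$, $n-N+1\le j\le n$, is $d_X^{n-1}\cdots d_X^{j}:X^j\to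 X^n$ (the identity if $j=n$). The suspension functor is induced by $\Sigma X=\operatorname{Cok}\lambda_X$ (the cokernel exists and the sequence is term-wise split exact). The shift functor $\Theta$ is given by $\Theta(X)^i=X^{i+1}$, $d_{\Theta(X)}^i=d_X^{i+1}$. *)

theory Defs
  imports "HOL-Algebra.FiniteProduct"
begin

section \<open>Categories, functors, natural isomorphisms\<close>

record ('o, 'a) category =
  Obj :: "'o set"
  Arr :: "'a set"
  Dom :: "'a \<Rightarrow> 'o"
  Cod :: "'a \<Rightarrow> 'o"
  Ident :: "'o \<Rightarrow> 'a"
  Comp :: "'a \<Rightarrow> 'a \<Rightarrow> 'a"  (infixr \<open>\<cdot>\<index>\<close> 75)

definition Hom :: "('o, 'a, 'm) category_scheme \<Rightarrow> 'o \<Rightarrow> 'o \<Rightarrow> 'a set"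
  where "Hom C A B = {f \<in> Arr C. Dom C f = A \<and> Cod C f = B}"

locale category =
  fixes C :: "('o, 'a, 'm) category_scheme" (structure)
  assumes Dom_closed: "f \<in> Arr C \<Longrightarrow> Dom C f \<in> Obj C"
    and Cod_closed: "f \<in> Arr C \<Longrightarrow> Cod C f \<in> Obj C"
    and Ident_Hom: "A \<in> Obj C \<Longrightarrow> Ident C A \<in> Hom C A A"
    and Comp_Hom: "\<lbrakk>f \<in> Hom C A A'; g \<in> Hom C A' A''\<rbrakk> \<Longrightarrow> g \<cdot> f \<in> Hom C A A''"
    and Comp_assoc: "\<lbrakk>f \<in> Hom C A A'; g \<in> Hom C A' A''; h \<in> Hom C A'' A'''\<rbrakk>
      \<Longrightarrow> (h \<cdot> g) \<cdot> f = h \<cdot> (g \<cdot> f)"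
    and Ident_left: "f \<in> Hom C A A' \<Longrightarrow> Ident C A' \<cdot> f = f"
    and Ident_right: "f \<in> Hom C A A' \<Longrightarrow> f \<cdot> Ident C A = f"

definition is_iso :: "('o, 'a, 'm) category_scheme \<Rightarrow> 'o \<Rightarrow> 'o \<Rightarrow> 'a \<Rightarrow> bool"
  where "is_iso C A B f \<longleftrightarrow> f \<in> Hom C A B \<and>
    (\<exists>g \<in> Hom C B A. g \<cdot>\<^bsub>C\<^esub> f = Ident C A \<and> f \<cdot>\<^bsub>C\<^esub> g = Ident C B)"

record ('o, 'a, 'p, 'b) functor_data =
  fobj :: "'o \<Rightarrow> 'p"
  farr :: "'a \<Rightarrow> 'b"

locale cat_functor = C: category C + D: category D
  for C :: "('o, 'a, 'm) category_scheme"
    and D :: "('p, 'b, 'k) category_scheme"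
    and F :: "('o, 'a, 'p, 'b) functor_data" +
  assumes fobj_closed: "A \<in> Obj C \<Longrightarrow> fobj F A \<in> Obj D"
    and farr_Hom: "f \<in> Hom C A A' \<Longrightarrow> farr F f \<in> Hom D (fobj F A) (fobj F A')"
    and farr_Ident: "A \<in> Obj C \<Longrightarrow> farr F (Ident C A) = Ident D (fobj F A)"
    and farr_Comp: "\<lbrakk>f \<in> Hom C A A'; g \<in> Hom C A' A''\<rbrakk>
      \<Longrightarrow> farr F (g \<cdot>\<^bsub>C\<^esub> f) = farr F g \<cdot>\<^bsub>D\<^esub> farr F f"

definition fident :: "('o, 'a, 'o, 'a) functor_data"
  where "fident = \<lparr>fobj = (\<lambda>A. A), farr = (\<lambda>f. f)\<rparr>"

definition functor_comp ::
  "('p, 'b, 'q, 'c) functor_data \<Rightarrow> ('o, 'a, 'p, 'b) functor_data \<Rightarrow> ('o, 'a, 'q, 'c) functor_data"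
  where "functor_comp G F = \<lparr>fobj = fobj G \<circ> fobj F, farr = farr G \<circ> farr F\<rparr>"

definition fpower :: "('o, 'a, 'o, 'a) functor_data \<Rightarrow> nat \<Rightarrow> ('o, 'a, 'o, 'a) functor_data"
  where "fpower F n = (functor_comp F ^^ n) fident"

definition natural_iso ::
  "('o, 'a, 'm) category_scheme \<Rightarrow> ('p, 'b, 'k) category_scheme \<Rightarrow>
   ('o, 'a, 'p, 'b) functor_data \<Rightarrow> ('o, 'a, 'p, 'b) functor_data \<Rightarrow> ('o \<Rightarrow> 'b) \<Rightarrow> bool"
  where "natural_iso C D F G \<eta> \<longleftrightarrow> cat_functor C D F \<and> cat_functor C D G \<and>
    (\<forall>A \<in> Obj C. is_iso D (fobj F A) (fobj G A) (\<eta> A)) \<and>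
    (\<forall>A A'. \<forall>f \<in> Hom C A A'. \<eta> A' \<cdot>\<^bsub>D\<^esub> farr F f = farr G f \<cdot>\<^bsub>D\<^esub> \<eta> A)"

definition naturally_isomorphic ::
  "('o, 'a, 'm) category_scheme \<Rightarrow> ('p, 'b, 'k) category_scheme \<Rightarrow>
   ('o, 'a, 'p, 'b) functor_data \<Rightarrow> ('o, 'a, 'p, 'b) functor_data \<Rightarrow> bool"
  where "naturally_isomorphic C D F G \<longleftrightarrow> (\<exists>\<eta>. natural_iso C D F G \<eta>)"


section \<open>Quotient categories\<close>

text \<open>The quotient of a category by a congruence \<open>R\<close> on its arrows: all arrows in a class
  have the same domain and codomain.\<close>

definition quotient_category ::
  "('o, 'a, 'm) category_scheme \<Rightarrow> 'a rel \<Rightarrow> ('o, 'a set) category"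
  where "quotient_category C R = \<lparr>
    Obj = Obj C,
    Arr = Arr C // R,
    Dom = (\<lambda>\<phi>. the_elem (Dom C ` \<phi>)),
    Cod = (\<lambda>\<phi>. the_elem (Cod C ` \<phi>)),
    Ident = (\<lambda>A. R `` {Ident C A}),
    Comp = (\<lambda>\<psi> \<phi>. \<Union>g\<in>\<psi>. \<Union>f\<in>\<phi>. R `` {g \<cdot>\<^bsub>C\<^esub> f})\<rparr>"

definition induced_functor ::
  "'b rel \<Rightarrow> ('o, 'a, 'p, 'b) functor_data \<Rightarrow> ('o, 'a set, 'p, 'b set) functor_data"
  where "induced_functor R F = \<lparr>fobj = fobj F, farr = (\<lambda>\<phi>. \<Union>f\<in>\<phi>. R `` {farr F f})\<rparr>"


section \<open>Additive categories\<close>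

record ('o, 'a) ab_category = "('o, 'a) category" +
  Zero :: "'o \<Rightarrow> 'o \<Rightarrow> 'a"
  Add :: "'a \<Rightarrow> 'a \<Rightarrow> 'a"

text \<open>Group and finite sum notions of HOL-Algebra are written multiplicatively, so a finite
  sum of parallel arrows is a \<open>finprod\<close> in the following group.\<close>

definition hom_group :: "('o, 'a, 'm) ab_category_scheme \<Rightarrow> 'o \<Rightarrow> 'o \<Rightarrow> 'a monoid"
  where "hom_group C A B = \<lparr>carrier = Hom C A B, mult = Add C, one = Zero C A B\<rparr>"

locale preadditive_category = category C
  for C :: "('o, 'a, 'm) ab_category_scheme" (structure) +
  assumes hom_comm_group: "\<lbrakk>A \<in> Obj C; A' \<in> Obj C\<rbrakk> \<Longrightarrow> comm_group (hom_group C A A')"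
    and Comp_Add_right: "\<lbrakk>f \<in> Hom C A A'; f' \<in> Hom C A A'; g \<in> Hom C A' A''\<rbrakk>
      \<Longrightarrow> g \<cdot> Add C f f' = Add C (g \<cdot> f) (g \<cdot> f')"
    and Comp_Add_left: "\<lbrakk>f \<in> Hom C A A'; g \<in> Hom C A' A''; g' \<in> Hom C A' A''\<rbrakk>
      \<Longrightarrow> Add C g g' \<cdot> f = Add C (g \<cdot> f) (g' \<cdot> f)"

definition is_zero_object :: "('o, 'a, 'm) category_scheme \<Rightarrow> 'o \<Rightarrow> bool"
  where "is_zero_object C Z \<longleftrightarrow> Z \<in> Obj C \<and>
    (\<forall>A \<in> Obj C. (\<exists>!f. f \<in> Hom C A Z) \<and> (\<exists>!f. f \<in> Hom C Z A))"

definition is_biproduct ::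
  "('o, 'a, 'm) ab_category_scheme \<Rightarrow> 'o \<Rightarrow> 'o \<Rightarrow> 'o \<Rightarrow> 'a \<Rightarrow> 'a \<Rightarrow> 'a \<Rightarrow> 'a \<Rightarrow> bool"
  where "is_biproduct C A A' S i i' p p' \<longleftrightarrow> S \<in> Obj C \<and>
    i \<in> Hom C A S \<and> i' \<in> Hom C A' S \<and> p \<in> Hom C S A \<and> p' \<in> Hom C S A' \<and>
    p \<cdot>\<^bsub>C\<^esub> i = Ident C A \<and> p' \<cdot>\<^bsub>C\<^esub> i' = Ident C A' \<and>
    p \<cdot>\<^bsub>C\<^esub> i' = Zero C A' A \<and> p' \<cdot>\<^bsub>C\<^esub> i = Zero C A A' \<and>
    Add C (i \<cdot>\<^bsub>C\<^esub> p) (i' \<cdot>\<^bsub>C\<^esub> p') = Ident C S"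

locale additive_category = preadditive_category +
  assumes ex_zero_object: "\<exists>Z. is_zero_object C Z"
    and ex_biproduct: "\<lbrakk>A \<in> Obj C; A' \<in> Obj C\<rbrakk> \<Longrightarrow> \<exists>S i i' p p'. is_biproduct C A A' S i i' p p'"

definition zero_object :: "('o, 'a, 'm) category_scheme \<Rightarrow> 'o"
  where "zero_object C = (SOME Z. is_zero_object C Z)"

text \<open>A possibly infinite direct sum, with injections \<open>\<iota>\<close> and projections \<open>\<pi>\<close>. A morphism into
  it is to be specified by its components, so it is required to be a product as well as
  a coproduct.\<close>

definition is_direct_sum ::
  "('o, 'a, 'm) ab_category_scheme \<Rightarrow> ('i \<Rightarrow> 'o) \<Rightarrow> 'o \<Rightarrow> ('i \<Rightarrow> 'a) \<Rightarrow> ('i \<Rightarrow> 'a) \<Rightarrow> bool"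
  where "is_direct_sum C A S \<iota> \<pi> \<longleftrightarrow> S \<in> Obj C \<and>
    (\<forall>n. \<iota> n \<in> Hom C (A n) S) \<and> (\<forall>n. \<pi> n \<in> Hom C S (A n)) \<and>
    (\<forall>m n. \<pi> m \<cdot>\<^bsub>C\<^esub> \<iota> n = (if m = n then Ident C (A n) else Zero C (A n) (A m))) \<and>
    (\<forall>T \<in> Obj C. \<forall>f. (\<forall>n. f n \<in> Hom C (A n) T) \<longrightarrow>
      (\<exists>!h. h \<in> Hom C S T \<and> (\<forall>n. h \<cdot>\<^bsub>C\<^esub> \<iota> n = f n))) \<and>
    (\<forall>T \<in> Obj C. \<forall>f. (\<forall>n. f n \<in> Hom C T (A n)) \<longrightarrow>
      (\<exists>!h. h \<in> Hom C T S \<and> (\<forall>n. \<pi> n \<cdot>\<^bsub>C\<^esub> h = f n)))"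

definition is_cokernel :: "('o, 'a, 'm) ab_category_scheme \<Rightarrow> 'a \<Rightarrow> 'o \<Rightarrow> 'a \<Rightarrow> bool"
  where "is_cokernel C f Q q \<longleftrightarrow> Q \<in> Obj C \<and> q \<in> Hom C (Cod C f) Q \<and>
    q \<cdot>\<^bsub>C\<^esub> f = Zero C (Dom C f) Q \<and>
    (\<forall>T \<in> Obj C. \<forall>g \<in> Hom C (Cod C f) T. g \<cdot>\<^bsub>C\<^esub> f = Zero C (Dom C f) T \<longrightarrow>
      (\<exists>!h. h \<in> Hom C Q T \<and> h \<cdot>\<^bsub>C\<^esub> q = g))"


section \<open>The category of \<open>N\<close>-complexes and its homotopy category\<close>

record ('o, 'a) ncomplex =
  cob :: "int \<Rightarrow> 'o"
  diff :: "int \<Rightarrow> 'a"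

record ('o, 'a) chain_map =
  src :: "('o, 'a) ncomplex"
  tgt :: "('o, 'a) ncomplex"
  cmp :: "int \<Rightarrow> 'a"

text \<open>\<open>dpow B X i k\<close> is the composite \<open>d\<^sup>i\<^sup>+\<^sup>k\<^sup>-\<^sup>1 \<cdots> d\<^sup>i\<close> from degree \<open>i\<close> to degree \<open>i + k\<close>.\<close>

primrec dpow :: "('o, 'a) ab_category \<Rightarrow> ('o, 'a) ncomplex \<Rightarrow> int \<Rightarrow> nat \<Rightarrow> 'a"
  where
    "dpow B X i 0 = Ident B (cob X i)"
  | "dpow B X i (Suc k) = diff X (i + int k) \<cdot>\<^bsub>B\<^esub> dpow B X i k"

definition is_ncomplex :: "nat \<Rightarrow> ('o, 'a) ab_category \<Rightarrow> ('o, 'a) ncomplex \<Rightarrow> bool"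
  where "is_ncomplex N B X \<longleftrightarrow>
    (\<forall>i. cob X i \<in> Obj B) \<and>
    (\<forall>i. diff X i \<in> Hom B (cob X i) (cob X (i + 1))) \<and>
    (\<forall>i. dpow B X i N = Zero B (cob X i) (cob X (i + int N)))"

definition is_chain_map :: "nat \<Rightarrow> ('o, 'a) ab_category \<Rightarrow> ('o, 'a) chain_map \<Rightarrow> bool"
  where "is_chain_map N B f \<longleftrightarrow>
    is_ncomplex N B (src f) \<and> is_ncomplex N B (tgt f) \<and>
    (\<forall>i. cmp f i \<in> Hom B (cob (src f) i) (cob (tgt f) i)) \<and>
    (\<forall>i. diff (tgt f) i \<cdot>\<^bsub>B\<^esub> cmp f i = cmp f (i + 1) \<cdot>\<^bsub>B\<^esub> diff (src f) i)"

definition CN :: "nat \<Rightarrow> ('o, 'a) ab_category \<Rightarrow>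
    (('o, 'a) ncomplex, ('o, 'a) chain_map) ab_category"
  where "CN N B = \<lparr>
    Obj = {X. is_ncomplex N B X},
    Arr = {f. is_chain_map N B f},
    Dom = src,
    Cod = tgt,
    Ident = (\<lambda>X. \<lparr>src = X, tgt = X, cmp = (\<lambda>i. Ident B (cob X i))\<rparr>),
    Comp = (\<lambda>g f. \<lparr>src = src f, tgt = tgt g, cmp = (\<lambda>i. cmp g i \<cdot>\<^bsub>B\<^esub> cmp f i)\<rparr>),
    Zero = (\<lambda>X Y. \<lparr>src = X, tgt = Y, cmp = (\<lambda>i. Zero B (cob X i) (cob Y i))\<rparr>),
    Add = (\<lambda>f g. \<lparr>src = src f, tgt = tgt f, cmp = (\<lambda>i. Add B (cmp f i) (cmp g i))\<rparr>)\<rparr>"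

definition null_homotopic :: "nat \<Rightarrow> ('o, 'a) ab_category \<Rightarrow> ('o, 'a) chain_map \<Rightarrow> bool"
  where "null_homotopic N B f \<longleftrightarrow> (\<exists>s.
    (\<forall>i. s i \<in> Hom B (cob (src f) i) (cob (tgt f) (i - int N + 1))) \<and>
    (\<forall>i. cmp f i = finprod (hom_group B (cob (src f) i) (cob (tgt f) i))
      (\<lambda>j. dpow B (tgt f) (i - int N + int j) (N - j) \<cdot>\<^bsub>B\<^esub>
            s (i + int j - 1) \<cdot>\<^bsub>B\<^esub> dpow B (src f) i (j - 1))
      {1..N}))"

definition homotopy_rel :: "nat \<Rightarrow> ('o, 'a) ab_category \<Rightarrow> ('o, 'a) chain_map rel"
  where "homotopy_rel N B = {(f, g). \<exists>X Y. f \<in> Hom (CN N B) X Y \<and> g \<in> Hom (CN N B) X Y \<and>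
    (\<exists>h \<in> Hom (CN N B) X Y. null_homotopic N B h \<and> f = Add (CN N B) g h)}"

definition KN :: "nat \<Rightarrow> ('o, 'a) ab_category \<Rightarrow>
    (('o, 'a) ncomplex, ('o, 'a) chain_map set) category"
  where "KN N B = quotient_category (CN N B) (homotopy_rel N B)"


section \<open>The shift functor\<close>

definition shift_CN ::
  "(('o, 'a) ncomplex, ('o, 'a) chain_map, ('o, 'a) ncomplex, ('o, 'a) chain_map) functor_data"
  where "shift_CN =
    (let \<theta> = (\<lambda>X. \<lparr>cob = (\<lambda>i. cob X (i + 1)), diff = (\<lambda>i. diff X (i + 1))\<rparr>) in
     \<lparr>fobj = \<theta>,
      farr = (\<lambda>f. \<lparr>src = \<theta> (src f), tgt = \<theta> (tgt f), cmp = (\<lambda>i. cmp f (i + 1))\<rparr>)\<rparr>)"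

definition shift :: "nat \<Rightarrow> ('o, 'a) ab_category \<Rightarrow>
    (('o, 'a) ncomplex, ('o, 'a) chain_map set, ('o, 'a) ncomplex, ('o, 'a) chain_map set) functor_data"
  where "shift N B = induced_functor (homotopy_rel N B) shift_CN"


section \<open>The suspension functor\<close>

definition mu :: "nat \<Rightarrow> ('o, 'a) ab_category \<Rightarrow> int \<Rightarrow> 'o \<Rightarrow> ('o, 'a) ncomplex"
  where "mu N B n M =
    (let ob = (\<lambda>i. if n - int N + 1 \<le> i \<and> i \<le> n then M else zero_object B) in
     \<lparr>cob = ob,
      diff = (\<lambda>i. if n - int N + 1 \<le> i \<and> i + 1 \<le> n then Ident B M
                   else Zero B (ob i) (ob (i + 1)))\<rparr>)"

definition mu_map :: "nat \<Rightarrow> ('o, 'a) ab_category \<Rightarrow> int \<Rightarrow> 'a \<Rightarrow> ('o, 'a) chain_map"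
  where "mu_map N B n f = \<lparr>
    src = mu N B n (Dom B f),
    tgt = mu N B n (Cod B f),
    cmp = (\<lambda>i. if n - int N + 1 \<le> i \<and> i \<le> n then f
                 else Zero B (zero_object B) (zero_object B))\<rparr>"

definition mu_sum :: "nat \<Rightarrow> ('o, 'a) ab_category \<Rightarrow> ('o, 'a) ncomplex \<Rightarrow>
    ('o, 'a) ncomplex \<times> (int \<Rightarrow> ('o, 'a) chain_map) \<times> (int \<Rightarrow> ('o, 'a) chain_map)"
  where "mu_sum N B X =
    (SOME (S, \<iota>, \<pi>). is_direct_sum (CN N B) (\<lambda>n. mu N B n (cob X n)) S \<iota> \<pi>)"

definition mu_sum_obj :: "nat \<Rightarrow> ('o, 'a) ab_category \<Rightarrow> ('o, 'a) ncomplex \<Rightarrow> ('o, 'a) ncomplex"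
  where "mu_sum_obj N B X = fst (mu_sum N B X)"

definition mu_proj ::
  "nat \<Rightarrow> ('o, 'a) ab_category \<Rightarrow> ('o, 'a) ncomplex \<Rightarrow> int \<Rightarrow> ('o, 'a) chain_map"
  where "mu_proj N B X = snd (snd (mu_sum N B X))"

definition mu_sum_map :: "nat \<Rightarrow> ('o, 'a) ab_category \<Rightarrow> ('o, 'a) chain_map \<Rightarrow> ('o, 'a) chain_map"
  where "mu_sum_map N B f =
    (THE g. g \<in> Hom (CN N B) (mu_sum_obj N B (src f)) (mu_sum_obj N B (tgt f)) \<and>
      (\<forall>n. mu_proj N B (tgt f) n \<cdot>\<^bsub>CN N B\<^esub> g
         = mu_map N B n (cmp f n) \<cdot>\<^bsub>CN N B\<^esub> mu_proj N B (src f) n))"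

definition lam_comp ::
  "nat \<Rightarrow> ('o, 'a) ab_category \<Rightarrow> ('o, 'a) ncomplex \<Rightarrow> int \<Rightarrow> ('o, 'a) chain_map"
  where "lam_comp N B X n = \<lparr>
    src = X,
    tgt = mu N B n (cob X n),
    cmp = (\<lambda>j. if n - int N + 1 \<le> j \<and> j \<le> n then dpow B X j (nat (n - j))
                 else Zero B (cob X j) (zero_object B))\<rparr>"

definition lam :: "nat \<Rightarrow> ('o, 'a) ab_category \<Rightarrow> ('o, 'a) ncomplex \<Rightarrow> ('o, 'a) chain_map"
  where "lam N B X =
    (THE l. l \<in> Hom (CN N B) X (mu_sum_obj N B X) \<and>
      (\<forall>n. mu_proj N B X n \<cdot>\<^bsub>CN N B\<^esub> l = lam_comp N B X n))"

definition susp_cokernel :: "nat \<Rightarrow> ('o, 'a) ab_category \<Rightarrow> ('o, 'a) ncomplex \<Rightarrow>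
    ('o, 'a) ncomplex \<times> ('o, 'a) chain_map"
  where "susp_cokernel N B X = (SOME (Q, q). is_cokernel (CN N B) (lam N B X) Q q)"

definition susp_obj :: "nat \<Rightarrow> ('o, 'a) ab_category \<Rightarrow> ('o, 'a) ncomplex \<Rightarrow> ('o, 'a) ncomplex"
  where "susp_obj N B X = fst (susp_cokernel N B X)"

definition susp_proj :: "nat \<Rightarrow> ('o, 'a) ab_category \<Rightarrow> ('o, 'a) ncomplex \<Rightarrow> ('o, 'a) chain_map"
  where "susp_proj N B X = snd (susp_cokernel N B X)"

text \<open>On a morphism \<open>f\<close>, the suspension is the map of cokernels induced by the commutative
  square formed by \<open>f\<close> and \<open>mu_sum_map N B f\<close>.\<close>

definition susp_map :: "nat \<Rightarrow> ('o, 'a) ab_category \<Rightarrow> ('o, 'a) chain_map \<Rightarrow> ('o, 'a) chain_map"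
  where "susp_map N B f =
    (THE h. h \<in> Hom (CN N B) (susp_obj N B (src f)) (susp_obj N B (tgt f)) \<and>
      h \<cdot>\<^bsub>CN N B\<^esub> susp_proj N B (src f) = susp_proj N B (tgt f) \<cdot>\<^bsub>CN N B\<^esub> mu_sum_map N B f)"

definition suspension :: "nat \<Rightarrow> ('o, 'a) ab_category \<Rightarrow>
    (('o, 'a) ncomplex, ('o, 'a) chain_map set, ('o, 'a) ncomplex, ('o, 'a) chain_map set) functor_data"
  where "suspension N B =
    induced_functor (homotopy_rel N B) \<lparr>fobj = susp_obj N B, farr = susp_map N B\<rparr>"

end

theory Submission
  imports Defs
begin

text \<open>Write \<open>I X\<close> for the direct sum of the complexes \<open>\<mu>\<^sup>n(X\<^sup>n)\<close>, so that the suspension is the cokernel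
in \<open>X \<rightarrow> I X \<rightarrow> \<Sigma>X\<close>. Call a sequence \<open>X \<rightarrow> S \<rightarrow> Q\<close> of chain maps split if it is split exact in
every degree. If the middle term \<open>S\<close> is contractible, then \<open>X\<close> determines \<open>Q\<close> up to
homotopy equivalence, naturally in \<open>X\<close>: a null-homotopic map \<open>X \<rightarrow> Y\<close> extends along \<open>X \<rightarrow> S\<close>,
because its homotopy can be composed with a degreewise retraction; so every map out of \<open>X\<close>
induces a map out of \<open>Q\<close>, and a null-homotopic one induces only null-homotopic maps
(\<open>split_seq_map\<close>, \<open>split_seq_map_null\<close>, \<open>split_seq_comparison\<close>). The defining sequence of
\<open>\<Sigma>\<^sup>2X\<close> is of this kind and starts at \<open>\<Sigma>X\<close>. It therefore suffices to find a second one,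
\<open>\<Sigma>X \<rightarrow> \<Theta>(I X) \<rightarrow> \<Theta>\<^sup>NX\<close>, natural in \<open>X\<close>.

In degree \<open>j\<close> the complex \<open>I X\<close> is \<open>X\<^sup>j \<oplus> \<cdots> \<oplus> X\<^sup>j\<^sup>+\<^sup>N\<^sup>-\<^sup>1\<close>. The projections \<open>\<epsilon>\<close> onto the first
summand make it the cofree complex on the graded object \<open>X\<close>: for every complex \<open>T\<close> and every
graded map \<open>f\<close> from \<open>T\<close> to \<open>X\<close> there is exactly one chain map \<open>h\<close> into \<open>I X\<close> with
\<open>\<epsilon> h = f\<close> (\<open>cofree_lift\<close>, \<open>cofree_eqI\<close>). In particular the differential \<open>d\<close> of \<open>X\<close> lifts to
a chain map \<open>d'\<close> from \<open>I X\<close> to \<open>\<Theta>(I X)\<close> with \<open>\<epsilon> d' = d \<epsilon>\<close>. The differential \<open>\<partial>\<close> of \<open>I X\<close> is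
another chain map between the same complexes, and \<open>\<delta> = \<partial> - d'\<close> vanishes on the image of \<open>X\<close>. With
\<open>w = \<Sum>\<^sub>j d\<^sup>N\<^sup>-\<^sup>j \<epsilon> \<partial>\<^sup>j\<^sup>-\<^sup>1\<close> the sequence
\<open>0 \<rightarrow> X \<rightarrow> I X \<rightarrow> \<Theta>(I X) \<rightarrow> \<Theta>\<^sup>NX \<rightarrow> 0\<close>
formed by \<open>\<lambda>\<close>, \<open>\<delta>\<close>, \<open>w\<close> is split exact in each degree (\<open>difference_split\<close>): on the summands,
\<open>\<delta>\<close> sends \<open>(x\<^sub>k)\<close> to \<open>(x\<^sub>k - d x\<^sub>k\<^sub>-\<^sub>1)\<close>, which is unipotent up to the shift of the index, and
\<open>w\<close> is the obstruction to solving for the last component. The image of \<open>\<delta>\<close> is \<open>\<Sigma>X\<close>, and this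
is the required sequence (\<open>second_split_seq\<close>).

The computations are carried out in a ring. A graded map \<open>f\<close> of degree \<open>k\<close> acts by
composition on the generalized elements of its source, the arrows \<open>T \<rightarrow> X\<^sup>i\<close>, and is determined
by this action. It is thus represented by an additive operator on an abelian group that depends
only on the types of objects and arrows (\<open>rep\<close>). Composites and sums become products and
sums in a ring given by a type class, so that degrees and matching conditions disappear
from the equations and the homotopy formula turns into \<open>\<Sum>\<^sub>j d\<^sup>N\<^sup>-\<^sup>j s d\<^sup>j\<^sup>-\<^sup>1\<close> (\<open>hsum\<close>).\<close>

section \<open>A ring of operators\<close>

typedef (overloaded) 'v endo = "{f :: 'v::ab_group_add \<Rightarrow> 'v. \<forall>x y. f (x + y) = f x + f y}"
  morphisms app Endo
  by (rule exI[of _ "\<lambda>x. x"]) simp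

lemma app_add: "app f (x + y) = app f x + app f y"
  using app[of f] by simp

lemma app_Endo: "(\<And>x y. f (x + y) = f x + f y) \<Longrightarrow> app (Endo f) = f"
  by (simp add: Endo_inverse)

instantiation endo :: (ab_group_add) ring
begin
definition "0 = Endo (\<lambda>x. 0)"
definition "f + g = Endo (\<lambda>x. app f x + app g x)"
definition "- f = Endo (\<lambda>x. - app f x)"
definition "f - g = Endo (\<lambda>x. app f x - app g x)"
definition "f * g = Endo (\<lambda>x. app f (app g x))"

lemma app_ops:
  "app 0 x = 0" "app (f + g) x = app f x + app g x" "app (- f) x = - app f x"
  "app (f - g) x = app f x - app g x" "app (f * g) x = app f (app g x)"
  unfolding zero_endo_def plus_endo_def uminus_endo_def minus_endo_def times_endo_def
  by (subst app_Endo; simp add: app_add algebra_simps)+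

instance
  by standard (simp_all add: app_inject[symmetric] fun_eq_iff app_ops app_add algebra_simps)
end

lemma endo_eqI: "(\<And>x. app f x = app g x) \<Longrightarrow> f = g"
  by (simp add: app_inject[symmetric] fun_eq_iff)

instantiation endo :: (ab_group_add) monoid_mult
begin
definition "1 = Endo (\<lambda>x. x)"
instance
  by standard (simp_all add: app_inject[symmetric] fun_eq_iff app_ops one_endo_def app_Endo mult.assoc)
end

subsection \<open>Homotopy sums\<close>

text \<open>The sum of \<open>a\<^sup>n\<^sup>-\<^sup>j s b\<^sup>j\<^sup>-\<^sup>1\<close> over \<open>1 \<le> j \<le> n\<close>. For \<open>n = N\<close> and differentials \<open>a\<close>, \<open>b\<close> it is the
  map with null-homotopy \<open>s\<close>; the partial sums, hence the recursion, are needed for the degreewise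
  splitting in \<open>difference_split\<close>.\<close>

primrec hsum :: "'r::{ring,monoid_mult} \<Rightarrow> 'r \<Rightarrow> 'r \<Rightarrow> nat \<Rightarrow> 'r" where
  "hsum a b s 0 = 0"
| "hsum a b s (Suc n) = a * hsum a b s n + s * b ^ n"

lemma hsum_Suc_right: "hsum a b s (Suc n) = hsum a b s n * b + a ^ n * s"
proof (induction n)
  case (Suc n)
  have "hsum a b s (Suc (Suc n)) = a * (hsum a b s n * b + a ^ n * s) + s * b ^ Suc n"
    by (simp only: hsum.simps(2)[of a b s "Suc n"] Suc)
  also have "\<dots> = (a * hsum a b s n + s * b ^ n) * b + a ^ Suc n * s"
    by (simp add: algebra_simps power_commutes)
  finally show ?case by simp
qed simp

lemma hsum_eq_sum: "hsum a b s n = (\<Sum>j=1..n. a ^ (n - j) * s * b ^ (j - 1))"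
proof (induction n)
  case (Suc n)
  have "a * (a ^ (n - j) * s * b ^ (j - 1)) = a ^ (Suc n - j) * s * b ^ (j - 1)"
    if "j \<in> {1..n}" for j
    using that by (simp add: Suc_diff_le mult.assoc)
  then show ?case using Suc by (simp add: sum_distrib_left)
qed simp

text \<open>The two recursions of the sum, from the left and from the right, both compute the sum for
  \<open>n + 1\<close>.\<close>

lemma hsum_commute: "a ^ n * s = 0 \<Longrightarrow> s * b ^ n = 0 \<Longrightarrow> a * hsum a b s n = hsum a b s n * b"
  using hsum_Suc_right[of a b s n] by simp

lemma mult_hsum:
  assumes "c * a = a' * c"
  shows "c * hsum a b s n = hsum a' b (c * s) n"
proof (induction n)
  case (Suc n)
  have "c * (a * hsum a b s n) = a' * (c * hsum a b s n)"
    by (simp only: mult.assoc[symmetric] assms)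
  then show ?case using Suc by (simp add: distrib_left mult.assoc)
qed simp

lemma power_mult_commute:
  fixes b b' c :: "'r::monoid_mult"
  assumes "b * c = c * b'"
  shows "b ^ n * c = c * b' ^ n"
proof (induction n)
  case (Suc n)
  have "b ^ Suc n * c = b * (b ^ n * c)" by (simp add: mult.assoc)
  also have "\<dots> = c * b' ^ Suc n" by (simp add: Suc mult.assoc[symmetric] assms)
  finally show ?case .
qed simp

lemma hsum_mult:
  assumes "b * c = c * b'"
  shows "hsum a b s n * c = hsum a b' (s * c) n"
  by (induction n) (simp_all add: algebra_simps power_mult_commute[OF assms])

lemma hsum_add: "hsum a b (s + s') n = hsum a b s n + hsum a b s' n"
  by (induction n) (simp_all add: algebra_simps)

lemma hsum_uminus: "hsum a b (- s) n = - hsum a b s n"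
  by (induction n) (simp_all add: algebra_simps)

section \<open>Generalized elements\<close>

text \<open>The category is part of a position so that the generalized elements of all preadditive categories
  over the given types form one type. Any operation on that type can then be a type class operation,
  with no category as parameter.\<close>

definition position :: "('o, 'a) ab_category \<Rightarrow> 'o \<Rightarrow> 'o \<Rightarrow> bool"
  where "position B T A \<longleftrightarrow> preadditive_category B \<and> T \<in> Obj B \<and> A \<in> Obj B"

lemma position_group: "position B T A \<Longrightarrow> comm_group (hom_group B T A)"
  by (simp add: position_def preadditive_category.hom_comm_group)

text \<open>A generalized element picks an arrow \<open>T \<rightarrow> A\<close> for all \<open>T\<close>, \<open>A\<close> and degrees \<open>i\<close> at once.
  Outside the positions its value is pinned down to keep equality extensional.\<close>

definition elements :: "(('o, 'a) ab_category \<Rightarrow> 'o \<Rightarrow> 'o \<Rightarrow> int \<Rightarrow> 'a) set" where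
  "elements = {v. \<forall>B T A i. if position B T A then v B T A i \<in> Hom B T A
                                else v B T A i = undefined}"

lemma hom_group_simps:
  "carrier (hom_group B T A) = Hom B T A" "mult (hom_group B T A) = Add B"
  "one (hom_group B T A) = Zero B T A"
  by (simp_all add: hom_group_def)

lemma Zero_position: "position B T A \<Longrightarrow> Zero B T A \<in> Hom B T A"
  using position_group[of B T A] comm_groupE(2)[of "hom_group B T A"] by (simp add: hom_group_simps)

lemma Add_position:
  "position B T A \<Longrightarrow> f \<in> Hom B T A \<Longrightarrow> g \<in> Hom B T A \<Longrightarrow> Add B f g \<in> Hom B T A"
  using comm_groupE(1)[OF position_group] by (metis hom_group_simps(1,2))

lemma inv_position:
  "position B T A \<Longrightarrow> f \<in> Hom B T A \<Longrightarrow> m_inv (hom_group B T A) f \<in> Hom B T A"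
  using group.inv_closed[OF comm_group.axioms(2)[OF position_group]] by (metis hom_group_simps(1))

typedef ('o, 'a) gelem = "elements :: (('o, 'a) ab_category \<Rightarrow> 'o \<Rightarrow> 'o \<Rightarrow> int \<Rightarrow> 'a) set"
  morphisms at Gelem
  by (rule exI[of _ "\<lambda>B T A i. if position B T A then Zero B T A else undefined"])
    (simp add: elements_def Zero_position)

lemma at_Hom: "position B T A \<Longrightarrow> at v B T A i \<in> Hom B T A"
  and at_undefined: "\<not> position B T A \<Longrightarrow> at v B T A i = undefined"
  using at[of v] by (auto simp: elements_def split: if_splits)

lemma at_Gelem: 
  assumes "\<And>B T A i. position B T A \<Longrightarrow> v B T A i \<in> Hom B T A"
  shows "at (Gelem (\<lambda>B T A i. if position B T A then v B T A i else undefined)) B T A i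
    = (if position B T A then v B T A i else undefined)"
  using assms by (subst Gelem_inverse) (auto simp: elements_def)

lemma gelem_eqI:
  assumes "\<And>B T A i. position B T A \<Longrightarrow> at v B T A i = at w B T A i"
  shows "v = w"
proof -
  have "at v B T A i = at w B T A i" for B T A i
    using assms[of B T A i] at_undefined[of B T A] by (cases "position B T A") simp_all
  then show ?thesis by (simp add: at_inject[symmetric] fun_eq_iff)
qed

instantiation gelem :: (type, type) ab_group_add
begin
definition "0 = Gelem (\<lambda>B T A i. if position B T A then Zero B T A else undefined)"
definition "v + w = Gelem (\<lambda>B T A i. if position B T A then Add B (at v B T A i) (at w B T A i) else undefined)"
definition "- v = Gelem (\<lambda>B T A i. if position B T A
  then m_inv (hom_group B T A) (at v B T A i) else undefined)"
definition "v - w = v + - (w :: ('a, 'b) gelem)"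

lemma at_ops:
  assumes P: "position B T A"
  shows "at 0 B T A i = Zero B T A"
    "at (v + w) B T A i = Add B (at v B T A i) (at w B T A i)"
    "at (- v) B T A i = m_inv (hom_group B T A) (at v B T A i)"
proof -
  show "at 0 B T A i = Zero B T A"
    unfolding zero_gelem_def by (subst at_Gelem) (simp_all add: Zero_position P)
  show "at (v + w) B T A i = Add B (at v B T A i) (at w B T A i)"
    unfolding plus_gelem_def by (subst at_Gelem) (simp_all add: Add_position at_Hom P)
  show "at (- v) B T A i = m_inv (hom_group B T A) (at v B T A i)"
    unfolding uminus_gelem_def by (subst at_Gelem) (simp_all add: inv_position at_Hom P)
qed

instance
proof
  fix a b c :: "('a, 'b) gelem"
  note E = comm_groupE[OF position_group, unfolded hom_group_simps]
  show "a + b + c = a + (b + c)"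
    by (rule gelem_eqI) (simp add: at_ops E(3) at_Hom)
  show "a + b = b + a"
    by (rule gelem_eqI) (simp add: at_ops E(4) at_Hom)
  show "0 + a = a"
    by (rule gelem_eqI) (simp add: at_ops E(5) at_Hom)
  show "- a + a = 0"
  proof (rule gelem_eqI)
    fix B :: "('a, 'b) ab_category" and T A i assume P: "position B T A"
    show "at (- a + a) B T A i = at 0 B T A i"
      using group.l_inv[OF comm_group.axioms(2)[OF position_group[OF P]], of "at a B T A i"]
      by (simp add: at_ops P at_Hom hom_group_simps)
  qed
  show "a - b = a + - b" by (fact minus_gelem_def)
qed
end

section \<open>Graded maps as operators\<close>

text \<open>The operator of a family \<open>f i : X i \<rightarrow> Y (i + k)\<close>. It reads the components of a generalized
  element at the objects \<open>X j\<close> in degree \<open>j\<close>, and its values have components only at the objects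
  \<open>Y i\<close> in degree \<open>i\<close>; the index \<open>i - k\<close> accounts for the degree of \<open>f\<close>.\<close>

definition rep :: "('o, 'a) ab_category \<Rightarrow> (int \<Rightarrow> 'o) \<Rightarrow> (int \<Rightarrow> 'o) \<Rightarrow> int \<Rightarrow> (int \<Rightarrow> 'a)
    \<Rightarrow> ('o, 'a) gelem endo" where
  "rep B X Y k f = Endo (\<lambda>v. Gelem (\<lambda>B' T A i. if position B' T A
      then if B' = B \<and> A = Y i then Comp B (f (i - k)) (at v B T (X (i - k)) (i - k)) else Zero B' T A
      else undefined))"

locale graded = additive_category B for B :: "('o, 'a) ab_category" (structure)
begin

definition gobj :: "(int \<Rightarrow> 'o) \<Rightarrow> bool" where
  "gobj X \<longleftrightarrow> (\<forall>i. X i \<in> Obj B)"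

definition gfam :: "(int \<Rightarrow> 'o) \<Rightarrow> (int \<Rightarrow> 'o) \<Rightarrow> int \<Rightarrow> (int \<Rightarrow> 'a) \<Rightarrow> bool" where
  "gfam X Y k f \<longleftrightarrow> gobj X \<and> gobj Y \<and> (\<forall>i. f i \<in> Hom B (X i) (Y (i + k)))"

text \<open>The graded maps of degree \<open>k\<close> from \<open>X\<close> to \<open>Y\<close>, seen in the ring.\<close>

definition G :: "(int \<Rightarrow> 'o) \<Rightarrow> (int \<Rightarrow> 'o) \<Rightarrow> int \<Rightarrow> ('o, 'a) gelem endo set" where
  "G X Y k = {rep B X Y k f |f. gfam X Y k f}"

abbreviation unit :: "(int \<Rightarrow> 'o) \<Rightarrow> ('o, 'a) gelem endo" where
  "unit X \<equiv> rep B X X 0 (\<lambda>i. Ident B (X i))"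

lemma preadditive: "preadditive_category B"
  by unfold_locales

lemma Hom_position: "f \<in> Hom B T A \<Longrightarrow> position B T A"
  using Dom_closed[of f] Cod_closed[of f] by (simp add: position_def Hom_def preadditive)

lemma position_B: "position B T A \<longleftrightarrow> T \<in> Obj B \<and> A \<in> Obj B"
  by (simp add: position_def preadditive)

lemma Zero_Hom: "T \<in> Obj B \<Longrightarrow> A \<in> Obj B \<Longrightarrow> Zero B T A \<in> Hom B T A"
  by (simp add: Zero_position position_B)

lemma Add_Hom: "f \<in> Hom B T A \<Longrightarrow> g \<in> Hom B T A \<Longrightarrow> Add B f g \<in> Hom B T A"
  using Add_position[OF Hom_position] .

lemma Add_Zero: "f \<in> Hom B T A \<Longrightarrow> Add B (Zero B T A) f = f"
  using comm_groupE(5)[OF position_group[OF Hom_position[of f T A]]] by (metis hom_group_simps)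

lemma idempotent_eq_Zero:
  assumes f: "f \<in> Hom B T A" and "Add B f f = f"
  shows "f = Zero B T A"
proof -
  interpret H: comm_group "hom_group B T A"
    by (rule position_group[OF Hom_position[OF f]])
  show ?thesis
    using H.l_cancel_one[of f f] assms by (simp add: hom_group_simps)
qed

lemma Comp_Zero_right:
  assumes "f \<in> Hom B A A'" "T \<in> Obj B"
  shows "f \<cdot> Zero B T A = Zero B T A'"
proof -
  have A: "A \<in> Obj B" using Hom_position[OF assms(1)] by (simp add: position_B)
  have z: "Zero B T A \<in> Hom B T A" by (rule Zero_Hom[OF assms(2) A])
  show ?thesis
    using Comp_Add_right[OF z z assms(1)] Add_Zero[OF z] Comp_Hom[OF z assms(1)]
    by (intro idempotent_eq_Zero) simp_all
qed

lemma Comp_Zero_left: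
  assumes "f \<in> Hom B T A" "A' \<in> Obj B"
  shows "Zero B A A' \<cdot> f = Zero B T A'"
proof -
  have A: "A \<in> Obj B" using Hom_position[OF assms(1)] by (simp add: position_B)
  have z: "Zero B A A' \<in> Hom B A A'" by (rule Zero_Hom[OF A assms(2)])
  show ?thesis
    using Comp_Add_left[OF assms(1) z z] Add_Zero[OF z] Comp_Hom[OF assms(1) z]
    by (intro idempotent_eq_Zero) simp_all
qed

lemma gfamD: "gfam X Y k f \<Longrightarrow> f i \<in> Hom B (X i) (Y (i + k))"
  "gfam X Y k f \<Longrightarrow> f (i - k) \<in> Hom B (X (i - k)) (Y i)"
  "gfam X Y k f \<Longrightarrow> X i \<in> Obj B" "gfam X Y k f \<Longrightarrow> Y i \<in> Obj B"
  unfolding gfam_def gobj_def by (auto dest: spec[of _ "i - k"])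

lemma app_rep:
  assumes f: "gfam X Y k f" and P: "position B' T A"
  shows "at (app (rep B X Y k f) v) B' T A i = (if B' = B \<and> A = Y i
      then f (i - k) \<cdot> at v B T (X (i - k)) (i - k) else Zero B' T A)"
proof -
  have typed: "(if B' = B \<and> A = Y i then f (i - k) \<cdot> at v B T (X (i - k)) (i - k)
      else Zero B' T A) \<in> Hom B' T A"
    if "position B' T A" for B' T A i v
    using that gfamD(2)[OF f, of i] at_Hom[of B T "X (i - k)" v "i - k"] gfamD(3)[OF f]
    by (auto intro: Comp_Hom Zero_position simp: position_B)
  define F where "F v = Gelem (\<lambda>B' T A i. if position B' T A
      then if B' = B \<and> A = Y i then f (i - k) \<cdot> at v B T (X (i - k)) (i - k) else Zero B' T A
      else undefined)" for v
  have at_F: "at (F v) B' T A i = (if B' = B \<and> A = Y i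
      then f (i - k) \<cdot> at v B T (X (i - k)) (i - k) else Zero B' T A)"
    if "position B' T A" for B' T A i v
    unfolding F_def using that typed by (subst at_Gelem) auto
  have "F (v + w) = F v + F w" for v w
  proof (rule gelem_eqI)
    fix B' :: "('o, 'a) ab_category" and T A i assume P: "position B' T A"
    have "Add B' (Zero B' T A) (Zero B' T A) = Zero B' T A"
      using comm_groupE(5)[OF position_group[OF P]] Zero_position[OF P] by (metis hom_group_simps)
    moreover have "f (i - k) \<cdot> Add B (at v B T (X (i - k)) (i - k)) (at w B T (X (i - k)) (i - k))
        = Add B (f (i - k) \<cdot> at v B T (X (i - k)) (i - k)) (f (i - k) \<cdot> at w B T (X (i - k)) (i - k))"
      if "T \<in> Obj B"
      by (rule Comp_Add_right[OF at_Hom at_Hom gfamD(2)[OF f]])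
        (use that gfamD[OF f] in \<open>simp_all add: position_B\<close>)
    ultimately show "at (F (v + w)) B' T A i = at (F v + F w) B' T A i"
      using P gfamD(3)[OF f]
      by (cases "B' = B \<and> A = Y i") (auto simp: at_F at_ops position_B)
  qed
  then have "app (rep B X Y k f) = F"
    unfolding rep_def F_def[symmetric] by (rule app_Endo)
  then show ?thesis using at_F[OF P] by simp
qed

lemma rep_add:
  assumes f: "gfam X Y k f" and g: "gfam X Y k g"
  shows "gfam X Y k (\<lambda>i. Add B (f i) (g i))"
    and "rep B X Y k (\<lambda>i. Add B (f i) (g i)) = rep B X Y k f + rep B X Y k g"
proof -
  show fg: "gfam X Y k (\<lambda>i. Add B (f i) (g i))"
    using f g by (auto simp: gfam_def intro: Add_Hom)
  show "rep B X Y k (\<lambda>i. Add B (f i) (g i)) = rep B X Y k f + rep B X Y k g"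
  proof (intro endo_eqI gelem_eqI)
    fix v and B' :: "('o, 'a) ab_category" and T A i assume P: "position B' T A"
    have "Add B' (Zero B' T A) (Zero B' T A) = Zero B' T A"
      using comm_groupE(5)[OF position_group[OF P]] Zero_position[OF P] by (metis hom_group_simps)
    moreover have "Add B (f (i - k)) (g (i - k)) \<cdot> at v B T (X (i - k)) (i - k)
       = Add B (f (i - k) \<cdot> at v B T (X (i - k)) (i - k)) (g (i - k) \<cdot> at v B T (X (i - k)) (i - k))"
      if "T \<in> Obj B"
      by (rule Comp_Add_left[OF at_Hom gfamD(2)[OF f] gfamD(2)[OF g]])
        (use that gfamD[OF f] in \<open>simp add: position_B\<close>)
    ultimately show "at (app (rep B X Y k (\<lambda>i. Add B (f i) (g i))) v) B' T A i
        = at (app (rep B X Y k f + rep B X Y k g) v) B' T A i"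
      using P by (cases "B' = B \<and> A = Y i") (auto simp: app_rep f g fg app_ops at_ops position_B)
  qed
qed

lemma rep_zero:
  assumes "gobj X" "gobj Y"
  shows "gfam X Y k (\<lambda>i. Zero B (X i) (Y (i + k)))"
    and "rep B X Y k (\<lambda>i. Zero B (X i) (Y (i + k))) = 0"
proof -
  show z: "gfam X Y k (\<lambda>i. Zero B (X i) (Y (i + k)))"
    using assms by (auto simp: gfam_def gobj_def intro: Zero_Hom)
  have "Add B (Zero B (X i) (Y (i + k))) (Zero B (X i) (Y (i + k))) = Zero B (X i) (Y (i + k))" for i
    by (rule Add_Zero[OF gfamD(1)[OF z]])
  then show "rep B X Y k (\<lambda>i. Zero B (X i) (Y (i + k))) = 0"
    using rep_add(2)[OF z z] by simp
qed

lemma rep_comp: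
  assumes f: "gfam X Y k f" and g: "gfam Y Z l g" and m: "m = k + l"
  shows "gfam X Z m (\<lambda>i. g (i + k) \<cdot> f i)"
    and "rep B X Z m (\<lambda>i. g (i + k) \<cdot> f i) = rep B Y Z l g * rep B X Y k f"
proof -
  show gf: "gfam X Z m (\<lambda>i. g (i + k) \<cdot> f i)"
    using f g unfolding gfam_def m by (auto intro: Comp_Hom simp: add.assoc[symmetric])
  show "rep B X Z m (\<lambda>i. g (i + k) \<cdot> f i) = rep B Y Z l g * rep B X Y k f"
  proof (intro endo_eqI gelem_eqI)
    fix v and B' :: "('o, 'a) ab_category" and T A i assume P: "position B' T A"
    have i: "i - m = i - l - k" "i - l - k + k = i - l" by (simp_all add: m)
    have "(g (i - l) \<cdot> f (i - l - k)) \<cdot> at v B T (X (i - l - k)) (i - l - k)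
        = g (i - l) \<cdot> f (i - l - k) \<cdot> at v B T (X (i - l - k)) (i - l - k)"
      if "T \<in> Obj B"
      by (rule Comp_assoc[OF at_Hom gfamD(2)[OF f] gfamD(2)[OF g]])
        (use that gfamD[OF f] in \<open>simp add: position_B\<close>)
    then show "at (app (rep B X Z m (\<lambda>i. g (i + k) \<cdot> f i)) v) B' T A i
        = at (app (rep B Y Z l g * rep B X Y k f) v) B' T A i"
      using P gfamD(3)[OF g]
      by (cases "B' = B \<and> A = Z i") (auto simp: app_rep f g gf app_ops position_B i)
  qed
qed

lemma rep_unit: "gobj X \<Longrightarrow> gfam X X 0 (\<lambda>i. Ident B (X i))"
  by (simp add: gfam_def gobj_def Ident_Hom)

text \<open>As in the Yoneda lemma, \<open>f\<close> is recovered from its action on identities.\<close>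

lemma rep_inject:
  assumes f: "gfam X Y k f" and g: "gfam X Y k g" and eq: "rep B X Y k f = rep B X Y k g"
  shows "f = g"
proof
  fix j
  define v where "v = Gelem (\<lambda>B' T A i. if position B' T A
    then if B' = B \<and> T = A then Ident B T else Zero B' T A else undefined)"
  have X: "X j \<in> Obj B" by (rule gfamD(3)[OF f])
  have "at v B (X j) (X j) j = Ident B (X j)"
    unfolding v_def using X
    by (subst at_Gelem) (auto simp: Zero_position position_B Ident_Hom)
  then show "f j = g j"
    using arg_cong[OF eq, of "\<lambda>r. at (app r v) B (X j) (Y (j + k)) (j + k)"] X
      Ident_right[OF gfamD(1)[OF f]] Ident_right[OF gfamD(1)[OF g]]
    by (simp add: app_rep f g position_B gfamD(4)[OF f])
qed

lemma rep_finprod: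
  assumes X: "gobj X" "gobj Y" and "finite J" and f: "\<And>j. j \<in> J \<Longrightarrow> gfam X Y k (f j)"
  shows "gfam X Y k (\<lambda>i. finprod (hom_group B (X i) (Y (i + k))) (\<lambda>j. f j i) J) \<and>
    rep B X Y k (\<lambda>i. finprod (hom_group B (X i) (Y (i + k))) (\<lambda>j. f j i) J)
      = (\<Sum>j\<in>J. rep B X Y k (f j))"
  using assms(3) f
proof (induction J)
  case empty
  have "finprod (hom_group B (X i) (Y (i + k))) (\<lambda>j. f j i) {} = Zero B (X i) (Y (i + k))" for i
    by (simp add: comm_monoid.finprod_empty[OF comm_group.axioms(1)[OF hom_comm_group]]
        hom_group_simps X[unfolded gobj_def])
  then show ?case using rep_zero[OF X] by simp
next
  case (insert j J)
  have "finprod (hom_group B (X i) (Y (i + k))) (\<lambda>j. f j i) (insert j J)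
      = Add B (f j i) (finprod (hom_group B (X i) (Y (i + k))) (\<lambda>j. f j i) J)" for i
  proof -
    interpret H: comm_group "hom_group B (X i) (Y (i + k))"
      using X by (intro hom_comm_group) (simp_all add: gobj_def)
    show ?thesis
      using insert.hyps insert.prems gfamD(1)
      by (subst H.finprod_insert) (auto simp: hom_group_simps)
  qed
  then show ?case using insert rep_add[of X Y k "f j"] by simp
qed

subsection \<open>Typing rules\<close>

lemma G_obj: "f \<in> G X Y k \<Longrightarrow> gobj X" "f \<in> G X Y k \<Longrightarrow> gobj Y"
  by (auto simp: G_def gfam_def)

lemma G_rep: "gfam X Y k f \<Longrightarrow> rep B X Y k f \<in> G X Y k"
  by (auto simp: G_def)

lemma G_E: assumes "r \<in> G X Y k" obtains f where "gfam X Y k f" "r = rep B X Y k f"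
  using assms by (auto simp: G_def)

lemma G_zero: "gobj X \<Longrightarrow> gobj Y \<Longrightarrow> 0 \<in> G X Y k"
  using rep_zero[of X Y k] G_rep by metis

lemma G_add: "f \<in> G X Y k \<Longrightarrow> g \<in> G X Y k \<Longrightarrow> f + g \<in> G X Y k"
proof (elim G_E)
  fix g' f' assume "gfam X Y k g'" "g = rep B X Y k g'" "gfam X Y k f'" "f = rep B X Y k f'"
  then show ?thesis using rep_add[of X Y k f' g'] G_rep[of X Y k] by metis
qed

lemma G_mult: "g \<in> G Y Z l \<Longrightarrow> f \<in> G X Y k \<Longrightarrow> m = k + l \<Longrightarrow> g * f \<in> G X Z m"
proof (elim G_E)
  fix g' f' assume "m = k + l" "gfam Y Z l g'" "g = rep B Y Z l g'" "gfam X Y k f'" "f = rep B X Y k f'"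
  then show ?thesis using rep_comp[of X Y k f' Z l g' m] G_rep[of X Z m] by metis
qed

lemma G_unit: "gobj X \<Longrightarrow> unit X \<in> G X X 0"
  by (intro G_rep rep_unit)

lemma unit_left: "f \<in> G X Y k \<Longrightarrow> unit Y * f = f"
proof (elim G_E, goal_cases)
  case (1 f')
  have "Ident B (Y (i + k)) \<cdot> f' i = f' i" for i
    by (rule Ident_left[OF gfamD(1)[OF 1(1)]])
  then show ?case
    using rep_comp(2)[OF 1(1) rep_unit, of k] 1 by (simp add: gfam_def)
qed

lemma unit_right: "f \<in> G X Y k \<Longrightarrow> f * unit X = f"
proof (elim G_E, goal_cases)
  case (1 f')
  have "f' i \<cdot> Ident B (X i) = f' i" for i
    by (rule Ident_right[OF gfamD(1)[OF 1(1)]])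
  then show ?case
    using rep_comp(2)[OF rep_unit 1(1), of k] 1 by (simp add: gfam_def)
qed

lemma G_uminus:
  assumes "f \<in> G X Y k" shows "- f \<in> G X Y k"
proof -
  obtain f' where f': "gfam X Y k f'" "f = rep B X Y k f'" using assms by (elim G_E)
  define g where "g i = m_inv (hom_group B (X i) (Y (i + k))) (f' i)" for i
  have P: "position B (X i) (Y (i + k))" for i using gfamD[OF f'(1)] by (simp add: position_B)
  have g: "gfam X Y k g"
    using f'(1) inv_position[OF P] by (auto simp: gfam_def g_def)
  have "Add B (g i) (f' i) = Zero B (X i) (Y (i + k))" for i
    using group.l_inv[OF comm_group.axioms(2)[OF position_group[OF P]]] gfamD(1)[OF f'(1)]
    unfolding g_def by (metis hom_group_simps)
  then have "rep B X Y k g + f = 0"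
    using rep_add(2)[OF g f'(1)] rep_zero(2)[of X Y k] f' by (simp add: gfam_def)
  then have "- f = rep B X Y k g" by (simp add: eq_neg_iff_add_eq_0[symmetric])
  then show ?thesis using G_rep[OF g] by simp
qed

lemma G_diff: "f \<in> G X Y k \<Longrightarrow> g \<in> G X Y k \<Longrightarrow> f - g \<in> G X Y k"
  using G_add[OF _ G_uminus, of f X Y k g] by simp

lemma G_sum:
  "gobj X \<Longrightarrow> gobj Y \<Longrightarrow> (\<And>j. j \<in> J \<Longrightarrow> f j \<in> G X Y k) \<Longrightarrow> (\<Sum>j\<in>J. f j) \<in> G X Y k"
  by (induction J rule: infinite_finite_induct) (auto intro: G_add G_zero)

lemma G_power_mult: "a \<in> G Y Y 1 \<Longrightarrow> s \<in> G X Y k \<Longrightarrow> m = k + int n \<Longrightarrow> a ^ n * s \<in> G X Y m"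
proof (induction n arbitrary: m)
  case (Suc n)
  have "a * (a ^ n * s) \<in> G X Y m"
    by (rule G_mult[OF Suc.prems(1) Suc.IH[OF Suc.prems(1,2) refl]]) (simp add: Suc.prems(3))
  then show ?case by (simp add: mult.assoc)
qed simp

lemma G_mult_power:
  assumes "s \<in> G X Y k" "b \<in> G X X 1"
  shows "m = k + int n \<Longrightarrow> s * b ^ n \<in> G X Y m"
proof (induction n arbitrary: m)
  case (Suc n)
  have "(s * b ^ n) * b \<in> G X Y m"
    by (rule G_mult[OF Suc.IH[OF refl] assms(2)]) (simp add: Suc.prems)
  then show ?case by (simp add: mult.assoc power_commutes)
qed (simp add: assms)

lemma G_hsum:
  assumes "a \<in> G Y Y 1" "b \<in> G X X 1" "s \<in> G X Y k" 
  shows "m = k + int n - 1 \<Longrightarrow> hsum a b s n \<in> G X Y m"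
proof (induction n arbitrary: m)
  case 0
  then show ?case using assms by (auto intro: G_zero G_obj)
next
  case (Suc n)
  have "a * hsum a b s n \<in> G X Y m"
    by (rule G_mult[OF assms(1) Suc.IH[OF refl]]) (simp add: Suc.prems)
  moreover have "s * b ^ n \<in> G X Y m"
    by (rule G_mult_power[OF assms(3,2)]) (simp add: Suc.prems)
  ultimately show ?case by (simp add: G_add)
qed

subsection \<open>Biproducts and shifts of graded objects\<close>

lemma graded_zero_object: "\<exists>S. gobj S \<and> unit S = 0"
proof -
  obtain Z where Z: "is_zero_object B Z" using ex_zero_object by blast
  then have O: "gobj (\<lambda>i. Z)" by (simp add: gobj_def is_zero_object_def)
  have "Ident B Z = Zero B Z Z"
    using Z Ident_Hom[of Z] Zero_Hom[of Z Z] by (auto simp: is_zero_object_def)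
  then have "unit (\<lambda>i. Z) = 0" using rep_zero(2)[OF O O, of 0] by simp
  then show ?thesis using O by blast
qed

lemma graded_biproduct:
  assumes "gobj X" "gobj Y"
  shows "\<exists>S i j p q. i \<in> G X S 0 \<and> j \<in> G Y S 0 \<and> p \<in> G S X 0 \<and> q \<in> G S Y 0 \<and>
    p * i = unit X \<and> q * j = unit Y \<and> p * j = 0 \<and> q * i = 0 \<and> i * p + j * q = unit S"
proof -
  have "\<forall>n. \<exists>S i j p q. is_biproduct B (X n) (Y n) S i j p q"
    using assms ex_biproduct by (auto simp: gobj_def)
  then obtain S i j p q where bp: "\<And>n. is_biproduct B (X n) (Y n) (S n) (i n) (j n) (p n) (q n)"
    by metis
  note D = bp[unfolded is_biproduct_def]
  have S: "gobj S" using D by (simp add: gobj_def)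
  have fam: "gfam X S 0 i" "gfam Y S 0 j" "gfam S X 0 p" "gfam S Y 0 q"
    using D S assms by (auto simp: gfam_def)
  note c = rep_comp[where m = 0 and k = 0 and l = 0, simplified]
  have "rep B S X 0 p * rep B X S 0 i = unit X" "rep B S Y 0 q * rep B Y S 0 j = unit Y"
    "rep B S X 0 p * rep B Y S 0 j = 0" "rep B S Y 0 q * rep B X S 0 i = 0"
    "rep B X S 0 i * rep B S X 0 p + rep B Y S 0 j * rep B S Y 0 q = unit S"
    using D rep_zero(2)[OF assms, of 0] rep_zero(2)[OF assms(2,1), of 0]
    using rep_add(2)[OF c(1)[OF fam(3,1)] c(1)[OF fam(4,2)], symmetric]
    by (simp_all add: c(2)[symmetric] fam)
  then show ?thesis using G_rep[OF fam(1)] G_rep[OF fam(2)] G_rep[OF fam(3)] G_rep[OF fam(4)]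
    by blast
qed

definition shifted :: "int \<Rightarrow> (int \<Rightarrow> 'o) \<Rightarrow> int \<Rightarrow> 'o" where
  "shifted m X i = X (i + m)"

abbreviation from_shift :: "int \<Rightarrow> (int \<Rightarrow> 'o) \<Rightarrow> ('o, 'a) gelem endo" where
  "from_shift m X \<equiv> rep B (shifted m X) X m (\<lambda>i. Ident B (X (i + m)))"

abbreviation to_shift :: "int \<Rightarrow> (int \<Rightarrow> 'o) \<Rightarrow> ('o, 'a) gelem endo" where
  "to_shift m X \<equiv> rep B X (shifted m X) (- m) (\<lambda>i. Ident B (X i))"

lemma shift_maps:
  assumes "gobj X"
  shows "gobj (shifted m X)" "gfam (shifted m X) X m (\<lambda>i. Ident B (X (i + m)))"
    "gfam X (shifted m X) (- m) (\<lambda>i. Ident B (X i))"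
    "from_shift m X \<in> G (shifted m X) X m" "to_shift m X \<in> G X (shifted m X) (- m)"
    "from_shift m X * to_shift m X = unit X" "to_shift m X * from_shift m X = unit (shifted m X)"
proof -
  show s: "gobj (shifted m X)" using assms by (simp add: gobj_def shifted_def)
  show d: "gfam (shifted m X) X m (\<lambda>i. Ident B (X (i + m)))"
    and r: "gfam X (shifted m X) (- m) (\<lambda>i. Ident B (X i))"
    using s assms by (auto simp: gfam_def shifted_def gobj_def Ident_Hom)
  then show "from_shift m X \<in> G (shifted m X) X m" "to_shift m X \<in> G X (shifted m X) (- m)"
    by (auto intro: G_rep)
  have id: "Ident B (X i) \<cdot> Ident B (X i) = Ident B (X i)" for i
    using assms by (intro Ident_left[OF Ident_Hom]) (simp add: gobj_def)
  show "from_shift m X * to_shift m X = unit X" "to_shift m X * from_shift m X = unit (shifted m X)"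
    using id by (simp_all add: rep_comp(2)[OF r d refl, symmetric] rep_comp(2)[OF d r refl, symmetric]
        shifted_def)
qed

text \<open>\<open>S\<close> is in degree \<open>j\<close> the direct sum of the objects \<open>X (j + k)\<close> for \<open>k \<in> K\<close>. For
  \<open>K = {0, \<dots>, N - 1}\<close> this is the graded object that underlies \<open>I X\<close>, for \<open>K = {1, \<dots>, N - 1}\<close> the one
  that underlies \<open>\<Sigma>X\<close>.\<close>

definition window_sum :: "(int \<Rightarrow> 'o) \<Rightarrow> nat set \<Rightarrow> (int \<Rightarrow> 'o) \<Rightarrow> (nat \<Rightarrow> ('o, 'a) gelem endo) \<Rightarrow>
    (nat \<Rightarrow> ('o, 'a) gelem endo) \<Rightarrow> bool" where
  "window_sum X K S p i \<longleftrightarrow> gobj S \<and> (\<forall>k\<in>K. p k \<in> G S X (int k) \<and> i k \<in> G X S (- int k)) \<and>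
    (\<forall>k\<in>K. \<forall>l\<in>K. p k * i l = (if k = l then unit X else 0)) \<and> (\<Sum>k\<in>K. i k * p k) = unit S"

lemma mult_mult_eq:
  fixes x y z t c :: "('o, 'a) gelem endo"
  assumes "y * z = c"
  shows "(x * y) * (z * t) = x * (c * t)"
  by (simp add: assms[symmetric] mult.assoc)

lemma window_sum_exists:
  assumes X: "gobj X" and "finite K"
  shows "\<exists>S p i. window_sum X K S p i"
  using assms(2)
proof (induction K)
  case empty
  show ?case using graded_zero_object by (auto simp: window_sum_def)
next
  case (insert k K)
  then obtain S p i where S: "window_sum X K S p i" by blast
  let ?Y = "shifted (int k) X" and ?r = "to_shift (int k) X" and ?e = "from_shift (int k) X"
  note Y = shift_maps[OF X, of "int k"]
  obtain S' a b u v where bp: "a \<in> G S S' 0" "b \<in> G ?Y S' 0" "u \<in> G S' S 0" "v \<in> G S' ?Y 0"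
    "u * a = unit S" "v * b = unit ?Y" "u * b = 0" "v * a = 0" "a * u + b * v = unit S'"
    using graded_biproduct[of S ?Y] S Y(1) by (auto simp: window_sum_def)
  define p' where "p' = (\<lambda>l. if l = k then ?e * v else p l * u)"
  define i' where "i' = (\<lambda>l. if l = k then b * ?r else a * i l)"
  have typed: "p' l \<in> G S' X (int l) \<and> i' l \<in> G X S' (- int l)" if "l \<in> insert k K" for l
    using that S bp Y by (auto simp: p'_def i'_def window_sum_def intro: G_mult)
  have prod: "p' l * i' m = (if l = m then unit X else 0)" if "l \<in> insert k K" "m \<in> insert k K" for l m
  proof -
    have "p l * i m = (if l = m then unit X else 0)" if "l \<noteq> k" "m \<noteq> k"
      using S that \<open>l \<in> _\<close> \<open>m \<in> _\<close> by (auto simp: window_sum_def)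
    moreover have "unit S * i m = i m" if "m \<noteq> k"
      using S that \<open>m \<in> _\<close> by (auto simp: window_sum_def intro: unit_left)
    ultimately show ?thesis
      using Y(6) unit_left[OF Y(5)]
      by (auto simp: p'_def i'_def mult_mult_eq[OF bp(5)] mult_mult_eq[OF bp(6)]
          mult_mult_eq[OF bp(7)] mult_mult_eq[OF bp(8)])
  qed
  have "(\<Sum>l\<in>insert k K. i' l * p' l) = b * (?r * ?e) * v + (\<Sum>l\<in>K. a * (i l * p l) * u)"
    using insert.hyps by (auto simp: p'_def i'_def mult.assoc intro!: sum.cong)
  also have "\<dots> = b * v + a * (\<Sum>l\<in>K. i l * p l) * u"
    using unit_right[OF bp(2)] by (simp add: Y(7) sum_distrib_left sum_distrib_right)
  also have "\<dots> = unit S'"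
    using S bp(9) unit_right[OF bp(1)] by (simp add: window_sum_def add.commute)
  finally have "window_sum X (insert k K) S' p' i'"
    using typed prod G_obj(2)[OF bp(1)] by (simp add: window_sum_def)
  then show ?case by blast
qed

end

section \<open>Complexes, chain maps and homotopies as operators\<close>

locale ncomplexes = graded B for B :: "('o, 'a) ab_category" (structure) +
  fixes N :: nat
  assumes two_le_N: "2 \<le> N"
begin

abbreviation \<C> :: "(('o, 'a) ncomplex, ('o, 'a) chain_map) ab_category" where
  "\<C> \<equiv> CN N B"

abbreviation cx :: "('o, 'a) ncomplex \<Rightarrow> bool" where
  "cx \<equiv> is_ncomplex N B"

abbreviation D :: "('o, 'a) ncomplex \<Rightarrow> ('o, 'a) gelem endo" where
  "D X \<equiv> rep B (cob X) (cob X) 1 (diff X)"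

abbreviation E :: "('o, 'a) ncomplex \<Rightarrow> ('o, 'a) gelem endo" where
  "E X \<equiv> unit (cob X)"

definition op_of :: "('o, 'a) chain_map \<Rightarrow> ('o, 'a) gelem endo" where
  "op_of f = rep B (cob (src f)) (cob (tgt f)) 0 (cmp f)"

definition Ch :: "('o, 'a) ncomplex \<Rightarrow> ('o, 'a) ncomplex \<Rightarrow> ('o, 'a) gelem endo set" where
  "Ch X Y = {f. cx X \<and> cx Y \<and> f \<in> G (cob X) (cob Y) 0 \<and> D Y * f = f * D X}"

definition Nh :: "('o, 'a) ncomplex \<Rightarrow> ('o, 'a) ncomplex \<Rightarrow> ('o, 'a) gelem endo set" where
  "Nh X Y = {hsum (D Y) (D X) s N |s. s \<in> G (cob X) (cob Y) (1 - int N)}"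

lemma cx_diff: "cx X \<Longrightarrow> gobj (cob X)" "cx X \<Longrightarrow> gfam (cob X) (cob X) 1 (diff X)"
  "cx X \<Longrightarrow> D X \<in> G (cob X) (cob X) 1"
proof -
  show *: "cx X \<Longrightarrow> gobj (cob X)" by (simp add: is_ncomplex_def gobj_def)
  then show "cx X \<Longrightarrow> gfam (cob X) (cob X) 1 (diff X)" by (simp add: is_ncomplex_def gfam_def)
  then show "cx X \<Longrightarrow> D X \<in> G (cob X) (cob X) 1" by (rule G_rep)
qed

lemma dpow_rep:
  assumes "gfam (cob X) (cob X) 1 (diff X)"
  shows "gfam (cob X) (cob X) (int k) (\<lambda>i. dpow B X i k) \<and>
    rep B (cob X) (cob X) (int k) (\<lambda>i. dpow B X i k) = D X ^ k * E X"
proof (induction k)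
  case 0
  show ?case using assms rep_unit[of "cob X"] by (simp add: gfam_def)
next
  case (Suc k)
  have "int (Suc k) = int k + 1" by simp
  from rep_comp[OF conjunct1[OF Suc] assms this] show ?case
    using Suc by (simp add: mult.assoc)
qed

lemma D_power_N: assumes "cx X" shows "D X ^ N = 0"
proof -
  note d = cx_diff[OF assms]
  have "D X ^ N * E X = rep B (cob X) (cob X) (int N) (\<lambda>i. dpow B X i N)"
    using dpow_rep[OF d(2)] by simp
  also have "\<dots> = rep B (cob X) (cob X) (int N) (\<lambda>i. Zero B (cob X i) (cob X (i + int N)))"
    using assms by (simp add: is_ncomplex_def)
  finally have 0: "D X ^ N * E X = 0" using rep_zero(2)[OF d(1,1)] by simp
  have "D X * E X = D X" by (rule unit_right[OF d(3)])
  then have "D X ^ N * E X = D X ^ N"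
    using two_le_N by (cases N) (simp_all add: power_Suc2 mult.assoc del: power_Suc)
  then show ?thesis using 0 by simp
qed

text \<open>The converse of \<open>D_power_N\<close>: a complex can be built from a single nilpotent operator.\<close>

lemma cx_intro:
  assumes d: "gfam S S 1 d" and "rep B S S 1 d ^ N = 0"
  shows "cx \<lparr>cob = S, diff = d\<rparr>"
proof -
  let ?X = "\<lparr>cob = S, diff = d\<rparr>"
  have S: "gobj S" using d by (simp add: gfam_def)
  have p: "gfam S S (int N) (\<lambda>i. dpow B ?X i N)" "rep B S S (int N) (\<lambda>i. dpow B ?X i N) = 0"
    using dpow_rep[of ?X N] assms by simp_all
  have "(\<lambda>i. dpow B ?X i N) = (\<lambda>i. Zero B (S i) (S (i + int N)))"
    by (rule rep_inject[OF p(1) rep_zero(1)[OF S S]]) (simp only: p(2) rep_zero(2)[OF S S])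
  then show ?thesis
    using d S by (auto simp: is_ncomplex_def gfam_def gobj_def fun_eq_iff)
qed

lemma CN_simps:
  "Comp \<C> g f = \<lparr>src = src f, tgt = tgt g, cmp = (\<lambda>i. cmp g i \<cdot> cmp f i)\<rparr>"
  "Ident \<C> X = \<lparr>src = X, tgt = X, cmp = (\<lambda>i. Ident B (cob X i))\<rparr>"
  "Zero \<C> X Y = \<lparr>src = X, tgt = Y, cmp = (\<lambda>i. Zero B (cob X i) (cob Y i))\<rparr>"
  "Add \<C> f g = \<lparr>src = src f, tgt = tgt f, cmp = (\<lambda>i. Add B (cmp f i) (cmp g i))\<rparr>"
  by (simp_all add: CN_def)

lemma Hom_CN: "f \<in> Hom \<C> X Y \<longleftrightarrow> src f = X \<and> tgt f = Y \<and> is_chain_map N B f"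
  by (auto simp: Hom_def CN_def)

lemma Obj_CN: "X \<in> Obj \<C> \<longleftrightarrow> cx X"
  by (simp add: CN_def)

lemma is_chain_map_iff:
  "is_chain_map N B f \<longleftrightarrow> cx (src f) \<and> cx (tgt f) \<and> gfam (cob (src f)) (cob (tgt f)) 0 (cmp f)
    \<and> D (tgt f) * op_of f = op_of f * D (src f)" (is "_ = (_ \<and> _ \<and> ?F \<and> _)")
proof -
  have "(\<forall>i. diff (tgt f) i \<cdot> cmp f i = cmp f (i + 1) \<cdot> diff (src f) i)
      \<longleftrightarrow> D (tgt f) * op_of f = op_of f * D (src f)"
    if "cx (src f)" "cx (tgt f)" "gfam (cob (src f)) (cob (tgt f)) 0 (cmp f)"
    unfolding op_of_def
    using rep_comp[OF that(3) cx_diff(2)[OF that(2)], of 1]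
      rep_comp[OF cx_diff(2)[OF that(1)] that(3), of 1] rep_inject
    by (fastforce simp: fun_eq_iff)
  moreover have "?F \<longleftrightarrow> (\<forall>i. cmp f i \<in> Hom B (cob (src f) i) (cob (tgt f) i))"
    if "cx (src f)" "cx (tgt f)"
    using that by (simp add: gfam_def cx_diff)
  ultimately show ?thesis unfolding is_chain_map_def by blast
qed

lemma chain_map_gfam: "f \<in> Hom \<C> X Y \<Longrightarrow> gfam (cob X) (cob Y) 0 (cmp f)"
  by (auto simp: Hom_CN is_chain_map_iff)

lemma op_of_chain: "f \<in> Hom \<C> X Y \<Longrightarrow> op_of f \<in> Ch X Y"
  using G_rep by (auto simp: Hom_CN is_chain_map_iff Ch_def op_of_def)

lemma op_of_inject:
  assumes f: "f \<in> Hom \<C> X Y" and g: "g \<in> Hom \<C> X Y" and "op_of f = op_of g"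
  shows "f = g"
proof -
  have "cmp f = cmp g"
    using rep_inject[OF chain_map_gfam[OF f] chain_map_gfam[OF g]] assms
    by (simp add: op_of_def Hom_CN)
  then show ?thesis using f g by (simp add: Hom_CN)
qed

lemma op_of_surj:
  assumes "r \<in> Ch X Y" obtains f where "f \<in> Hom \<C> X Y" "op_of f = r"
proof -
  obtain c where c: "gfam (cob X) (cob Y) 0 c" "r = rep B (cob X) (cob Y) 0 c"
    using assms by (auto simp: Ch_def elim: G_E)
  have "op_of \<lparr>src = X, tgt = Y, cmp = c\<rparr> = r" by (simp add: op_of_def c)
  then show ?thesis
    using assms c by (intro that[of "\<lparr>src = X, tgt = Y, cmp = c\<rparr>"])
      (auto simp: Hom_CN is_chain_map_iff Ch_def)
qed

lemma Ch_D: assumes "f \<in> Ch X Y"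
  shows "cx X" "cx Y" "f \<in> G (cob X) (cob Y) 0" "D Y * f = f * D X" "E Y * f = f" "f * E X = f"
  using assms unit_left unit_right by (auto simp: Ch_def)

lemma D_typed: assumes "cx X"
  shows "E X * D X = D X" "D X * E X = D X" "E X * E X = E X"
  using unit_left[OF cx_diff(3)[OF assms]] unit_right[OF cx_diff(3)[OF assms]]
    unit_left[OF G_unit[OF cx_diff(1)[OF assms]]] by auto

lemma Ch_mult: "g \<in> Ch Y Z \<Longrightarrow> f \<in> Ch X Y \<Longrightarrow> g * f \<in> Ch X Z"
proof -
  assume g: "g \<in> Ch Y Z" and f: "f \<in> Ch X Y"
  have "D Z * (g * f) = g * f * D X"
    by (simp add: mult.assoc[symmetric] Ch_D(4)[OF g]) (simp add: mult.assoc Ch_D(4)[OF f])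
  then show "g * f \<in> Ch X Z"
    using g f G_mult[OF Ch_D(3)[OF g] Ch_D(3)[OF f], of 0] by (simp add: Ch_def)
qed

lemma Ch_unit: "cx X \<Longrightarrow> E X \<in> Ch X X"
  by (simp add: Ch_def D_typed G_unit cx_diff)

lemma Ch_zero: "cx X \<Longrightarrow> cx Y \<Longrightarrow> 0 \<in> Ch X Y"
  by (simp add: Ch_def G_zero cx_diff)

lemma Ch_add: "f \<in> Ch X Y \<Longrightarrow> g \<in> Ch X Y \<Longrightarrow> f + g \<in> Ch X Y"
  by (auto simp: Ch_def G_add algebra_simps)

lemma Ch_diff: "f \<in> Ch X Y \<Longrightarrow> g \<in> Ch X Y \<Longrightarrow> f - g \<in> Ch X Y"
  by (auto simp: Ch_def G_diff algebra_simps)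

lemma op_of_Comp:
  assumes f: "f \<in> Hom \<C> X Y" and g: "g \<in> Hom \<C> Y Z"
  shows "Comp \<C> g f \<in> Hom \<C> X Z" "op_of (Comp \<C> g f) = op_of g * op_of f"
proof -
  note c = rep_comp[OF chain_map_gfam[OF f] chain_map_gfam[OF g], of 0, simplified]
  show eq: "op_of (Comp \<C> g f) = op_of g * op_of f"
    using c(2) f g by (simp add: op_of_def CN_simps Hom_CN)
  show "Comp \<C> g f \<in> Hom \<C> X Z"
    using c(1) Ch_mult[OF op_of_chain[OF g] op_of_chain[OF f]] f g eq
    by (auto simp: Hom_CN is_chain_map_iff Ch_def) (simp_all add: CN_simps)
qed

lemma op_of_Ident:
  assumes "cx X"
  shows "Ident \<C> X \<in> Hom \<C> X X" "op_of (Ident \<C> X) = E X"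
proof -
  show eq: "op_of (Ident \<C> X) = E X" by (simp add: op_of_def CN_simps)
  show "Ident \<C> X \<in> Hom \<C> X X"
    using Ch_unit[OF assms] eq rep_unit[OF cx_diff(1)[OF assms]]
    by (auto simp: Hom_CN is_chain_map_iff Ch_def) (simp_all add: CN_simps)
qed

lemma op_of_Zero:
  assumes "cx X" "cx Y"
  shows "Zero \<C> X Y \<in> Hom \<C> X Y" "op_of (Zero \<C> X Y) = 0"
proof -
  note z = rep_zero[OF cx_diff(1)[OF assms(1)] cx_diff(1)[OF assms(2)], of 0]
  show eq: "op_of (Zero \<C> X Y) = 0" using z by (simp add: op_of_def CN_simps)
  show "Zero \<C> X Y \<in> Hom \<C> X Y"
    using z(1) assms eq by (auto simp: Hom_CN is_chain_map_iff) (simp_all add: CN_simps)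
qed

lemma op_of_Add:
  assumes f: "f \<in> Hom \<C> X Y" and g: "g \<in> Hom \<C> X Y"
  shows "Add \<C> f g \<in> Hom \<C> X Y" "op_of (Add \<C> f g) = op_of f + op_of g"
proof -
  note c = rep_add[OF chain_map_gfam[OF f] chain_map_gfam[OF g]]
  show eq: "op_of (Add \<C> f g) = op_of f + op_of g"
    using c(2) f g by (simp add: op_of_def CN_simps Hom_CN)
  show "Add \<C> f g \<in> Hom \<C> X Y"
    using c(1) Ch_add[OF op_of_chain[OF f] op_of_chain[OF g]] f g eq
    by (auto simp: Hom_CN is_chain_map_iff Ch_def) (simp_all add: CN_simps)
qed

lemma category_CN: "category \<C>"
proof
  show "Dom \<C> f \<in> Obj \<C>" "Cod \<C> f \<in> Obj \<C>" if "f \<in> Arr \<C>" for f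
    using that by (auto simp: CN_def is_chain_map_def)
  show "Ident \<C> X \<in> Hom \<C> X X" if "X \<in> Obj \<C>" for X
    using that op_of_Ident by (simp add: Obj_CN)
  show "Comp \<C> g f \<in> Hom \<C> X Z"
    if "f \<in> Hom \<C> X Y" "g \<in> Hom \<C> Y Z" for X Y Z f g
    by (rule op_of_Comp(1)[OF that])
  show "Comp \<C> (Comp \<C> h g) f = Comp \<C> h (Comp \<C> g f)"
    if "f \<in> Hom \<C> X Y" "g \<in> Hom \<C> Y Z" "h \<in> Hom \<C> Z W" for X Y Z W f g h
  proof -
    note gf = op_of_Comp[OF that(1,2)] and hg = op_of_Comp[OF that(2,3)]
    show ?thesis
      by (rule op_of_inject[OF op_of_Comp(1)[OF that(1) hg(1)] op_of_Comp(1)[OF gf(1) that(3)]])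
        (simp add: op_of_Comp(2)[OF that(1) hg(1)] op_of_Comp(2)[OF gf(1) that(3)] gf(2) hg(2) mult.assoc)
  qed
  show "Comp \<C> (Ident \<C> Y) f = f" "Comp \<C> f (Ident \<C> X) = f"
    if f: "f \<in> Hom \<C> X Y" for X Y f
  proof -
    note C = Ch_D[OF op_of_chain[OF f]]
    note X = op_of_Ident[OF C(1)] and Y = op_of_Ident[OF C(2)]
    show "Comp \<C> (Ident \<C> Y) f = f"
      by (rule op_of_inject[OF op_of_Comp(1)[OF f Y(1)] f]) (simp add: op_of_Comp(2)[OF f Y(1)] Y(2) C(5))
    show "Comp \<C> f (Ident \<C> X) = f"
      by (rule op_of_inject[OF op_of_Comp(1)[OF X(1) f] f]) (simp add: op_of_Comp(2)[OF X(1) f] X(2) C(6))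
  qed
qed

abbreviation (input) homotopic_family where "homotopic_family X Y s \<equiv> \<lambda>i.
    finprod (hom_group B (cob X i) (cob Y i))
      (\<lambda>j. dpow B Y (i - int N + int j) (N - j) \<cdot> s (i + int j - 1) \<cdot> dpow B X i (j - 1)) {1..N}"

lemma homotopy_rep:
  assumes X: "cx X" and Y: "cx Y" and s: "gfam (cob X) (cob Y) (1 - int N) s"
  defines "h \<equiv> homotopic_family X Y s"
  shows "gfam (cob X) (cob Y) 0 h \<and>
    rep B (cob X) (cob Y) 0 h = hsum (D Y) (D X) (rep B (cob X) (cob Y) (1 - int N) s) N"
proof -
  define t where "t j i = dpow B Y (i - int N + int j) (N - j) \<cdot> s (i + int j - 1) \<cdot> dpow B X i (j - 1)"
    for j i
  let ?s = "rep B (cob X) (cob Y) (1 - int N) s"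
  have t: "gfam (cob X) (cob Y) 0 (t j) \<and>
      rep B (cob X) (cob Y) 0 (t j) = D Y ^ (N - j) * ?s * D X ^ (j - 1)" if j: "j \<in> {1..N}" for j
  proof -
    note dX = dpow_rep[OF cx_diff(2)[OF X], of "j - 1"]
      and dY = dpow_rep[OF cx_diff(2)[OF Y], of "N - j"]
    define m where "m = int (j - 1) + (1 - int N)"
    note sd = rep_comp[OF conjunct1[OF dX] s m_def]
    have "0 = m + int (N - j)" using j by (simp add: m_def of_nat_diff)
    note dsd = rep_comp[OF sd(1) conjunct1[OF dY] this]
    have idx: "i + m = i - int N + int j" "i + int (j - 1) = i + int j - 1" for i
      using j by (simp_all add: m_def of_nat_diff)
    have ss: "?s \<in> G (cob X) (cob Y) (1 - int N)" by (rule G_rep[OF s])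
    have "D X ^ (j - 1) * E X = E X * D X ^ (j - 1)"
      by (rule power_mult_commute) (simp add: D_typed X)
    then have "D Y ^ (N - j) * E Y * (?s * (D X ^ (j - 1) * E X))
        = D Y ^ (N - j) * (E Y * (?s * E X)) * D X ^ (j - 1)"
      by (simp add: mult.assoc)
    moreover have "rep B (cob X) (cob Y) 0 (t j) = D Y ^ (N - j) * E Y * (?s * (D X ^ (j - 1) * E X))"
      using dsd(2) unfolding idx sd(2)[unfolded idx(2)] conjunct2[OF dX] conjunct2[OF dY] t_def[abs_def] .
    moreover have "gfam (cob X) (cob Y) 0 (t j)"
      using dsd(1) unfolding idx t_def[abs_def] .
    ultimately show ?thesis
      by (simp only: unit_left[OF ss] unit_right[OF ss])
  qed
  have "h = (\<lambda>i. finprod (hom_group B (cob X i) (cob Y (i + 0))) (\<lambda>j. t j i) {1..N})"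
    by (simp add: h_def t_def)
  then show ?thesis
    using rep_finprod[OF cx_diff(1)[OF X] cx_diff(1)[OF Y], of "{1..N}" 0 t] t
    by (simp add: hsum_eq_sum)
qed

lemma null_homotopic_iff:
  assumes f: "f \<in> Hom \<C> X Y"
  shows "null_homotopic N B f \<longleftrightarrow> op_of f \<in> Nh X Y"
proof -
  note C = Ch_D[OF op_of_chain[OF f]]
  have st: "src f = X" "tgt f = Y" using f by (auto simp: Hom_CN)
  have gf: "gfam (cob X) (cob Y) (1 - int N) s \<longleftrightarrow>
      (\<forall>i. s i \<in> Hom B (cob X i) (cob Y (i - int N + 1)))" for s
  proof -
    have "i + (1 - int N) = i - int N + 1" for i by simp
    then show ?thesis using C by (simp only: gfam_def cx_diff(1) simp_thms)
  qed
  show ?thesis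
  proof
    assume "null_homotopic N B f"
    then obtain s where s: "gfam (cob X) (cob Y) (1 - int N) s"
      and "\<And>i. cmp f i = homotopic_family X Y s i"
      unfolding null_homotopic_def gf st by blast
    then have "cmp f = homotopic_family X Y s"
      by (intro ext)
    then have "op_of f = hsum (D Y) (D X) (rep B (cob X) (cob Y) (1 - int N) s) N"
      using homotopy_rep[OF C(1,2) s] by (simp only: op_of_def st)
    then show "op_of f \<in> Nh X Y" using G_rep[OF s] by (auto simp: Nh_def)
  next
    assume "op_of f \<in> Nh X Y"
    then obtain s where s: "gfam (cob X) (cob Y) (1 - int N) s"
      and eq: "op_of f = hsum (D Y) (D X) (rep B (cob X) (cob Y) (1 - int N) s) N"
      by (auto simp: Nh_def G_def)
    note h = homotopy_rep[OF C(1,2) s]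
    have "cmp f = homotopic_family X Y s"
      (is "_ = ?h")
      using eq h by (intro rep_inject[OF chain_map_gfam[OF f]]) (simp_all add: op_of_def st)
    then show "null_homotopic N B f"
      unfolding null_homotopic_def st
      by (intro exI[of _ s] conjI s[unfolded gf] allI fun_cong[of "cmp f" ?h])
  qed
qed

lemma Nh_chain:
  assumes "cx X" "cx Y" "h \<in> Nh X Y" shows "h \<in> Ch X Y"
proof -
  obtain s where s: "s \<in> G (cob X) (cob Y) (1 - int N)" "h = hsum (D Y) (D X) s N"
    using assms by (auto simp: Nh_def)
  have "h \<in> G (cob X) (cob Y) 0"
    unfolding s(2) by (rule G_hsum[OF cx_diff(3)[OF assms(2)] cx_diff(3)[OF assms(1)] s(1)]) simp
  moreover have "D Y * h = h * D X"
    unfolding s(2) by (rule hsum_commute) (simp_all add: D_power_N assms)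
  ultimately show ?thesis using assms by (simp add: Ch_def)
qed

lemma Nh_closed:
  assumes "cx X" "cx Y"
  shows "0 \<in> Nh X Y" "h \<in> Nh X Y \<Longrightarrow> k \<in> Nh X Y \<Longrightarrow> h + k \<in> Nh X Y" "h \<in> Nh X Y \<Longrightarrow> - h \<in> Nh X Y"
proof -
  have "hsum (D Y) (D X) 0 N = 0" using hsum_add[of "D Y" "D X" 0 0 N] by simp
  moreover have "0 \<in> G (cob X) (cob Y) (1 - int N)" by (simp add: G_zero cx_diff assms)
  ultimately show "0 \<in> Nh X Y" unfolding Nh_def by (metis (mono_tags, lifting) mem_Collect_eq)
  show "h \<in> Nh X Y \<Longrightarrow> k \<in> Nh X Y \<Longrightarrow> h + k \<in> Nh X Y"
    unfolding Nh_def using G_add hsum_add[symmetric] by blast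
  show "h \<in> Nh X Y \<Longrightarrow> - h \<in> Nh X Y"
    unfolding Nh_def using G_uminus hsum_uminus[symmetric] by blast
qed

lemma Nh_mult_left:
  assumes g: "g \<in> Ch Y Z" and "h \<in> Nh X Y" shows "g * h \<in> Nh X Z"
proof -
  obtain s where s: "s \<in> G (cob X) (cob Y) (1 - int N)" "h = hsum (D Y) (D X) s N"
    using assms by (auto simp: Nh_def)
  have "g * h = hsum (D Z) (D X) (g * s) N"
    unfolding s(2) by (rule mult_hsum) (simp add: Ch_D[OF g])
  moreover have "g * s \<in> G (cob X) (cob Z) (1 - int N)"
    by (rule G_mult[OF Ch_D(3)[OF g] s(1)]) simp
  ultimately show ?thesis by (auto simp: Nh_def)
qed

lemma Nh_mult_right:
  assumes g: "g \<in> Ch W X" and "h \<in> Nh X Y" shows "h * g \<in> Nh W Y"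
proof -
  obtain s where s: "s \<in> G (cob X) (cob Y) (1 - int N)" "h = hsum (D Y) (D X) s N"
    using assms by (auto simp: Nh_def)
  have "h * g = hsum (D Y) (D W) (s * g) N"
    unfolding s(2) by (rule hsum_mult) (simp add: Ch_D[OF g])
  moreover have "s * g \<in> G (cob W) (cob Y) (1 - int N)"
    by (rule G_mult[OF s(1) Ch_D(3)[OF g]]) simp
  ultimately show ?thesis by (auto simp: Nh_def)
qed

lemma homotopy_rel_iff:
  "(f, g) \<in> homotopy_rel N B \<longleftrightarrow> (\<exists>X Y. f \<in> Hom \<C> X Y \<and> g \<in> Hom \<C> X Y \<and>
    op_of f - op_of g \<in> Nh X Y)"
proof -
  have "(\<exists>h \<in> Hom \<C> X Y. null_homotopic N B h \<and> f = Add \<C> g h)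
      \<longleftrightarrow> op_of f - op_of g \<in> Nh X Y"
    if f: "f \<in> Hom \<C> X Y" and g: "g \<in> Hom \<C> X Y" for X Y
  proof
    assume "\<exists>h \<in> Hom \<C> X Y. null_homotopic N B h \<and> f = Add \<C> g h"
    then show "op_of f - op_of g \<in> Nh X Y"
      using op_of_Add(2)[OF g] null_homotopic_iff by auto
  next
    assume nh: "op_of f - op_of g \<in> Nh X Y"
    obtain h where h: "h \<in> Hom \<C> X Y" "op_of h = op_of f - op_of g"
      using Ch_diff[OF op_of_chain[OF f] op_of_chain[OF g]] by (rule op_of_surj)
    have "f = Add \<C> g h"
      using f op_of_Add[OF g h(1)] h(2) by (intro op_of_inject[of f X Y]) simp_all
    then show "\<exists>h \<in> Hom \<C> X Y. null_homotopic N B h \<and> f = Add \<C> g h"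
      using h nh null_homotopic_iff[OF h(1)] by auto
  qed
  then show ?thesis unfolding homotopy_rel_def by blast
qed

section \<open>Split sequences with contractible middle term\<close>

text \<open>Split exactness in each degree, expressed by graded maps \<open>r\<close> and \<open>t\<close> that need not commute
  with the differentials. These sequences are the exact sequences of the Frobenius category of
  complexes.\<close>

definition split_seq :: "('o, 'a) ncomplex \<Rightarrow> ('o, 'a) ncomplex \<Rightarrow> ('o, 'a) ncomplex \<Rightarrow>
    ('o, 'a) gelem endo \<Rightarrow> ('o, 'a) gelem endo \<Rightarrow> bool" where
  "split_seq X S Q u q \<longleftrightarrow> u \<in> Ch X S \<and> q \<in> Ch S Q \<and> q * u = 0 \<and>
    (\<exists>r \<in> G (cob S) (cob X) 0. \<exists>t \<in> G (cob Q) (cob S) 0.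
      r * u = E X \<and> q * t = E Q \<and> u * r + t * q = E S)"

definition contractible :: "('o, 'a) ncomplex \<Rightarrow> bool" where
  "contractible S \<longleftrightarrow> cx S \<and> E S \<in> Nh S S"

lemma split_seqE:
  assumes "split_seq X S Q u q"
  obtains r t where "u \<in> Ch X S" "q \<in> Ch S Q" "q * u = 0" "r \<in> G (cob S) (cob X) 0"
    "t \<in> G (cob Q) (cob S) 0" "r * u = E X" "q * t = E Q" "u * r + t * q = E S"
  using assms unfolding split_seq_def by blast

lemma split_seq_epi:
  assumes "split_seq X S Q u q" "h \<in> G (cob Q) Z k" "h' \<in> G (cob Q) Z k" "h * q = h' * q"
  shows "h = h'"
proof -
  obtain t where "q * t = E Q" using assms(1) by (rule split_seqE)
  then show ?thesis
    using arg_cong[OF assms(4), of "\<lambda>x. x * t"] unit_right[OF assms(2)] unit_right[OF assms(3)]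
    by (simp add: mult.assoc)
qed

text \<open>A split sequence exhibits a cokernel: the factorisation is \<open>g t\<close>, and it commutes with the
  differentials because it does so after composition with the epimorphism \<open>q\<close>.\<close>

lemma split_seq_factor:
  assumes "split_seq X S Q u q" and g: "g \<in> Ch S T" "g * u = 0"
  obtains h where "h \<in> Ch Q T" "h * q = g"
proof -
  obtain r t where s: "u \<in> Ch X S" "q \<in> Ch S Q" "q * u = 0" "r \<in> G (cob S) (cob X) 0"
    "t \<in> G (cob Q) (cob S) 0" "r * u = E X" "q * t = E Q" "u * r + t * q = E S"
    using assms(1) by (rule split_seqE)
  have "g = g * (u * r + t * q)" using s(8) Ch_D(6)[OF g(1)] by simp
  then have gt: "(g * t) * q = g" using g(2) by (simp add: distrib_left mult.assoc[symmetric])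
  have typed: "g * t \<in> G (cob Q) (cob T) 0" by (rule G_mult[OF Ch_D(3)[OF g(1)] s(5)]) simp
  note cx = Ch_D(1,2)[OF g(1)] Ch_D(1,2)[OF s(2)]
  have "D T * (g * t) * q = (g * t) * D Q * q"
  proof -
    have "D T * (g * t) * q = D T * g" by (simp add: mult.assoc) (simp add: mult.assoc[symmetric] gt)
    also have "\<dots> = (g * t * q) * D S" using Ch_D(4)[OF g(1)] by (simp add: gt)
    also have "\<dots> = (g * t) * D Q * q" using Ch_D(4)[OF s(2)] by (simp add: mult.assoc)
    finally show ?thesis .
  qed
  then have "D T * (g * t) = (g * t) * D Q"
    by (rule split_seq_epi[OF assms(1), rotated 2])
      (rule G_mult[OF cx_diff(3)[OF cx(2)] typed] G_mult[OF typed cx_diff(3)[OF cx(4)]], simp)+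
  then have "g * t \<in> Ch Q T" using typed cx by (simp add: Ch_def)
  then show thesis using gt that by blast
qed

lemma contractible_null:
  assumes "contractible S"
  shows "f \<in> Ch X S \<Longrightarrow> f \<in> Nh X S" "g \<in> Ch S X \<Longrightarrow> g \<in> Nh S X"
  using assms Nh_mult_right[of f X S "E S" S] Nh_mult_left[of g S X "E S" S]
  by (auto simp: contractible_def Ch_D(5) Ch_D(6))

text \<open>If \<open>s\<close> is a homotopy for \<open>f\<close> and \<open>r\<close> a degreewise retraction of \<open>u\<close>, then \<open>s r\<close> is the homotopy
  of an extension of \<open>f\<close>. This is the injectivity of contractible complexes.\<close>

lemma null_homotopic_extends:
  assumes "split_seq X S Q u q" and f: "f \<in> Nh X Y" and Y: "cx Y"
  obtains k where "k \<in> Ch S Y" "k * u = f"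
proof -
  obtain r t where s: "u \<in> Ch X S" "r \<in> G (cob S) (cob X) 0" "r * u = E X"
    using assms(1) by (rule split_seqE)
  obtain s' where s': "s' \<in> G (cob X) (cob Y) (1 - int N)" "f = hsum (D Y) (D X) s' N"
    using f by (auto simp: Nh_def)
  have "s' * r \<in> G (cob S) (cob Y) (1 - int N)" by (rule G_mult[OF s'(1) s(2)]) simp
  then have "hsum (D Y) (D S) (s' * r) N \<in> Nh S Y" by (auto simp: Nh_def)
  then have "hsum (D Y) (D S) (s' * r) N \<in> Ch S Y" by (rule Nh_chain[OF Ch_D(2)[OF s(1)] Y])
  moreover have "hsum (D Y) (D S) (s' * r) N * u = f"
    unfolding s'(2) hsum_mult[OF Ch_D(4)[OF s(1)]] by (simp add: mult.assoc s(3) unit_right[OF s'(1)])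
  ultimately show thesis using that by blast
qed

text \<open>Maps into a contractible complex are null-homotopic, so \<open>u' f\<close> extends along \<open>u\<close>.\<close>

lemma split_seq_map:
  assumes 1: "split_seq X S Q u q" and 2: "split_seq X' S' Q' u' q'"
    and S': "contractible S'" and f: "f \<in> Ch X X'"
  obtains k g where "k \<in> Ch S S'" "g \<in> Ch Q Q'" "k * u = u' * f" "g * q = q' * k"
proof -
  have s: "u' \<in> Ch X' S'" "q' \<in> Ch S' Q'" "q' * u' = 0" using 2 by (auto elim: split_seqE)
  have "u' * f \<in> Nh X S'" by (rule contractible_null(1)[OF S' Ch_mult[OF s(1) f]])
  then obtain k where k: "k \<in> Ch S S'" "k * u = u' * f"
    using null_homotopic_extends[OF 1] Ch_D(2)[OF s(1)] by metis
  have "(q' * k) * u = 0" using k s(3) by (simp add: mult.assoc) (simp add: mult.assoc[symmetric])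
  then obtain g where "g \<in> Ch Q Q'" "g * q = q' * k"
    using split_seq_factor[OF 1 Ch_mult[OF s(2) k(1)]] by blast
  then show thesis using k that by blast
qed

text \<open>Applied to differences of maps over \<open>f = 0\<close>, this says that the map induced on the third terms is
  unique up to homotopy. The reason: an extension \<open>k'\<close> of \<open>f\<close> along \<open>u\<close> makes \<open>k - u' k'\<close> vanish on
  \<open>X\<close>, so \<open>g\<close> factors through the contractible complex \<open>S'\<close>.\<close>

lemma split_seq_map_null:
  assumes 1: "split_seq X S Q u q" and 2: "split_seq X' S' Q' u' q'"
    and S': "contractible S'" and f: "f \<in> Nh X X'"
    and k: "k \<in> Ch S S'" "k * u = u' * f" and g: "g \<in> Ch Q Q'" "g * q = q' * k"
  shows "g \<in> Nh Q Q'"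
proof -
  have s: "u' \<in> Ch X' S'" "q' \<in> Ch S' Q'" "q' * u' = 0" using 2 by (auto elim: split_seqE)
  obtain k' where k': "k' \<in> Ch S X'" "k' * u = f"
    using null_homotopic_extends[OF 1 f] Ch_D(1)[OF s(1)] by metis
  have "(k - u' * k') * u = 0" using k(2) k'(2) by (simp add: left_diff_distrib mult.assoc)
  then obtain m where m: "m \<in> Ch Q S'" "m * q = k - u' * k'"
    using split_seq_factor[OF 1 Ch_diff[OF k(1) Ch_mult[OF s(1) k'(1)]]] by blast
  have "g * q = (q' * m) * q"
    using g(2) m(2) s(3) by (simp add: mult.assoc right_diff_distrib) (simp add: mult.assoc[symmetric])
  then have "g = q' * m"
    by (rule split_seq_epi[OF 1 Ch_D(3)[OF g(1)] Ch_D(3)[OF Ch_mult[OF s(2) m(1)]]])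
  then show ?thesis using Nh_mult_left[OF s(2) contractible_null(1)[OF S' m(1)]] by simp
qed

text \<open>The complement \<open>Q\<close> of \<open>X\<close> in \<open>S\<close> inherits the differential \<open>q d t\<close>.\<close>

lemma split_quotient:
  assumes u: "u \<in> Ch X S" and q: "q \<in> G (cob S) Q 0" and r: "r \<in> G (cob S) (cob X) 0"
    and t: "t \<in> G Q (cob S) 0"
    and eqs: "r * u = E X" "q * u = 0" "q * t = unit Q" "u * r + t * q = E S"
  obtains Q' where "cob Q' = Q" "split_seq X S Q' u q"
proof -
  have "q * (D S * t) \<in> G Q Q 1"
    by (intro G_mult[OF q] G_mult[OF cx_diff(3)[OF Ch_D(2)[OF u]] t]) simp_all
  then obtain d where d: "gfam Q Q 1 d" "q * (D S * t) = rep B Q Q 1 d" by (rule G_E)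
  let ?Q = "\<lparr>cob = Q, diff = d\<rparr>"
  have tq: "t * q = E S - u * r" using eqs(4) by (simp add: algebra_simps)
  have "(q * (D S * t)) * q = q * (D S * (E S - u * r))" by (simp add: mult.assoc tq)
  also have "\<dots> = q * D S - q * (D S * u) * r"
    by (simp add: right_diff_distrib D_typed Ch_D(2)[OF u] mult.assoc)
  also have "\<dots> = q * D S"
    by (simp add: Ch_D(4)[OF u]) (simp add: mult.assoc[symmetric] eqs(2))
  finally have comm: "rep B Q Q 1 d * q = q * D S" by (simp add: d(2))
  have "rep B Q Q 1 d ^ N * (q * t) = 0"
    using power_mult_commute[OF comm, of N] D_power_N[OF Ch_D(2)[OF u]]
    by (simp add: mult.assoc[symmetric])
  moreover have "rep B Q Q 1 d ^ N * unit Q = rep B Q Q 1 d ^ N"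
    using two_le_N unit_right[OF G_rep[OF d(1)]]
    by (cases N) (simp_all add: power_Suc2 mult.assoc del: power_Suc)
  ultimately have "cx ?Q" using cx_intro[OF d(1)] eqs(3) by simp
  then have "q \<in> Ch S ?Q" using comm q Ch_D(2)[OF u] by (simp add: Ch_def)
  then have "split_seq X S ?Q u q" using u eqs r t by (auto simp: split_seq_def)
  then show thesis using that[of ?Q] by simp
qed

lemma split_seq_cokernel:
  assumes s: "split_seq X S Q u q" and l: "l \<in> Hom \<C> X S" "op_of l = u"
  obtains c where "is_cokernel \<C> l Q c" "op_of c = q"
proof -
  have q: "q \<in> Ch S Q" "q * u = 0" "u \<in> Ch X S" using s by (auto elim: split_seqE)
  obtain c where c: "c \<in> Hom \<C> S Q" "op_of c = q" using op_of_surj[OF q(1)] .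
  have lX: "Dom \<C> l = X" "Cod \<C> l = S" using l(1) by (auto simp: Hom_def)
  note cxs = Ch_D(1,2)[OF q(3)] Ch_D(1,2)[OF q(1)]
  have "Comp \<C> c l = Zero \<C> X Q"
    by (rule op_of_inject[OF op_of_Comp(1)[OF l(1) c(1)] op_of_Zero(1)])
      (simp_all add: op_of_Comp(2)[OF l(1) c(1)] op_of_Zero cxs c l q)
  moreover have "\<exists>!h. h \<in> Hom \<C> Q T \<and> Comp \<C> h c = g"
    if g: "g \<in> Hom \<C> S T" "Comp \<C> g l = Zero \<C> X T" for T g
  proof -
    have T: "cx T" by (rule Ch_D(2)[OF op_of_chain[OF g(1)]])
    have "op_of g * u = 0"
      using arg_cong[OF g(2), of op_of] by (simp add: op_of_Comp(2)[OF l(1) g(1)] op_of_Zero cxs T l)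
    then obtain h' where h': "h' \<in> Ch Q T" "h' * q = op_of g"
      using split_seq_factor[OF s op_of_chain[OF g(1)]] by blast
    obtain h where h: "h \<in> Hom \<C> Q T" "op_of h = h'" using op_of_surj[OF h'(1)] .
    show ?thesis
    proof (rule ex1I[of _ h])
      show "h \<in> Hom \<C> Q T \<and> Comp \<C> h c = g"
        using h h' c(2) op_of_Comp[OF c(1) h(1)] by (auto intro!: op_of_inject[OF _ g(1)])
    next
      fix k assume k: "k \<in> Hom \<C> Q T \<and> Comp \<C> k c = g"
      then have "op_of k * q = op_of h * q"
        using op_of_Comp(2)[OF c(1), of k] h h' c by auto
      then have "op_of k = op_of h"
        using split_seq_epi[OF s] Ch_D(3)[OF op_of_chain] k h by blast
      then show "k = h" using op_of_inject k h by blast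
    qed
  qed
  ultimately have "is_cokernel \<C> l Q c"
    using c(1) cxs by (simp add: is_cokernel_def lX Obj_CN)
  then show thesis using c(2) that by blast
qed

text \<open>The splitting is carried from one cokernel of \<open>u\<close> to any other by the isomorphism between
  them.\<close>

lemma cokernel_split_seq:
  assumes s: "split_seq X S Q0 u q0" and l: "l \<in> Hom \<C> X S" "op_of l = u"
    and cok: "is_cokernel \<C> l Q c"
  shows "split_seq X S Q u (op_of c)"
proof -
  have lX: "Dom \<C> l = X" "Cod \<C> l = S" using l(1) by (auto simp: Hom_def)
  have c: "c \<in> Hom \<C> S Q" "Comp \<C> c l = Zero \<C> X Q"
    and univ: "\<And>T g. cx T \<Longrightarrow> g \<in> Hom \<C> S T \<Longrightarrow> Comp \<C> g l = Zero \<C> X T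
      \<Longrightarrow> \<exists>!h. h \<in> Hom \<C> Q T \<and> Comp \<C> h c = g"
    using cok by (auto simp: is_cokernel_def lX Obj_CN)
  have Q: "cx S" "cx Q" by (rule Ch_D[OF op_of_chain[OF c(1)]])+
  obtain r t where r: "u \<in> Ch X S" "q0 \<in> Ch S Q0" "q0 * u = 0" "r \<in> G (cob S) (cob X) 0"
    "t \<in> G (cob Q0) (cob S) 0" "r * u = E X" "q0 * t = E Q0" "u * r + t * q0 = E S"
    using s by (rule split_seqE)
  have X: "cx X" by (rule Ch_D(1)[OF r(1)])
  have Q0: "cx Q0" by (rule Ch_D(2)[OF r(2)])
  have cu: "op_of c * u = 0"
    using arg_cong[OF c(2), of op_of] op_of_Comp(2)[OF l(1) c(1)] op_of_Zero(2)[OF X Q(2)] l(2) by simp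
  obtain a where a: "a \<in> Ch Q0 Q" "a * q0 = op_of c"
    using split_seq_factor[OF s op_of_chain[OF c(1)] cu] .
  obtain c0 where c0: "c0 \<in> Hom \<C> S Q0" "op_of c0 = q0" using op_of_surj[OF r(2)] .
  have "Comp \<C> c0 l = Zero \<C> X Q0"
    by (rule op_of_inject[OF op_of_Comp(1)[OF l(1) c0(1)] op_of_Zero(1)[OF X Q0]])
      (simp add: op_of_Comp(2)[OF l(1) c0(1)] op_of_Zero X Q0 c0 l r(3))
  then obtain b where b: "b \<in> Hom \<C> Q Q0" "Comp \<C> b c = c0"
    using univ[OF Q0 c0(1)] by blast
  have bc: "op_of b * op_of c = q0" using b(2) c0(2) op_of_Comp(2)[OF c(1) b(1)] by simp
  obtain ab where ab: "ab \<in> Hom \<C> Q Q" "op_of ab = a * op_of b"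
    using op_of_surj[OF Ch_mult[OF a(1) op_of_chain[OF b(1)]]] .
  have "Comp \<C> ab c = c"
    by (rule op_of_inject[OF op_of_Comp(1)[OF c(1) ab(1)] c(1)])
      (simp add: op_of_Comp(2)[OF c(1) ab(1)] ab(2) mult.assoc bc a(2))
  moreover have "Comp \<C> (Ident \<C> Q) c = c"
    by (rule category.Ident_left[OF category_CN c(1)])
  ultimately have "ab = Ident \<C> Q"
    using univ[OF Q(2) c(1) c(2)] ab(1) op_of_Ident(1)[OF Q(2)] by blast
  then have ab1: "a * op_of b = E Q" using ab(2) op_of_Ident(2)[OF Q(2)] by simp
  have "t * op_of b \<in> G (cob Q) (cob S) 0"
    by (rule G_mult[OF r(5) Ch_D(3)[OF op_of_chain[OF b(1)]]]) simp
  moreover have "op_of c * (t * op_of b) = E Q"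
  proof -
    have "op_of c * (t * op_of b) = a * (q0 * t) * op_of b" by (simp add: a(2)[symmetric] mult.assoc)
    then show ?thesis using Ch_D(6)[OF a(1)] ab1 by (simp add: r(7))
  qed
  moreover have "u * r + (t * op_of b) * op_of c = E S" by (simp add: mult.assoc bc r(8))
  ultimately show ?thesis
    using r(1,4,6) op_of_chain[OF c(1)] cu unfolding split_seq_def by blast
qed

section \<open>Cofree complexes\<close>

text \<open>In degree \<open>j\<close>, the complex \<open>S\<close> is the direct sum of \<open>X j, \<dots>, X (j + N - 1)\<close> and its differential
  forgets the first summand. The map \<open>e\<close> projects onto the first summand, and \<open>s\<close> includes \<open>X n\<close> as
  the last summand in degree \<open>n - N + 1\<close>. All projections and inclusions are then \<open>e d\<^sup>k\<close> and
  \<open>d\<^sup>N\<^sup>-\<^sup>1\<^sup>-\<^sup>k s\<close> (\<open>cofree_window_sum\<close>), so two conditions on \<open>e\<close> and \<open>s\<close> suffice to say this. The last one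
  also states that \<open>s e\<close> contracts \<open>S\<close>.\<close>

definition cofree :: "(int \<Rightarrow> 'o) \<Rightarrow> ('o, 'a) ncomplex \<Rightarrow> ('o, 'a) gelem endo \<Rightarrow> ('o, 'a) gelem endo
    \<Rightarrow> bool" where
  "cofree X S e s \<longleftrightarrow> gobj X \<and> cx S \<and> e \<in> G (cob S) X 0 \<and> s \<in> G X (cob S) (1 - int N) \<and>
    (\<forall>k<N. e * D S ^ k * s = (if k = N - 1 then unit X else 0)) \<and>
    hsum (D S) (D S) (s * e) N = E S"

lemma cofreeD: assumes "cofree X S e s"
  shows "gobj X" "cx S" "e \<in> G (cob S) X 0" "s \<in> G X (cob S) (1 - int N)"
    "k < N \<Longrightarrow> e * (D S ^ k * s) = (if k = N - 1 then unit X else 0)"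
    "hsum (D S) (D S) (s * e) N = E S"
  using assms by (auto simp: cofree_def mult.assoc)

lemma cofree_contractible:
  assumes "cofree X S e s" shows "contractible S"
proof -
  note c = cofreeD[OF assms]
  have "s * e \<in> G (cob S) (cob S) (1 - int N)" by (rule G_mult[OF c(4) c(3)]) simp
  then show ?thesis using c(2,6) by (force simp: contractible_def Nh_def)
qed

lemma hsum_chain:
  assumes "cx S" "cx T" and f: "f \<in> G (cob T) (cob S) (m + 1 - int N)"
  shows "hsum (D S) (D T) f N \<in> G (cob T) (cob S) m"
    "D S * hsum (D S) (D T) f N = hsum (D S) (D T) f N * D T"
  by (rule G_hsum[OF cx_diff(3)[OF assms(1)] cx_diff(3)[OF assms(2)] f], simp)
    (rule hsum_commute; simp add: D_power_N assms)

text \<open>The lift of \<open>f\<close> is the map with homotopy \<open>s f\<close>: in \<open>e d\<^sup>N\<^sup>-\<^sup>j s\<close> only the term \<open>j = 1\<close> survives.\<close>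

lemma cofree_lift:
  assumes c: "cofree X S e s" and T: "cx T" and f: "f \<in> G (cob T) X m"
  shows "hsum (D S) (D T) (s * f) N \<in> G (cob T) (cob S) m"
    "D S * hsum (D S) (D T) (s * f) N = hsum (D S) (D T) (s * f) N * D T"
    "e * hsum (D S) (D T) (s * f) N = f"
proof -
  note C = cofreeD[OF c]
  have sf: "s * f \<in> G (cob T) (cob S) (m + 1 - int N)" by (rule G_mult[OF C(4) f]) simp
  show "hsum (D S) (D T) (s * f) N \<in> G (cob T) (cob S) m"
    "D S * hsum (D S) (D T) (s * f) N = hsum (D S) (D T) (s * f) N * D T"
    by (rule hsum_chain[OF C(2) T sf])+
  have "e * (D S ^ (N - j) * (s * f) * D T ^ (j - 1)) = (if j = 1 then f else 0)" if "j \<in> {1..N}" for j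
  proof -
    have "e * (D S ^ (N - j) * (s * f) * D T ^ (j - 1))
      = (e * (D S ^ (N - j) * s)) * (f * D T ^ (j - 1))"
      by (simp add: mult.assoc)
    moreover have "e * (D S ^ (N - j) * s) = (if j = 1 then unit X else 0)"
      using C(5)[of "N - j"] that by auto
    ultimately show ?thesis using unit_left[OF f] by auto
  qed
  then have "e * hsum (D S) (D T) (s * f) N = (\<Sum>j=1..N. if j = 1 then f else 0)"
    by (simp add: hsum_eq_sum sum_distrib_left)
  also have "\<dots> = f" using two_le_N by (subst sum.delta) auto
  finally show "e * hsum (D S) (D T) (s * f) N = f" .
qed

text \<open>The identity of \<open>S\<close> is the map with homotopy \<open>s e\<close>, and composing it with \<open>h\<close> composes the
  homotopy with \<open>h\<close>. A chain map into \<open>S\<close> is therefore determined by its composite with \<open>e\<close>.\<close>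

lemma cofree_eta:
  assumes c: "cofree X S e s" and h: "h \<in> G Z (cob S) m" "D S * h = h * b"
  shows "h = hsum (D S) b (s * (e * h)) N"
proof -
  have "h = hsum (D S) (D S) (s * e) N * h" using unit_left[OF h(1)] cofreeD(6)[OF c] by simp
  also have "\<dots> = hsum (D S) b (s * (e * h)) N"
    by (simp only: hsum_mult[OF h(2)] mult.assoc)
  finally show ?thesis .
qed

lemma cofree_eqI:
  assumes "cofree X S e s" and "h \<in> G Z (cob S) m" "D S * h = h * b"
    and "h' \<in> G Z (cob S) m'" "D S * h' = h' * b" and "e * h = e * h'"
  shows "h = h'"
  using cofree_eta[OF assms(1,2,3)] cofree_eta[OF assms(1,4,5)] assms(6) by simp

lemma hsum_free:
  assumes c: "cofree X S e s" and f: "f \<in> G X Z k"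
  shows "hsum a (D S) (f * e) N * s = f"
proof -
  have "(a ^ (N - j) * (f * e) * D S ^ (j - 1)) * s = (if j = N then f else 0)" if "j \<in> {1..N}" for j
  proof -
    have "(a ^ (N - j) * (f * e) * D S ^ (j - 1)) * s = a ^ (N - j) * (f * (e * (D S ^ (j - 1) * s)))"
      by (simp add: mult.assoc)
    moreover have "e * (D S ^ (j - 1) * s) = (if j = N then unit X else 0)"
      using cofreeD(5)[OF c, of "j - 1"] that by auto
    ultimately show ?thesis using unit_right[OF f] by auto
  qed
  then have "hsum a (D S) (f * e) N * s = (\<Sum>j=1..N. if j = N then f else 0)"
    by (simp add: hsum_eq_sum sum_distrib_right)
  also have "\<dots> = f" using two_le_N by (subst sum.delta) auto
  finally show ?thesis .
qed

text \<open>The complex \<open>S\<close> is also free on the inclusions \<open>s\<close>, which have degree \<open>1 - N\<close>. Thus a graded map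
  of degree \<open>1 - N\<close> is the same as a chain map out of \<open>S\<close>, which gives the coproduct property of
  the direct sum.\<close>

lemma free_extend:
  assumes c: "cofree X S e s" and T: "cx T" and f: "f \<in> G X (cob T) (1 - int N)"
  shows "hsum (D T) (D S) (f * e) N \<in> Ch S T" "hsum (D T) (D S) (f * e) N * s = f"
proof -
  note C = cofreeD[OF c]
  have "f * e \<in> G (cob S) (cob T) (0 + 1 - int N)" by (rule G_mult[OF f C(3)]) simp
  from hsum_chain[OF T C(2) this] show "hsum (D T) (D S) (f * e) N \<in> Ch S T"
    using T C(2) by (simp add: Ch_def)
  show "hsum (D T) (D S) (f * e) N * s = f" by (rule hsum_free[OF c f])
qed

lemma free_eqI:
  assumes c: "cofree X S e s" and h: "h \<in> Ch S T" "h' \<in> Ch S T" and eq: "h * s = h' * s"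
  shows "h = h'"
proof -
  have "k = hsum (D T) (D S) (k * s * e) N" if "k \<in> Ch S T" for k
  proof -
    have "k = k * hsum (D S) (D S) (s * e) N" using Ch_D(6)[OF that] cofreeD(6)[OF c] by simp
    also have "\<dots> = hsum (D T) (D S) (k * s * e) N"
      by (simp only: mult_hsum[OF Ch_D(4)[OF that, symmetric]] mult.assoc)
    finally show ?thesis .
  qed
  then show ?thesis using h eq by metis
qed

lemma cofree_window_sum:
  assumes "cofree X S e s"
  shows "window_sum X {..<N} (cob S) (\<lambda>k. e * D S ^ k) (\<lambda>k. D S ^ (N - 1 - k) * s)"
proof -
  note C = cofreeD[OF assms]
  have 1: "e * D S ^ k * (D S ^ (N - 1 - l) * s) = (if k = l then unit X else 0)"
    if "k < N" "l < N" for k l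
  proof (cases "k + (N - 1 - l) < N")
    case True
    have "e * D S ^ k * (D S ^ (N - 1 - l) * s) = e * (D S ^ (k + (N - 1 - l)) * s)"
      by (simp add: power_add mult.assoc)
    also have "\<dots> = (if k = l then unit X else 0)" using C(5)[OF True] that by auto
    finally show ?thesis .
  next
    case False
    have "e * D S ^ k * (D S ^ (N - 1 - l) * s) = e * (D S ^ (N + (k + (N - 1 - l) - N)) * s)"
      using False by (simp add: power_add[symmetric] mult.assoc[symmetric])
        (simp add: power_add mult.assoc)
    also have "\<dots> = 0" by (simp add: power_add D_power_N[OF C(2)])
    finally show ?thesis using False that by auto
  qed
  have 2: "(\<Sum>k<N. (D S ^ (N - 1 - k) * s) * (e * D S ^ k)) = E S"
  proof -
    have "(\<Sum>k<N. (D S ^ (N - 1 - k) * s) * (e * D S ^ k))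
      = (\<Sum>j=1..N. D S ^ (N - j) * (s * e) * D S ^ (j - 1))"
      by (rule sum.reindex_bij_witness[where i = "\<lambda>j. j - 1" and j = Suc])
        (auto simp: mult.assoc)
    then show ?thesis using C(6) by (simp add: hsum_eq_sum)
  qed
  have "e * D S ^ k \<in> G (cob S) X (int k)" "k < N \<Longrightarrow> D S ^ (N - 1 - k) * s \<in> G X (cob S) (- int k)" for k
  proof -
    show "e * D S ^ k \<in> G (cob S) X (int k)"
      by (rule G_mult_power[OF C(3) cx_diff(3)[OF C(2)]]) simp
    show "k < N \<Longrightarrow> D S ^ (N - 1 - k) * s \<in> G X (cob S) (- int k)"
      by (rule G_power_mult[OF cx_diff(3)[OF C(2)] C(4)]) (simp add: of_nat_diff)
  qed
  then show ?thesis using 1 2 cx_diff(1)[OF C(2)] by (simp add: window_sum_def)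
qed

text \<open>The differential moves the summand \<open>X (j + k + 1)\<close> in degree \<open>j\<close>, which is number \<open>k + 1\<close> there,
  to the summand number \<open>k\<close> in degree \<open>j + 1\<close>.\<close>

lemma cofree_exists:
  assumes X: "gobj X"
  obtains S e s where "cofree X S e s"
proof -
  obtain S p i where w: "window_sum X {..<N} S p i" using window_sum_exists[OF X, of "{..<N}"] by auto
  have S: "gobj S" and p: "\<And>k. k < N \<Longrightarrow> p k \<in> G S X (int k)" and i: "\<And>k. k < N \<Longrightarrow> i k \<in> G X S (- int k)"
    and pi: "\<And>k l. k < N \<Longrightarrow> l < N \<Longrightarrow> p k * i l = (if k = l then unit X else 0)"
    and sum1: "(\<Sum>k<N. i k * p k) = unit S"
    using w by (auto simp: window_sum_def)
  define d where "d = (\<Sum>k<N-1. i k * p (Suc k))"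
  have "d \<in> G S S 1" unfolding d_def
    by (rule G_sum[OF S S], rule G_mult[OF i p]) auto
  then obtain d' where d': "gfam S S 1 d'" "d = rep B S S 1 d'" by (rule G_E)
  have pd: "p k * d = (if Suc k < N then p (Suc k) else 0)" if "k < N" for k
  proof -
    have "p k * d = (\<Sum>l<N-1. (p k * i l) * p (Suc l))"
      by (simp add: d_def sum_distrib_left mult.assoc)
    also have "\<dots> = (\<Sum>l<N-1. if l = k then p (Suc k) else 0)"
      using that pi unit_left[OF p] by (intro sum.cong) auto
    finally show ?thesis using that by (auto simp: sum.delta)
  qed
  have di: "d * i l = (if l = 0 then 0 else i (l - 1))" if "l < N" for l
  proof -
    have "d * i l = (\<Sum>k<N-1. i k * (p (Suc k) * i l))"
      by (simp add: d_def sum_distrib_right mult.assoc)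
    also have "\<dots> = (\<Sum>k<N-1. if Suc k = l then i k else 0)"
      using that pi unit_right[OF i] by (intro sum.cong) auto
    also have "\<dots> = (if l = 0 then 0 else i (l - 1))"
    proof (cases l)
      case (Suc m)
      then show ?thesis using that by (auto simp: sum.delta)
    qed simp
    finally show ?thesis .
  qed
  have pdm: "p 0 * d ^ m = (if m < N then p m else 0)" for m
  proof (induction m)
    case (Suc m)
    have "p 0 * d ^ Suc m = (p 0 * d ^ m) * d" by (simp add: mult.assoc power_commutes)
    then show ?case using Suc pd[of m] by auto
  qed (use two_le_N in auto)
  (* p k = p 0 d^k, so that d^N = 0 follows from p 0 d^m = 0 for m >= N *)
  have pkN: "p k * d ^ N = 0" if "k < N" for k
  proof -
    have "p k * d ^ N = (p 0 * d ^ k) * d ^ N" using that by (simp add: pdm)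
    also have "\<dots> = p 0 * d ^ (k + N)" by (simp add: mult.assoc power_add)
    finally show ?thesis by (simp add: pdm)
  qed
  have "d ^ N = unit S * d ^ N"
    using two_le_N unit_left[OF \<open>d \<in> G S S 1\<close>] by (cases N) (simp_all add: mult.assoc[symmetric])
  also have "\<dots> = 0" by (simp add: sum1[symmetric] sum_distrib_right mult.assoc pkN)
  finally have "cx \<lparr>cob = S, diff = d'\<rparr>" using cx_intro[OF d'(1)] d'(2) by simp
  have dmi: "d ^ m * i (N - 1) = i (N - 1 - m)" if "m < N" for m
    using that
  proof (induction m)
    case (Suc m)
    then have "d ^ Suc m * i (N - 1) = d * i (N - 1 - m)" by (simp add: mult.assoc)
    then show ?case using Suc.prems di[of "N - 1 - m"] by (simp add: Suc_diff_Suc)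
  qed simp
  have "(\<Sum>j=1..N. d ^ (N - j) * (i (N - 1) * p 0) * d ^ (j - 1)) = (\<Sum>k<N. i k * p k)"
  proof (rule sum.reindex_bij_witness[where j = "\<lambda>j. j - 1" and i = Suc])
    fix j assume j: "j \<in> {1..N}"
    have "d ^ (N - j) * (i (N - 1) * p 0) * d ^ (j - 1) = (d ^ (N - j) * i (N - 1)) * (p 0 * d ^ (j - 1))"
      by (simp add: mult.assoc)
    then show "i (j - 1) * p (j - 1) = d ^ (N - j) * (i (N - 1) * p 0) * d ^ (j - 1)"
      using j dmi[of "N - j"] pdm[of "j - 1"] by auto
  qed auto
  moreover have "p 0 * d ^ k * i (N - 1) = (if k = N - 1 then unit X else 0)" if "k < N" for k
    using that pi[of k "N - 1"] by (simp add: pdm)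
  ultimately have "cofree X \<lparr>cob = S, diff = d'\<rparr> (p 0) (i (N - 1))"
    using X \<open>cx _\<close> p[of 0] i[of "N - 1"] two_le_N
    by (simp add: cofree_def hsum_eq_sum sum1 d'(2)[symmetric] of_nat_diff)
  then show thesis by (rule that)
qed

text \<open>The first component of \<open>l\<close> is the identity, so the image of \<open>l\<close> is a graph over the first summand
  of \<open>S\<close> and the remaining summands form a complement.\<close>

lemma cofree_split_seq:
  assumes c: "cofree (cob X) S e s" and l: "l \<in> Ch X S" "e * l = E X"
  obtains Q q where "split_seq X S Q l q"
proof -
  note C = cofreeD[OF c]
  define p where "p k = e * D S ^ k" for k
  define i where "i k = D S ^ (N - 1 - k) * s" for k
  have w: "window_sum (cob X) {..<N} (cob S) p i"
    using cofree_window_sum[OF c] by (simp add: p_def[abs_def] i_def[abs_def])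
  have p: "\<And>k. k < N \<Longrightarrow> p k \<in> G (cob S) (cob X) (int k)"
    and i: "\<And>k. k < N \<Longrightarrow> i k \<in> G (cob X) (cob S) (- int k)"
    and pi: "\<And>k l. k < N \<Longrightarrow> l < N \<Longrightarrow> p k * i l = (if k = l then E X else 0)"
    and sum1: "(\<Sum>k<N. i k * p k) = E S"
    using w by (auto simp: window_sum_def)
  obtain Q p' i' where w': "window_sum (cob X) {1..<N} Q p' i'"
    using window_sum_exists[OF C(1), of "{1..<N}"] by auto
  have Q: "gobj Q" and p': "\<And>k. k \<in> {1..<N} \<Longrightarrow> p' k \<in> G Q (cob X) (int k)"
    and i': "\<And>k. k \<in> {1..<N} \<Longrightarrow> i' k \<in> G (cob X) Q (- int k)"
    and pi': "\<And>k l. k \<in> {1..<N} \<Longrightarrow> l \<in> {1..<N} \<Longrightarrow> p' k * i' l = (if k = l then E X else 0)"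
    and sum1': "(\<Sum>k=1..<N. i' k * p' k) = unit Q"
    using w' by (auto simp: window_sum_def)
  have S: "gobj (cob S)" by (rule cx_diff(1)[OF C(2)])
  define t where "t = (\<Sum>k=1..<N. i k * p' k)"
  define q0 where "q0 = (\<Sum>k=1..<N. i' k * p k)"
  have t: "t \<in> G Q (cob S) 0" unfolding t_def
    by (rule G_sum[OF Q S], rule G_mult[OF i p']) auto
  have q0: "q0 \<in> G (cob S) Q 0" unfolding q0_def
    by (rule G_sum[OF S Q], rule G_mult[OF i' p]) auto
  have e: "p 0 = e" by (simp add: p_def)
  have "p k * t = (if k = 0 then 0 else p' k)" if "k < N" for k
  proof -
    have "p k * t = (\<Sum>l=1..<N. (p k * i l) * p' l)" by (simp add: t_def sum_distrib_left mult.assoc)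
    also have "\<dots> = (\<Sum>l=1..<N. if l = k then p' k else 0)"
      using that pi unit_left[OF p'] by (intro sum.cong) auto
    finally show ?thesis using that by (simp add: sum.delta)
  qed
  note pt = this
  have "q0 * t = (\<Sum>k=1..<N. i' k * (p k * t))" by (simp add: q0_def sum_distrib_right mult.assoc)
  also have "\<dots> = unit Q" unfolding sum1'[symmetric] by (intro sum.cong) (auto simp: pt)
  finally have q0t: "q0 * t = unit Q" .
  have "p' k * q0 = p k" if "k \<in> {1..<N}" for k
  proof -
    have "p' k * q0 = (\<Sum>l=1..<N. (p' k * i' l) * p l)" by (simp add: q0_def sum_distrib_left mult.assoc)
    also have "\<dots> = (\<Sum>l=1..<N. if l = k then p k else 0)"
      using that pi' unit_left[OF p] by (intro sum.cong) auto
    finally show ?thesis using that by (simp add: sum.delta)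
  qed
  then have "t * q0 = (\<Sum>k=1..<N. i k * p k)" by (simp add: t_def sum_distrib_right mult.assoc)
  moreover have "(\<Sum>k<N. i k * p k) = i 0 * p 0 + (\<Sum>k=1..<N. i k * p k)"
    using two_le_N by (simp add: lessThan_atLeast0 sum.atLeast_Suc_lessThan)
  ultimately have tq0: "t * q0 = E S - i 0 * e" using sum1 by (simp add: e algebra_simps)
  have et: "e * t = 0" using pt[of 0] two_le_N by (simp add: e)
  (* q0 forgets the first summand of S; subtracting q0 l e makes it vanish on the graph of l *)
  define q where "q = q0 - q0 * l * e"
  have eS: "e * E S = e" "E X * e = e" using C(3) by (simp_all add: unit_left unit_right)
  have q: "q \<in> G (cob S) Q 0" unfolding q_def
    by (rule G_diff[OF q0]) (rule G_mult[OF G_mult[OF q0 Ch_D(3)[OF l(1)]] C(3)]; simp)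
  have "t * q = t * q0 - (t * q0) * l * e" by (simp add: q_def right_diff_distrib mult.assoc)
  also have "\<dots> = E S - i 0 * e - (l * e - i 0 * ((e * l) * e))"
    by (simp add: tq0 left_diff_distrib right_diff_distrib mult.assoc[symmetric] Ch_D(5)[OF l(1)])
  finally have "l * e + t * q = E S" by (simp add: l(2) eS)
  moreover have "q * t = unit Q" by (simp add: q_def left_diff_distrib mult.assoc et q0t)
  moreover have "q * l = 0"
    using unit_right[OF G_mult[OF q0 Ch_D(3)[OF l(1)] refl]]
    by (simp add: q_def left_diff_distrib mult.assoc l(2))
  ultimately show thesis
    using split_quotient[OF l(1) q C(3) t l(2)] that by blast
qed

section \<open>The complexes \<open>\<mu>\<close> and their direct sums\<close>

lemma zero_object_B: "is_zero_object B (zero_object B)"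
  unfolding zero_object_def by (rule someI_ex[OF ex_zero_object])

lemma zero_object_Obj: "zero_object B \<in> Obj B"
  using zero_object_B by (simp add: is_zero_object_def)

lemma zero_object_unique:
  "f \<in> Hom B T (zero_object B) \<Longrightarrow> g \<in> Hom B T (zero_object B) \<Longrightarrow> f = g"
  "f \<in> Hom B (zero_object B) T \<Longrightarrow> g \<in> Hom B (zero_object B) T \<Longrightarrow> f = g"
proof -
  assume "f \<in> Hom B T (zero_object B)" "g \<in> Hom B T (zero_object B)"
  moreover from this(1) have "T \<in> Obj B" using Hom_position by (simp add: position_B)
  ultimately show "f = g" using zero_object_B unfolding is_zero_object_def by blast
next
  assume "f \<in> Hom B (zero_object B) T" "g \<in> Hom B (zero_object B) T"
  moreover from this(1) have "T \<in> Obj B" using Hom_position by (simp add: position_B)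
  ultimately show "f = g" using zero_object_B unfolding is_zero_object_def by blast
qed

lemma Ident_zero_object:
  "Ident B (zero_object B) = Zero B (zero_object B) (zero_object B)"
  by (rule zero_object_unique(1)[of _ "zero_object B"]) (simp_all add: Ident_Hom Zero_Hom zero_object_Obj)

lemma mu_cob: "cob (mu N B n A) i = (if n - int N + 1 \<le> i \<and> i \<le> n then A else zero_object B)"
  by (simp add: mu_def Let_def)

lemma mu_cob_n: "cob (mu N B n A) n = A" "cob (mu N B n A) (n - int N + 1) = A"
  using two_le_N by (simp_all add: mu_cob)

lemma mu_diff: "diff (mu N B n A) i = (if n - int N + 1 \<le> i \<and> i + 1 \<le> n then Ident B A
    else Zero B (cob (mu N B n A) i) (cob (mu N B n A) (i + 1)))"
  by (simp add: mu_def Let_def)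

lemma mu_gfam:
  assumes "A \<in> Obj B"
  shows "gobj (cob (mu N B n A))" "gfam (cob (mu N B n A)) (cob (mu N B n A)) 1 (diff (mu N B n A))"
proof -
  show *: "gobj (cob (mu N B n A))" using assms by (simp add: gobj_def mu_cob zero_object_Obj)
  then have "diff (mu N B n A) i \<in> Hom B (cob (mu N B n A) i) (cob (mu N B n A) (i + 1))" for i
    using assms Ident_Hom Zero_Hom by (auto simp: gobj_def mu_diff) (auto simp: mu_cob)
  with * show "gfam (cob (mu N B n A)) (cob (mu N B n A)) 1 (diff (mu N B n A))"
    by (simp add: gfam_def)
qed

lemma mu_dpow:
  assumes A: "A \<in> Obj B"
  shows "dpow B (mu N B n A) i k = (if n - int N + 1 \<le> i \<and> i + int k \<le> n then Ident B A
    else Zero B (cob (mu N B n A) i) (cob (mu N B n A) (i + int k)))"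
proof (induction k)
  case 0
  show ?case by (simp add: mu_cob Ident_zero_object)
next
  case (Suc k)
  let ?M = "cob (mu N B n A)"
  note O = mu_gfam(1)[OF A, of n, unfolded gobj_def, rule_format]
  have i: "i + (1 + int k) = i + int k + 1" by simp
  consider "n - int N + 1 \<le> i \<and> i + int k + 1 \<le> n" |
    "\<not> (n - int N + 1 \<le> i \<and> i + int k \<le> n)" |
    "n - int N + 1 \<le> i" "i + int k = n" by linarith
  then show ?case
  proof cases
    case 1
    then show ?thesis using Suc Ident_left[OF Ident_Hom[OF A]] by (simp add: mu_diff)
  next
    case 2
    then show ?thesis
      using Suc Comp_Zero_right[OF gfamD(1)[OF mu_gfam(2)[OF A], of n "i + int k"] O]
      by (auto simp: i)
  next
    case 3
    then have "dpow B (mu N B n A) i k \<in> Hom B (?M i) (?M (i + int k))"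
      using Suc Ident_Hom[OF A] by (simp add: mu_cob)
    then show ?thesis
      using 3 Comp_Zero_left[OF _ O, of _ "?M i" "?M (i + int k)" "i + int k + 1"]
      by (simp add: i mu_diff)
  qed
qed

lemma mu_cx: "A \<in> Obj B \<Longrightarrow> cx (mu N B n A)"
  using mu_gfam[of A n] mu_dpow[of A n _ N] two_le_N
  by (auto simp: is_ncomplex_def gfam_def gobj_def)

lemma dpow_Hom: "cx X \<Longrightarrow> dpow B X i k \<in> Hom B (cob X i) (cob X (i + int k))"
  using gfamD(1)[OF conjunct1[OF dpow_rep[OF cx_diff(2)]]] .

lemma dpow_Suc_right:
  assumes X: "cx X" shows "dpow B X i (Suc k) = dpow B X (i + 1) k \<cdot> diff X i"
proof -
  note k = dpow_rep[OF cx_diff(2)[OF X]]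
  have "int (Suc k) = 1 + int k" by simp
  note c = rep_comp[OF cx_diff(2)[OF X] conjunct1[OF k] this]
  have "D X ^ k * E X * D X = D X ^ Suc k * E X"
    by (simp add: mult.assoc D_typed X power_Suc2 del: power_Suc)
  then have "(\<lambda>i. dpow B X i (Suc k)) = (\<lambda>i. dpow B X (i + 1) k \<cdot> diff X i)"
    using c(2) k[of "Suc k"] k[of k] by (intro rep_inject[OF _ c(1)]) auto
  then show ?thesis by (rule fun_cong)
qed

lemma chain_map_dpow:
  assumes f: "f \<in> Hom \<C> X Y"
  shows "dpow B Y i k \<cdot> cmp f i = cmp f (i + int k) \<cdot> dpow B X i k"
proof -
  note C = Ch_D[OF op_of_chain[OF f]]
  note X = dpow_rep[OF cx_diff(2)[OF C(1)], of k] and Y = dpow_rep[OF cx_diff(2)[OF C(2)], of k]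
  note g = chain_map_gfam[OF f]
  note l = rep_comp[OF g conjunct1[OF Y], of "int k"] and r = rep_comp[OF conjunct1[OF X] g, of "int k"]
  have op: "rep B (cob X) (cob Y) 0 (cmp f) = op_of f" using f by (simp add: op_of_def Hom_CN)
  have "D Y ^ k * E Y * op_of f = op_of f * (D X ^ k * E X)"
  proof -
    have "D Y ^ k * E Y * op_of f = D Y ^ k * (op_of f * E X)" by (simp add: mult.assoc C(5,6))
    then show ?thesis by (simp add: mult.assoc[symmetric] power_mult_commute[OF C(4)])
  qed
  moreover have "D X ^ k * E X = E X * D X ^ k"
    by (rule power_mult_commute) (simp add: D_typed C)
  ultimately have "(\<lambda>i. dpow B Y i k \<cdot> cmp f i) = (\<lambda>i. cmp f (i + int k) \<cdot> dpow B X i k)"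
    using l r X Y op by (intro rep_inject[of "cob X" "cob Y" "int k"]) simp_all
  then show ?thesis by (rule fun_cong)
qed

text \<open>A chain map into \<open>\<mu>\<^sup>n(A)\<close> is determined by its component in degree \<open>n\<close>, and one out of it by its
  component in the lowest degree \<open>n - N + 1\<close>; both components are arbitrary. This is what links the
  direct sum of the complexes \<open>\<mu>\<close> to cofree complexes.\<close>

lemma into_mu_cmp:
  assumes A: "A \<in> Obj B" and f: "f \<in> Hom \<C> T (mu N B n A)"
  shows "cmp f j = (if n - int N + 1 \<le> j \<and> j \<le> n then cmp f n \<cdot> dpow B T j (nat (n - j))
      else Zero B (cob T j) (zero_object B))"
proof -
  note fj = gfamD[OF chain_map_gfam[OF f]]
  show ?thesis
  proof (cases "n - int N + 1 \<le> j \<and> j \<le> n")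
    case True
    then have "Ident B A \<cdot> cmp f j = cmp f n \<cdot> dpow B T j (nat (n - j))"
      using chain_map_dpow[OF f, of j "nat (n - j)"] by (simp add: mu_dpow A)
    moreover have "cmp f j \<in> Hom B (cob T j) A" using fj(1)[of j] True by (simp add: mu_cob)
    ultimately show ?thesis using True by (simp add: Ident_left)
  next
    case False
    then show ?thesis
      using fj(1)[of j] Zero_Hom[OF fj(3) zero_object_Obj, of j]
      by (auto simp: mu_cob intro: zero_object_unique)
  qed
qed

lemma into_mu_eqI:
  assumes "A \<in> Obj B" "f \<in> Hom \<C> T (mu N B n A)" "g \<in> Hom \<C> T (mu N B n A)"
    and "cmp f n = cmp g n"
  shows "f = g"
proof -
  have "cmp f j = cmp g j" for j
    using into_mu_cmp[OF assms(1,2), of j] into_mu_cmp[OF assms(1,3), of j] assms(4) by simp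
  then show ?thesis using assms(2,3) by (auto simp: Hom_CN fun_eq_iff intro: chain_map.equality)
qed

lemma into_mu_exists:
  assumes A: "A \<in> Obj B" and T: "cx T" and phi: "p \<in> Hom B (cob T n) A"
  obtains f where "f \<in> Hom \<C> T (mu N B n A)" "cmp f n = p"
proof -
  let ?M = "mu N B n A"
  define c where "c j = (if n - int N + 1 \<le> j \<and> j \<le> n then p \<cdot> dpow B T j (nat (n - j))
      else Zero B (cob T j) (zero_object B))" for j
  note O = cx_diff(1)[OF T, unfolded gobj_def, rule_format]
  have c: "c j \<in> Hom B (cob T j) (cob ?M j)" for j
    using Comp_Hom[OF dpow_Hom[OF T, of j "nat (n - j)"], of p A] phi Zero_Hom[OF O zero_object_Obj]
    by (auto simp: c_def mu_cob)
  have d: "diff T i \<in> Hom B (cob T i) (cob T (i + 1))" for i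
    using gfamD(1)[OF cx_diff(2)[OF T]] .
  have dM: "diff ?M i \<in> Hom B (cob ?M i) (cob ?M (i + 1))" for i
    using gfamD(1)[OF mu_gfam(2)[OF A]] .
  have "diff ?M i \<cdot> c i = c (i + 1) \<cdot> diff T i" for i
  proof -
    have pd: "p \<cdot> dpow B T i (Suc (nat (n - (i + 1)))) = (p \<cdot> dpow B T (i + 1) (nat (n - (i + 1)))) \<cdot> diff T i"
      if "i + 1 \<le> n"
      using Comp_assoc[OF d dpow_Hom[OF T, of "i + 1" "nat (n - (i + 1))"], where h = p] phi that
      by (simp add: dpow_Suc_right[OF T] del: dpow.simps(2))
    consider "n - int N + 1 \<le> i" "i + 1 \<le> n" | "i = n - int N" |
      "\<not> (n - int N + 1 \<le> i + 1 \<and> i + 1 \<le> n)" by linarith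
    then show ?thesis
    proof cases
      case 1
      then have "Suc (nat (n - (i + 1))) = nat (n - i)" by linarith
      then show ?thesis
        using 1 pd Ident_left[of "c i" "cob T i" A] c[of i] by (simp add: c_def mu_diff mu_cob)
    next
      case 2
      then have Nk: "Suc (nat (n - (i + 1))) = N" using two_le_N by linarith
      have "c (i + 1) \<cdot> diff T i = p \<cdot> dpow B T i N"
        using 2 pd two_le_N unfolding Nk by (simp add: c_def)
      also have "\<dots> = Zero B (cob T i) A"
        using T Comp_Zero_right[OF phi O[of i]] 2 by (simp add: is_ncomplex_def)
      also have "\<dots> = diff ?M i \<cdot> c i"
        using 2 two_le_N Comp_Zero_left[OF c[of i] A] by (simp add: mu_diff mu_cob)
      finally show ?thesis by simp
    next
      case 3
      then have "cob ?M (i + 1) = zero_object B" by (auto simp: mu_cob)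
      then show ?thesis
        using Comp_Hom[OF c dM] Comp_Hom[OF d c] zero_object_unique(1) by metis
    qed
  qed
  then have "\<lparr>src = T, tgt = ?M, cmp = c\<rparr> \<in> Hom \<C> T ?M"
    using T mu_cx[OF A] c by (simp add: Hom_CN is_chain_map_def)
  moreover have "c n = p" using two_le_N Ident_right[OF phi] by (simp add: c_def)
  ultimately show thesis using that by force
qed

lemma from_mu_cmp:
  assumes A: "A \<in> Obj B" and f: "f \<in> Hom \<C> (mu N B n A) T" and a: "a = n - int N + 1"
  shows "cmp f j = (if a \<le> j \<and> j \<le> n then dpow B T a (nat (j - a)) \<cdot> cmp f a
      else Zero B (zero_object B) (cob T j))"
proof -
  note fj = gfamD[OF chain_map_gfam[OF f]]
  show ?thesis
  proof (cases "a \<le> j \<and> j \<le> n")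
    case True
    then have "dpow B T a (nat (j - a)) \<cdot> cmp f a = cmp f j \<cdot> Ident B A"
      using chain_map_dpow[OF f, of a "nat (j - a)"] by (simp add: mu_dpow A a)
    moreover have "cmp f j \<in> Hom B A (cob T j)" using fj(1)[of j] True by (simp add: mu_cob a)
    ultimately show ?thesis using True by (simp add: Ident_right)
  next
    case False
    then show ?thesis
      using fj(1)[of j] Zero_Hom[OF zero_object_Obj fj(4), of j]
      by (auto simp: mu_cob a intro: zero_object_unique)
  qed
qed

lemma from_mu_eqI:
  assumes "A \<in> Obj B" "f \<in> Hom \<C> (mu N B n A) T" "g \<in> Hom \<C> (mu N B n A) T"
    and a: "a = n - int N + 1" and "cmp f a = cmp g a"
  shows "f = g"
proof -
  have "cmp f j = cmp g j" for j
    using from_mu_cmp[OF assms(1,2) a, of j] from_mu_cmp[OF assms(1,3) a, of j] assms(5) by simp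
  then show ?thesis using assms(2,3) by (auto simp: Hom_CN fun_eq_iff intro: chain_map.equality)
qed

lemma from_mu_exists:
  assumes A: "A \<in> Obj B" and T: "cx T" and a: "a = n - int N + 1" and phi: "p \<in> Hom B A (cob T a)"
  obtains f where "f \<in> Hom \<C> (mu N B n A) T" "cmp f a = p"
proof -
  let ?M = "mu N B n A"
  define c where "c j = (if a \<le> j \<and> j \<le> n then dpow B T a (nat (j - a)) \<cdot> p
      else Zero B (zero_object B) (cob T j))" for j
  note O = cx_diff(1)[OF T, unfolded gobj_def, rule_format]
  have c: "c j \<in> Hom B (cob ?M j) (cob T j)" for j
    using Comp_Hom[OF phi dpow_Hom[OF T, of a "nat (j - a)"]] Zero_Hom[OF zero_object_Obj O]
    by (auto simp: c_def mu_cob a)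
  have d: "diff T i \<in> Hom B (cob T i) (cob T (i + 1))" for i
    using gfamD(1)[OF cx_diff(2)[OF T]] .
  have dM: "diff ?M i \<in> Hom B (cob ?M i) (cob ?M (i + 1))" for i
    using gfamD(1)[OF mu_gfam(2)[OF A]] .
  have "diff T i \<cdot> c i = c (i + 1) \<cdot> diff ?M i" for i
  proof -
    have pd: "diff T i \<cdot> (dpow B T a (nat (i - a)) \<cdot> p) = dpow B T a (Suc (nat (i - a))) \<cdot> p" if "a \<le> i"
      using Comp_assoc[OF phi dpow_Hom[OF T, of a "nat (i - a)"], where h = "diff T i" and A''' = "cob T (i + 1)"] d that by simp
    consider "a \<le> i" "i + 1 \<le> n" | "i = n" | "\<not> (a \<le> i \<and> i \<le> n)" by linarith
    then show ?thesis
    proof cases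
      case 1
      then have "Suc (nat (i - a)) = nat (i + 1 - a)" by linarith
      then show ?thesis
        using 1 pd Ident_right[of "c (i + 1)" A "cob T (i + 1)"] c[of "i + 1"] a
        by (simp add: c_def mu_diff mu_cob)
    next
      case 2
      then have Nk: "Suc (nat (i - a)) = N" "a \<le> i" using two_le_N a by linarith+
      have "diff T i \<cdot> c i = dpow B T a N \<cdot> p"
        using 2 pd Nk by (simp add: c_def del: dpow.simps(2))
      also have "\<dots> = Zero B A (cob T (i + 1))"
        using T Comp_Zero_left[OF phi O[of "i + 1"]] 2 a by (simp add: is_ncomplex_def)
      also have "\<dots> = c (i + 1) \<cdot> diff ?M i"
        using 2 two_le_N Comp_Zero_right[OF c[of "i + 1"] A] a by (simp add: mu_diff mu_cob)
      finally show ?thesis by simp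
    next
      case 3
      then have "cob ?M i = zero_object B" by (auto simp: mu_cob a)
      then show ?thesis
        using Comp_Hom[OF c d] Comp_Hom[OF dM c] zero_object_unique(2) by metis
    qed
  qed
  then have "\<lparr>src = ?M, tgt = T, cmp = c\<rparr> \<in> Hom \<C> ?M T"
    using T mu_cx[OF A] c by (simp add: Hom_CN is_chain_map_def)
  moreover have "c a = p" using two_le_N Ident_left[OF phi] by (simp add: c_def a)
  ultimately show thesis using that by force
qed

lemma lam_comp_Hom:
  assumes X: "cx X"
  shows "lam_comp N B X n \<in> Hom \<C> X (mu N B n (cob X n))"
    "cmp (lam_comp N B X n) n = Ident B (cob X n)"
proof -
  have A: "cob X n \<in> Obj B" using cx_diff(1)[OF X] by (simp add: gobj_def)
  obtain f where f: "f \<in> Hom \<C> X (mu N B n (cob X n))" "cmp f n = Ident B (cob X n)"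
    using into_mu_exists[OF A X Ident_Hom[OF A]] .
  have "cmp f j = cmp (lam_comp N B X n) j" for j
    using into_mu_cmp[OF A f(1), of j] f(2) Ident_left[OF dpow_Hom[OF X, of j "nat (n - j)"]]
    by (auto simp: lam_comp_def)
  then have "f = lam_comp N B X n"
    using f(1) by (auto simp: Hom_CN lam_comp_def fun_eq_iff intro!: chain_map.equality)
  then show "lam_comp N B X n \<in> Hom \<C> X (mu N B n (cob X n))"
    "cmp (lam_comp N B X n) n = Ident B (cob X n)" using f by auto
qed

lemma mu_map_Hom:
  assumes f: "f \<in> Hom B A A'"
  shows "mu_map N B n f \<in> Hom \<C> (mu N B n A) (mu N B n A')" "cmp (mu_map N B n f) n = f"
proof -
  have A: "A \<in> Obj B" "A' \<in> Obj B" using Hom_position[OF f] by (auto simp: position_B)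
  have dc: "Dom B f = A" "Cod B f = A'" using f by (auto simp: Hom_def)
  have f': "f \<in> Hom B (cob (mu N B n A) n) A'" using f by (simp add: mu_cob_n)
  obtain g where g: "g \<in> Hom \<C> (mu N B n A) (mu N B n A')" "cmp g n = f"
    using into_mu_exists[OF A(2) mu_cx[OF A(1)] f'] .
  have "cmp g j = cmp (mu_map N B n f) j" for j
    using into_mu_cmp[OF A(2) g(1), of j] g(2) Ident_right[OF f]
    by (auto simp: mu_map_def mu_dpow A mu_cob)
  then have "g = mu_map N B n f"
    using g(1) by (auto simp: Hom_CN mu_map_def dc fun_eq_iff intro!: chain_map.equality)
  then show "mu_map N B n f \<in> Hom \<C> (mu N B n A) (mu N B n A')" "cmp (mu_map N B n f) n = f"
    using g by auto
qed

lemma cmp_Comp_CN: "cmp (Comp \<C> g f) i = cmp g i \<cdot> cmp f i"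
  by (simp add: CN_simps)

lemma rep_comp_eq_iff:
  assumes f: "gfam X Y k f" and g: "gfam Y Z l g" and h: "gfam X Z m h" and m: "m = k + l"
  shows "rep B Y Z l g * rep B X Y k f = rep B X Z m h \<longleftrightarrow> (\<forall>i. g (i + k) \<cdot> f i = h i)"
  using rep_comp[OF f g m] rep_inject[OF rep_comp(1)[OF f g m] h] by (auto simp: fun_eq_iff)

lemma op_of_eq: "f \<in> Hom \<C> X Y \<Longrightarrow> op_of f = rep B (cob X) (cob Y) 0 (cmp f)"
  by (auto simp: op_of_def Hom_CN)

text \<open>The product property is the cofreeness of \<open>S\<close> and the coproduct property its freeness, both
  translated by the description of maps into and out of \<open>\<mu>\<close>.\<close>

lemma cofree_direct_sum:
  assumes c: "cofree X S (rep B (cob S) X 0 e) s" and e: "gfam (cob S) X 0 e"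
  obtains j p where "is_direct_sum \<C> (\<lambda>n. mu N B n (X n)) S j p" "\<And>n. cmp (p n) n = e n"
proof -
  note C = cofreeD[OF c]
  let ?M = "\<lambda>n. mu N B n (X n)" and ?e = "rep B (cob S) X 0 e"
  obtain s' where s': "gfam X (cob S) (1 - int N) s'" "s = rep B X (cob S) (1 - int N) s'"
    using C(4) by (rule G_E)
  have X: "X n \<in> Obj B" for n using C(1) by (simp add: gobj_def)
  define a where "a n = n - int N + 1" for n
  have an: "n + (1 - int N) = a n" for n by (simp add: a_def)
  have "\<forall>n. \<exists>f. f \<in> Hom \<C> S (?M n) \<and> cmp f n = e n"
    using into_mu_exists[OF X C(2)] gfamD(1)[OF e] by (metis add.right_neutral)
  then obtain p where p: "\<And>n. p n \<in> Hom \<C> S (?M n)" "\<And>n. cmp (p n) n = e n" by metis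
  have "\<forall>n. \<exists>f. f \<in> Hom \<C> (?M n) S \<and> cmp f (a n) = s' n"
    using from_mu_exists[OF X C(2) a_def] gfamD(1)[OF s'(1)] unfolding an by metis
  then obtain j where j: "\<And>n. j n \<in> Hom \<C> (?M n) S" "\<And>n. cmp (j n) (a n) = s' n" by metis
  have pj: "Comp \<C> (p m) (j n) = (if m = n then Ident \<C> (?M n) else Zero \<C> (?M n) (?M m))"
    for m n
  proof (rule into_mu_eqI[OF X])
    show "Comp \<C> (p m) (j n) \<in> Hom \<C> (?M n) (?M m)"
      by (rule op_of_Comp(1)[OF j(1) p(1)])
    show "(if m = n then Ident \<C> (?M n) else Zero \<C> (?M n) (?M m)) \<in> Hom \<C> (?M n) (?M m)"
      using op_of_Ident(1)[OF mu_cx[OF X]] op_of_Zero(1)[OF mu_cx[OF X] mu_cx[OF X]] by auto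
    have "e m \<cdot> cmp (j n) m = (if m = n then Ident B (X n) else Zero B (cob (?M n) m) (X m))"
    proof (cases "a n \<le> m \<and> m \<le> n")
      case True
      (* in degree m the inclusion is d^k s, and m = n means k = N - 1 *)
      define k where "k = nat (m - a n)"
      have k: "k < N" "a n + int k = m" "k = N - 1 \<longleftrightarrow> m = n"
        using True two_le_N by (auto simp: k_def a_def)
      note dk = dpow_rep[OF cx_diff(2)[OF C(2)], of k]
      note ds = rep_comp[OF s'(1) conjunct1[OF dk] refl]
      note eds = rep_comp[OF ds(1) e refl]
      let ?F = "\<lambda>i. e (i + (1 - int N + int k)) \<cdot> dpow B S (i + (1 - int N)) k \<cdot> s' i"
      have "?e * (D S ^ k * s) = ?e * (D S ^ k * E S * s)"
        by (simp add: mult.assoc unit_left[OF C(4)])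
      also have "\<dots> = rep B X X (1 - int N + int k) ?F"
        using eds(2) ds(2) dk s'(2) by simp
      finally have r: "rep B X X (1 - int N + int k) ?F = (if k = N - 1 then unit X else 0)"
        using C(5)[OF k(1)] by simp
      have idx: "n + (1 - int N + int k) = m" "n + (1 - int N) = a n"
        using k(2) by (auto simp: a_def)
      let ?Z = "if k = N - 1 then (\<lambda>i. Ident B (X i)) else (\<lambda>i. Zero B (X i) (X (i + (1 - int N + int k))))"
      have "?F = ?Z"
      proof (rule rep_inject)
        show "gfam X X (1 - int N + int k) ?F" using eds(1) by simp
        show "gfam X X (1 - int N + int k)
          ?Z"
          using rep_zero(1)[OF C(1,1)] rep_unit[OF C(1)] two_le_N by (auto simp: of_nat_diff)
        show "rep B X X (1 - int N + int k) ?F = rep B X X (1 - int N + int k)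
          ?Z"
          unfolding r using rep_zero(2)[OF C(1,1)] two_le_N by (auto simp: of_nat_diff)
      qed
      from fun_cong[OF this, of n] have "e m \<cdot> dpow B S (a n) k \<cdot> s' n
          = (if m = n then Ident B (X n) else Zero B (X n) (X m))"
        unfolding idx k(3) by (auto simp: idx)
      moreover have "cmp (j n) m = dpow B S (a n) k \<cdot> s' n"
        using from_mu_cmp[OF X j(1) a_def, of n m] True by (simp add: j(2) k_def)
      ultimately show ?thesis using True by (simp add: mu_cob a_def)
    next
      case False
      then have "m \<noteq> n" using two_le_N by (auto simp: a_def)
      moreover have "e m \<cdot> Zero B (zero_object B) (cob S m) = Zero B (zero_object B) (X m)"
        using Comp_Zero_right[OF _ zero_object_Obj] gfamD(1)[OF e, of m] by simp
      moreover have "cmp (j n) m = Zero B (zero_object B) (cob S m)"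
        using from_mu_cmp[OF X j(1) a_def, of n m] False by (simp only: if_False)
      ultimately show ?thesis
        using False by (auto simp: mu_cob a_def)
    qed
    then show "cmp (Comp \<C> (p m) (j n)) m
      = cmp (if m = n then Ident \<C> (?M n) else Zero \<C> (?M n) (?M m)) m"
      by (simp add: cmp_Comp_CN p(2)) (simp add: CN_simps mu_cob_n)
  qed
  have coprod: "\<exists>!h. h \<in> Hom \<C> S T \<and> (\<forall>n. Comp \<C> h (j n) = f n)"
    if T: "cx T" and f: "\<And>n. f n \<in> Hom \<C> (?M n) T" for T f
  proof -
    define y where "y n = cmp (f n) (a n)" for n
    have y: "gfam X (cob T) (1 - int N) y"
      using gfamD(1)[OF chain_map_gfam[OF f]] C(1) cx_diff(1)[OF T] mu_cob_n(2)
      unfolding gfam_def an y_def a_def by (metis add.right_neutral)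
    have key: "(\<forall>n. Comp \<C> h (j n) = f n) \<longleftrightarrow> op_of h * s = rep B X (cob T) (1 - int N) y"
      if h: "h \<in> Hom \<C> S T" for h
    proof -
      have "Comp \<C> h (j n) = f n \<longleftrightarrow> cmp h (a n) \<cdot> s' n = y n" for n
        using from_mu_eqI[OF X op_of_Comp(1)[OF j(1) h] f a_def] cmp_Comp_CN j(2) y_def by metis
      then show ?thesis
        using rep_comp_eq_iff[OF s'(1) chain_map_gfam[OF h] y] by (simp add: op_of_eq[OF h] s'(2) an)
    qed
    note H = free_extend[OF c T G_rep[OF y]]
    obtain h where h: "h \<in> Hom \<C> S T" "op_of h * s = rep B X (cob T) (1 - int N) y"
      using op_of_surj[OF H(1)] H(2) by metis
    show ?thesis
    proof (rule ex1I[of _ h])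
      show "h \<in> Hom \<C> S T \<and> (\<forall>n. Comp \<C> h (j n) = f n)" using h key by blast
      fix h' assume h': "h' \<in> Hom \<C> S T \<and> (\<forall>n. Comp \<C> h' (j n) = f n)"
      then have "op_of h' = op_of h"
        using free_eqI[OF c op_of_chain op_of_chain] key h by metis
      then show "h' = h" using op_of_inject h' h by blast
    qed
  qed
  have prod: "\<exists>!h. h \<in> Hom \<C> T S \<and> (\<forall>n. Comp \<C> (p n) h = f n)"
    if T: "cx T" and f: "\<And>n. f n \<in> Hom \<C> T (?M n)" for T f
  proof -
    define y where "y n = cmp (f n) n" for n
    have y: "gfam (cob T) X 0 y"
      using gfamD(1)[OF chain_map_gfam[OF f]] C(1) cx_diff(1)[OF T] mu_cob_n(1)
      unfolding gfam_def y_def by (metis add.right_neutral)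
    have key: "(\<forall>n. Comp \<C> (p n) h = f n) \<longleftrightarrow> ?e * op_of h = rep B (cob T) X 0 y"
      if h: "h \<in> Hom \<C> T S" for h
    proof -
      have "Comp \<C> (p n) h = f n \<longleftrightarrow> e n \<cdot> cmp h n = y n" for n
        using into_mu_eqI[OF X op_of_Comp(1)[OF h p(1)] f] cmp_Comp_CN p(2) y_def by metis
      then show ?thesis
        using rep_comp_eq_iff[OF chain_map_gfam[OF h] e y] by (simp add: op_of_eq[OF h])
    qed
    note H = cofree_lift[OF c T G_rep[OF y]]
    then have "hsum (D S) (D T) (s * rep B (cob T) X 0 y) N \<in> Ch T S"
      using T C(2) by (simp add: Ch_def)
    then obtain h where h: "h \<in> Hom \<C> T S" "?e * op_of h = rep B (cob T) X 0 y"
      using op_of_surj H(3) by metis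
    show ?thesis
    proof (rule ex1I[of _ h])
      show "h \<in> Hom \<C> T S \<and> (\<forall>n. Comp \<C> (p n) h = f n)" using h key by blast
      fix h' assume h': "h' \<in> Hom \<C> T S \<and> (\<forall>n. Comp \<C> (p n) h' = f n)"
      then have "?e * op_of h' = ?e * op_of h" using key h by metis
      then have "op_of h' = op_of h"
        using cofree_eqI[OF c] Ch_D(3,4)[OF op_of_chain] h h' by blast
      then show "h' = h" using op_of_inject h' h by blast
    qed
  qed
  have "is_direct_sum \<C> ?M S j p"
    unfolding is_direct_sum_def
    by (intro conjI ballI allI impI coprod prod C(2)[folded Obj_CN] j(1) p(1) pj) (auto simp: Obj_CN)
  then show thesis using p(2) that by blast
qed

text \<open>Direct sums are unique up to isomorphism, so every direct sum of the complexes \<open>\<mu>\<close> carries the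
  structure of a cofree complex.\<close>

lemma direct_sum_cofree:
  assumes X: "gobj X" and ds: "is_direct_sum \<C> (\<lambda>n. mu N B n (X n)) S' j' p'"
  shows "gfam (cob S') X 0 (\<lambda>n. cmp (p' n) n)"
    "\<exists>s. cofree X S' (rep B (cob S') X 0 (\<lambda>n. cmp (p' n) n)) s"
proof -
  let ?M = "\<lambda>n. mu N B n (X n)" and ?e' = "rep B (cob S') X 0 (\<lambda>n. cmp (p' n) n)"
  have S': "cx S'" and p': "\<And>n. p' n \<in> Hom \<C> S' (?M n)"
    and univ': "\<And>T f. cx T \<Longrightarrow> (\<And>n. f n \<in> Hom \<C> T (?M n)) \<Longrightarrow>
      \<exists>!h. h \<in> Hom \<C> T S' \<and> (\<forall>n. Comp \<C> (p' n) h = f n)"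
    using ds by (auto simp: is_direct_sum_def Obj_CN)
  show e': "gfam (cob S') X 0 (\<lambda>n. cmp (p' n) n)"
    using gfamD(1)[OF chain_map_gfam[OF p']] X cx_diff(1)[OF S'] mu_cob_n(1)
    unfolding gfam_def by (metis add.right_neutral)
  obtain S e0 s where c0: "cofree X S e0 s" using cofree_exists[OF X] .
  obtain e where e: "gfam (cob S) X 0 e" "e0 = rep B (cob S) X 0 e" using cofreeD(3)[OF c0] by (rule G_E)
  note c = c0[unfolded e(2)]
  note C = cofreeD[OF c]
  let ?e = "rep B (cob S) X 0 e"
  obtain j p where d: "is_direct_sum \<C> ?M S j p" and pe: "\<And>n. cmp (p n) n = e n"
    using cofree_direct_sum[OF c e(1)] by blast
  have p: "\<And>n. p n \<in> Hom \<C> S (?M n)"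
    and univ: "\<And>T f. cx T \<Longrightarrow> (\<And>n. f n \<in> Hom \<C> T (?M n)) \<Longrightarrow>
      \<exists>!h. h \<in> Hom \<C> T S \<and> (\<forall>n. Comp \<C> (p n) h = f n)"
    using d by (auto simp: is_direct_sum_def Obj_CN)
  obtain f where f: "f \<in> Hom \<C> S S'" "\<And>n. Comp \<C> (p' n) f = p n"
    using univ'[OF C(2) p] by blast
  obtain g where g: "g \<in> Hom \<C> S' S" "\<And>n. Comp \<C> (p n) g = p' n"
    using univ[OF S' p'] by blast
  have "Comp \<C> (p' n) (Comp \<C> f g) = p' n" for n
    using category.Comp_assoc[OF category_CN g(1) f(1) p'] f(2) g(2) by metis
  moreover have "Comp \<C> (p' n) (Ident \<C> S') = p' n" for n
    by (rule category.Ident_right[OF category_CN p'])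
  ultimately have "Comp \<C> f g = Ident \<C> S'"
    using univ'[OF S' p'] op_of_Comp(1)[OF g(1) f(1)] op_of_Ident(1)[OF S'] by blast
  then have fg: "op_of f * op_of g = E S'"
    using op_of_Comp(2)[OF g(1) f(1)] op_of_Ident(2)[OF S'] by simp
  have ef: "?e' * op_of f = ?e"
    using rep_comp_eq_iff[OF chain_map_gfam[OF f(1)] e' e(1)] arg_cong[OF f(2), of "\<lambda>x. cmp x _"]
    by (simp add: op_of_eq[OF f(1)] cmp_Comp_CN pe)
  have eg: "?e * op_of g = ?e'"
    using rep_comp_eq_iff[OF chain_map_gfam[OF g(1)] e(1) e'] arg_cong[OF g(2), of "\<lambda>x. cmp x _"]
    by (simp add: op_of_eq[OF g(1)] cmp_Comp_CN pe[symmetric])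
  note F = Ch_D[OF op_of_chain[OF f(1)]] and Gg = Ch_D[OF op_of_chain[OF g(1)]]
  have "?e' * (D S' ^ k * (op_of f * s)) = (if k = N - 1 then unit X else 0)" if "k < N" for k
  proof -
    have "?e' * (D S' ^ k * (op_of f * s)) = ?e' * ((D S' ^ k * op_of f) * s)"
      by (simp add: mult.assoc)
    also have "\<dots> = ?e' * op_of f * (D S ^ k * s)"
      by (simp add: power_mult_commute[OF F(4)] mult.assoc)
    finally show ?thesis using C(5)[OF that] by (simp add: ef)
  qed
  moreover have "hsum (D S') (D S') (op_of f * s * ?e') N = E S'"
  proof -
    have "hsum (D S') (D S') (op_of f * (s * ?e) * op_of g) N
        = op_of f * hsum (D S) (D S) (s * ?e) N * op_of g"
      by (simp only: hsum_mult[OF Gg(4)] mult_hsum[OF F(4)[symmetric]] mult.assoc)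
    then show ?thesis by (simp add: C(6) F(6) fg mult.assoc eg)
  qed
  moreover have "op_of f * s \<in> G X (cob S') (1 - int N)" by (rule G_mult[OF F(3) C(4)]) simp
  ultimately have "cofree X S' ?e' (op_of f * s)"
    using X S' G_rep[OF e'] by (simp add: cofree_def mult.assoc)
  then show "\<exists>s. cofree X S' ?e' s" by blast
qed

section \<open>The suspension\<close>

abbreviation (input) \<I> where "\<I> \<equiv> mu_sum_obj N B"
abbreviation (input) Imap where "Imap \<equiv> mu_sum_map N B"
abbreviation (input) \<S> where "\<S> \<equiv> susp_obj N B"
abbreviation (input) Smap where "Smap \<equiv> susp_map N B"
abbreviation (input) Sproj where "Sproj \<equiv> susp_proj N B"

text \<open>The projections \<open>\<epsilon>\<close> from \<open>I X\<close> to \<open>X\<close>: in degree \<open>n\<close> the component of the projection onto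
  \<open>\<mu>\<^sup>n(X\<^sup>n)\<close>.\<close>

definition counit :: "('o, 'a) ncomplex \<Rightarrow> ('o, 'a) gelem endo" where
  "counit X = rep B (cob (\<I> X)) (cob X) 0 (\<lambda>n. cmp (mu_proj N B X n) n)"

lemma mu_sum_direct_sum:
  assumes X: "cx X"
  obtains j where "is_direct_sum \<C> (\<lambda>n. mu N B n (cob X n)) (\<I> X) j (mu_proj N B X)"
proof -
  obtain S e s where c: "cofree (cob X) S e s" using cofree_exists[OF cx_diff(1)[OF X]] .
  obtain e' where e: "gfam (cob S) (cob X) 0 e'" "e = rep B (cob S) (cob X) 0 e'"
    using cofreeD(3)[OF c] by (rule G_E)
  have "\<exists>j p. is_direct_sum \<C> (\<lambda>n. mu N B n (cob X n)) S j p"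
    using cofree_direct_sum[OF c[unfolded e(2)] e(1)] by metis
  then have "\<exists>z. case z of (S, j, p) \<Rightarrow> is_direct_sum \<C> (\<lambda>n. mu N B n (cob X n)) S j p"
    by auto
  then have "case mu_sum N B X of (S, j, p) \<Rightarrow> is_direct_sum \<C> (\<lambda>n. mu N B n (cob X n)) S j p"
    unfolding mu_sum_def by (rule someI_ex)
  then show thesis
    using that by (cases "mu_sum N B X") (auto simp: mu_sum_obj_def mu_proj_def)
qed

lemma mu_sum_cofree:
  assumes X: "cx X"
  obtains s where "cofree (cob X) (\<I> X) (counit X) s"
    "gfam (cob (\<I> X)) (cob X) 0 (\<lambda>n. cmp (mu_proj N B X n) n)"
proof -
  obtain j where "is_direct_sum \<C> (\<lambda>n. mu N B n (cob X n)) (\<I> X) j (mu_proj N B X)"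
    using mu_sum_direct_sum[OF X] .
  from direct_sum_cofree[OF cx_diff(1)[OF X] this] show thesis
    using that unfolding counit_def by blast
qed

lemma mu_proj:
  assumes X: "cx X"
  shows "mu_proj N B X n \<in> Hom \<C> (\<I> X) (mu N B n (cob X n))"
    "cx T \<Longrightarrow> (\<And>n. f n \<in> Hom \<C> T (mu N B n (cob X n))) \<Longrightarrow>
      \<exists>!h. h \<in> Hom \<C> T (\<I> X) \<and> (\<forall>n. Comp \<C> (mu_proj N B X n) h = f n)"
proof -
  obtain j where "is_direct_sum \<C> (\<lambda>n. mu N B n (cob X n)) (\<I> X) j (mu_proj N B X)"
    using mu_sum_direct_sum[OF X] .
  then show "mu_proj N B X n \<in> Hom \<C> (\<I> X) (mu N B n (cob X n))"
    "cx T \<Longrightarrow> (\<And>n. f n \<in> Hom \<C> T (mu N B n (cob X n))) \<Longrightarrow>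
      \<exists>!h. h \<in> Hom \<C> T (\<I> X) \<and> (\<forall>n. Comp \<C> (mu_proj N B X n) h = f n)"
    by (auto simp: is_direct_sum_def Obj_CN)
qed

text \<open>The map \<open>\<lambda>\<close> is the chain map that cofreeness assigns to the identity of the graded object \<open>X\<close>.\<close>

lemma lam_Hom:
  assumes X: "cx X"
  shows "lam N B X \<in> Hom \<C> X (\<I> X)" "counit X * op_of (lam N B X) = E X"
proof -
  have l: "lam N B X \<in> Hom \<C> X (\<I> X) \<and>
      (\<forall>n. Comp \<C> (mu_proj N B X n) (lam N B X) = lam_comp N B X n)"
    unfolding lam_def by (rule theI') (rule mu_proj(2)[OF X X lam_comp_Hom(1)[OF X]])
  then show 1: "lam N B X \<in> Hom \<C> X (\<I> X)" ..
  have "cmp (mu_proj N B X n) n \<cdot> cmp (lam N B X) n = Ident B (cob X n)" for n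
    using l lam_comp_Hom(2)[OF X] cmp_Comp_CN by metis
  moreover obtain s where "gfam (cob (\<I> X)) (cob X) 0 (\<lambda>n. cmp (mu_proj N B X n) n)"
    using mu_sum_cofree[OF X] .
  ultimately show "counit X * op_of (lam N B X) = E X"
    using rep_comp_eq_iff[OF chain_map_gfam[OF 1] _ rep_unit[OF cx_diff(1)[OF X]]]
    by (simp add: counit_def op_of_eq[OF 1])
qed

lemma mu_sum_map_Hom:
  assumes f: "f \<in> Hom \<C> X Y"
  shows "Imap f \<in> Hom \<C> (\<I> X) (\<I> Y)"
    "counit Y * op_of (Imap f) = op_of f * counit X"
proof -
  note F = Ch_D[OF op_of_chain[OF f]]
  have st: "src f = X" "tgt f = Y" using f by (auto simp: Hom_CN)
  have fn: "cmp f n \<in> Hom B (cob X n) (cob Y n)" for n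
    using gfamD(1)[OF chain_map_gfam[OF f], of n] by simp
  have S: "cx (\<I> X)" using mu_sum_cofree[OF F(1)] cofreeD(2) by metis
  have g: "Imap f \<in> Hom \<C> (\<I> X) (\<I> Y) \<and>
      (\<forall>n. Comp \<C> (mu_proj N B Y n) (Imap f)
         = Comp \<C> (mu_map N B n (cmp f n)) (mu_proj N B X n))"
    unfolding mu_sum_map_def st
    by (rule theI') (rule mu_proj(2)[OF F(2) S], rule op_of_Comp(1)[OF mu_proj(1)[OF F(1)] mu_map_Hom(1)[OF fn]])
  then show 1: "Imap f \<in> Hom \<C> (\<I> X) (\<I> Y)" ..
  obtain s where eX: "gfam (cob (\<I> X)) (cob X) 0 (\<lambda>n. cmp (mu_proj N B X n) n)"
    using mu_sum_cofree[OF F(1)] .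
  obtain s' where eY: "gfam (cob (\<I> Y)) (cob Y) 0 (\<lambda>n. cmp (mu_proj N B Y n) n)"
    using mu_sum_cofree[OF F(2)] .
  note r = rep_comp[OF eX chain_map_gfam[OF f], of 0, simplified]
  have "cmp (mu_proj N B Y n) n \<cdot> cmp (Imap f) n = cmp f n \<cdot> cmp (mu_proj N B X n) n" for n
    using g mu_map_Hom(2)[OF fn] cmp_Comp_CN by metis
  then show "counit Y * op_of (Imap f) = op_of f * counit X"
    using rep_comp_eq_iff[OF chain_map_gfam[OF 1] eY r(1)] r(2)
    by (simp add: counit_def op_of_eq[OF 1] op_of_eq[OF f])
qed

lemma susp_split_seq:
  assumes X: "cx X"
  shows "split_seq X (\<I> X) (\<S> X) (op_of (lam N B X)) (op_of (Sproj X))"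
    "Sproj X \<in> Hom \<C> (\<I> X) (\<S> X)"
    "contractible (\<I> X)"
proof -
  obtain s where c: "cofree (cob X) (\<I> X) (counit X) s" using mu_sum_cofree[OF X] .
  then show "contractible (\<I> X)" by (rule cofree_contractible)
  note l = lam_Hom[OF X]
  obtain Q q where Q: "split_seq X (\<I> X) Q (op_of (lam N B X)) q"
    using cofree_split_seq[OF c op_of_chain[OF l(1)] l(2)] .
  obtain c where "is_cokernel \<C> (lam N B X) Q c"
    using split_seq_cokernel[OF Q l(1) refl] .
  then have "\<exists>z. case z of (Q, q) \<Rightarrow> is_cokernel \<C> (lam N B X) Q q" by auto
  then have "case susp_cokernel N B X of (Q, q) \<Rightarrow> is_cokernel \<C> (lam N B X) Q q"
    unfolding susp_cokernel_def by (rule someI_ex)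
  then have k: "is_cokernel \<C> (lam N B X) (\<S> X) (Sproj X)"
    by (auto simp: susp_obj_def susp_proj_def split: prod.splits)
  show "split_seq X (\<I> X) (\<S> X) (op_of (lam N B X)) (op_of (Sproj X))"
    by (rule cokernel_split_seq[OF Q l(1) refl k])
  have "Cod \<C> (lam N B X) = \<I> X" using l(1) by (simp add: Hom_def)
  then show "Sproj X \<in> Hom \<C> (\<I> X) (\<S> X)"
    using k by (simp add: is_cokernel_def)
qed

lemma mu_sum_map_lam:
  assumes f: "f \<in> Hom \<C> X Y"
  shows "op_of (Imap f) * op_of (lam N B X) = op_of (lam N B Y) * op_of f"
proof -
  note F = Ch_D[OF op_of_chain[OF f]]
  note lX = lam_Hom[OF F(1)] and lY = lam_Hom[OF F(2)] and I = mu_sum_map_Hom[OF f]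
  obtain s where c: "cofree (cob Y) (\<I> Y) (counit Y) s" using mu_sum_cofree[OF F(2)] .
  note a = Ch_mult[OF op_of_chain[OF I(1)] op_of_chain[OF lX(1)]]
    and b = Ch_mult[OF op_of_chain[OF lY(1)] op_of_chain[OF f]]
  show ?thesis
  proof (rule cofree_eqI[OF c Ch_D(3,4)[OF a] Ch_D(3,4)[OF b]])
    have "counit Y * (op_of (Imap f) * op_of (lam N B X)) = op_of f * (counit X * op_of (lam N B X))"
      by (simp add: mult.assoc[symmetric] I(2))
    also have "\<dots> = counit Y * (op_of (lam N B Y) * op_of f)"
      by (simp add: lX(2) F(6)) (simp add: mult.assoc[symmetric] lY(2) F(5))
    finally show "counit Y * (op_of (Imap f) * op_of (lam N B X))
      = counit Y * (op_of (lam N B Y) * op_of f)" .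
  qed
qed

lemma susp_map_Hom:
  assumes f: "f \<in> Hom \<C> X Y"
  shows "Smap f \<in> Hom \<C> (\<S> X) (\<S> Y)"
    "op_of (Smap f) * op_of (Sproj X) = op_of (Sproj Y) * op_of (Imap f)"
proof -
  note F = Ch_D[OF op_of_chain[OF f]]
  have st: "src f = X" "tgt f = Y" using f by (auto simp: Hom_CN)
  note sX = susp_split_seq[OF F(1)] and sY = susp_split_seq[OF F(2)] and I = mu_sum_map_Hom[OF f]
  let ?P = "\<lambda>h. h \<in> Hom \<C> (\<S> X) (\<S> Y) \<and>
    Comp \<C> h (Sproj X) = Comp \<C> (Sproj Y) (Imap f)"
  note qI = op_of_Comp[OF I(1) sY(2)]
  have P: "?P h \<longleftrightarrow> h \<in> Hom \<C> (\<S> X) (\<S> Y) \<and>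
    op_of h * op_of (Sproj X) = op_of (Sproj Y) * op_of (Imap f)" for h
    using op_of_Comp[OF sX(2), of h "\<S> Y"] qI op_of_inject[OF _ qI(1)] by metis
  have "op_of (Sproj Y) * op_of (lam N B Y) = 0" using sY(1) by (rule split_seqE)
  then have "(op_of (Sproj Y) * op_of (Imap f)) * op_of (lam N B X) = 0"
    by (simp add: mult.assoc mu_sum_map_lam[OF f]) (simp add: mult.assoc[symmetric])
  then obtain h where h: "h \<in> Ch (\<S> X) (\<S> Y)"
    "h * op_of (Sproj X) = op_of (Sproj Y) * op_of (Imap f)"
    using split_seq_factor[OF sX(1) Ch_mult[OF op_of_chain[OF sY(2)] op_of_chain[OF I(1)]]] by blast
  obtain h' where "?P h'" using op_of_surj[OF h(1)] h(2) P by metis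
  moreover have "k = h'" if "?P h'" "?P k" for h' k
    using that P split_seq_epi[OF sX(1) Ch_D(3)[OF op_of_chain] Ch_D(3)[OF op_of_chain]] op_of_inject by metis
  ultimately have "?P (Smap f)"
    unfolding susp_map_def st by (intro theI'[of ?P]) blast
  then show "Smap f \<in> Hom \<C> (\<S> X) (\<S> Y)"
    "op_of (Smap f) * op_of (Sproj X) = op_of (Sproj Y) * op_of (Imap f)"
    using P by blast+
qed

lemma mu_sum_map_eqI:
  assumes f: "f \<in> Hom \<C> X Y" and I: "I \<in> Ch (\<I> X) (\<I> Y)"
    and eq: "counit Y * I = op_of f * counit X"
  shows "op_of (Imap f) = I"
proof -
  obtain s where c: "cofree (cob Y) (\<I> Y) (counit Y) s"
    using mu_sum_cofree[OF Ch_D(2)[OF op_of_chain[OF f]]] .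
  note J = mu_sum_map_Hom[OF f]
  show ?thesis
    by (rule cofree_eqI[OF c Ch_D(3,4)[OF op_of_chain[OF J(1)]] Ch_D(3,4)[OF I]]) (simp add: J(2) eq)
qed

lemma susp_map_eqI:
  assumes f: "f \<in> Hom \<C> X Y" and h: "h \<in> Hom \<C> (\<S> X) (\<S> Y)"
    and eq: "op_of h * op_of (Sproj X) = op_of (Sproj Y) * op_of (Imap f)"
  shows "Smap f = h"
proof -
  note s = susp_map_Hom[OF f] and q = susp_split_seq(1)[OF Ch_D(1)[OF op_of_chain[OF f]]]
  have "op_of (Smap f) = op_of h"
    using split_seq_epi[OF q Ch_D(3)[OF op_of_chain[OF s(1)]] Ch_D(3)[OF op_of_chain[OF h]]] s(2) eq by simp
  then show ?thesis by (rule op_of_inject[OF s(1) h])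
qed

lemma susp_map_Ident:
  assumes X: "cx X"
  shows "Smap (Ident \<C> X) = Ident \<C> (\<S> X)"
proof -
  note i = op_of_Ident[OF X]
  note q = op_of_chain[OF susp_split_seq(2)[OF X]]
  note S = Ch_D(1)[OF q] and Q = Ch_D(2)[OF q]
  obtain s where c: "cofree (cob X) (\<I> X) (counit X) s" using mu_sum_cofree[OF X] .
  have "op_of (Imap (Ident \<C> X)) = E (\<I> X)"
    by (rule mu_sum_map_eqI[OF i(1) Ch_unit[OF S]])
      (simp add: i(2) unit_left[OF cofreeD(3)[OF c]] unit_right[OF cofreeD(3)[OF c]])
  then show ?thesis
    by (intro susp_map_eqI[OF i(1) op_of_Ident(1)[OF Q]])
      (simp add: op_of_Ident(2)[OF Q] Ch_D(5,6)[OF q])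
qed

lemma susp_map_Comp:
  assumes f: "f \<in> Hom \<C> X Y" and g: "g \<in> Hom \<C> Y Z"
  shows "Smap (Comp \<C> g f) = Comp \<C> (Smap g) (Smap f)"
proof -
  note gf = op_of_Comp[OF f g]
  note If = mu_sum_map_Hom[OF f] and Ig = mu_sum_map_Hom[OF g]
  note sf = susp_map_Hom[OF f] and sg = susp_map_Hom[OF g]
  have "op_of (Imap (Comp \<C> g f)) = op_of (Imap g) * op_of (Imap f)"
    by (rule mu_sum_map_eqI[OF gf(1) Ch_mult[OF op_of_chain[OF Ig(1)] op_of_chain[OF If(1)]]])
      (simp add: mult.assoc[symmetric] Ig(2), simp add: mult.assoc If(2) gf(2))
  then show ?thesis
    by (intro susp_map_eqI[OF gf(1) op_of_Comp(1)[OF sf(1) sg(1)]])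
      (simp add: op_of_Comp(2)[OF sf(1) sg(1)] mult.assoc sf(2),
       simp add: mult.assoc[symmetric] sg(2))
qed

lemma susp_map_homotopy:
  assumes f: "f \<in> Hom \<C> X Y" and g: "g \<in> Hom \<C> X Y" and fg: "op_of f - op_of g \<in> Nh X Y"
  shows "op_of (Smap f) - op_of (Smap g) \<in> Nh (\<S> X) (\<S> Y)"
proof -
  note F = Ch_D[OF op_of_chain[OF f]]
  note sX = susp_split_seq[OF F(1)] and sY = susp_split_seq[OF F(2)]
  note If = mu_sum_map_Hom[OF f] and Ig = mu_sum_map_Hom[OF g]
  note sf = susp_map_Hom[OF f] and sg = susp_map_Hom[OF g]
  show ?thesis
  proof (rule split_seq_map_null[OF sX(1) sY(1) sY(3) fg])
    show "op_of (Imap f) - op_of (Imap g) \<in> Ch (\<I> X) (\<I> Y)"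
      by (rule Ch_diff[OF op_of_chain[OF If(1)] op_of_chain[OF Ig(1)]])
    show "op_of (Smap f) - op_of (Smap g) \<in> Ch (\<S> X) (\<S> Y)"
      by (rule Ch_diff[OF op_of_chain[OF sf(1)] op_of_chain[OF sg(1)]])
  qed (simp_all add: left_diff_distrib right_diff_distrib mu_sum_map_lam[OF f] mu_sum_map_lam[OF g] sf(2) sg(2))
qed

section \<open>The shift\<close>

definition Sh :: "int \<Rightarrow> ('o, 'a) ncomplex \<Rightarrow> ('o, 'a) ncomplex" where
  "Sh m X = \<lparr>cob = shifted m (cob X), diff = (\<lambda>i. diff X (i + m))\<rparr>"

definition Sh_map :: "int \<Rightarrow> ('o, 'a) chain_map \<Rightarrow> ('o, 'a) chain_map" where
  "Sh_map m f = \<lparr>src = Sh m (src f), tgt = Sh m (tgt f), cmp = (\<lambda>i. cmp f (i + m))\<rparr>"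

abbreviation from_sh :: "int \<Rightarrow> ('o, 'a) ncomplex \<Rightarrow> ('o, 'a) gelem endo" where
  "from_sh m X \<equiv> from_shift m (cob X)"

abbreviation to_sh :: "int \<Rightarrow> ('o, 'a) ncomplex \<Rightarrow> ('o, 'a) gelem endo" where
  "to_sh m X \<equiv> to_shift m (cob X)"

lemma Sh_sel: "cob (Sh m X) = shifted m (cob X)" "diff (Sh m X) = (\<lambda>i. diff X (i + m))"
  by (simp_all add: Sh_def)

text \<open>Shifting the index of a family is conjugation by the identity of \<open>X\<close>, viewed as a map of degree
  \<open>m\<close> from the shifted object.\<close>

lemma rep_shift:
  assumes f: "gfam X Y k f"
  shows "gfam (shifted m X) (shifted m Y) k (\<lambda>i. f (i + m))"
    "rep B (shifted m X) (shifted m Y) k (\<lambda>i. f (i + m)) = to_shift m Y * rep B X Y k f * from_shift m X"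
proof -
  have X: "gobj X" and Y: "gobj Y" using f by (auto simp: gfam_def)
  note sX = shift_maps[OF X, of m] and sY = shift_maps[OF Y, of m]
  have *: "f (i + m) \<in> Hom B (X (i + m)) (Y (i + k + m))" for i
    using gfamD(1)[OF f, of "i + m"] by (simp add: add_ac)
  then show "gfam (shifted m X) (shifted m Y) k (\<lambda>i. f (i + m))"
    using sX(1) sY(1) by (simp add: gfam_def) (simp add: shifted_def)
  note a = rep_comp[OF sX(2) f refl]
  have "k = m + k + - m" by simp
  note b = rep_comp[OF a(1) sY(3) this]
  have "Ident B (Y (i + (m + k))) \<cdot> f (i + m) \<cdot> Ident B (X (i + m)) = f (i + m)" for i
    using Ident_right[OF *] Ident_left[OF *] by (simp add: add_ac)
  then show "rep B (shifted m X) (shifted m Y) k (\<lambda>i. f (i + m))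
      = to_shift m Y * rep B X Y k f * from_shift m X"
    using a(2) b(2) by (simp add: mult.assoc)
qed

lemma shift_ops:
  assumes X: "cx X"
  shows "from_sh m X \<in> G (cob (Sh m X)) (cob X) m" "to_sh m X \<in> G (cob X) (cob (Sh m X)) (- m)"
    "from_sh m X * to_sh m X = E X" "to_sh m X * from_sh m X = E (Sh m X)"
    "D (Sh m X) * to_sh m X = to_sh m X * D X" "D X * from_sh m X = from_sh m X * D (Sh m X)"
    "cx (Sh m X)"
proof -
  note s = shift_maps[OF cx_diff(1)[OF X], of m]
  show 1: "from_sh m X \<in> G (cob (Sh m X)) (cob X) m" "to_sh m X \<in> G (cob X) (cob (Sh m X)) (- m)"
    and 2: "from_sh m X * to_sh m X = E X" "to_sh m X * from_sh m X = E (Sh m X)"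
    using s by (auto simp: Sh_sel)
  note r = rep_shift[OF cx_diff(2)[OF X], of m]
  have D: "D (Sh m X) = to_sh m X * D X * from_sh m X" using r(2) by (simp add: Sh_sel)
  show to_sh: "D (Sh m X) * to_sh m X = to_sh m X * D X" by (simp add: D mult.assoc 2 D_typed X)
  show "D X * from_sh m X = from_sh m X * D (Sh m X)"
    by (simp add: D mult.assoc[symmetric] 2 D_typed X)
  have "D (Sh m X) ^ N = D (Sh m X) ^ N * E (Sh m X)"
    using two_le_N unit_right[OF G_rep[OF r(1)]]
    by (cases N) (simp_all add: power_Suc2 mult.assoc Sh_sel del: power_Suc)
  also have "\<dots> = (D (Sh m X) ^ N * to_sh m X) * from_sh m X" by (simp add: 2 mult.assoc)
  also have "\<dots> = 0" by (simp add: power_mult_commute[OF to_sh] D_power_N[OF X])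
  finally show "cx (Sh m X)"
    using cx_intro[OF r(1)] by (simp add: Sh_def)
qed

lemma Sh_map_Hom:
  assumes f: "f \<in> Hom \<C> X Y"
  shows "Sh_map m f \<in> Hom \<C> (Sh m X) (Sh m Y)" "op_of (Sh_map m f) = to_sh m Y * op_of f * from_sh m X"
proof -
  note F = Ch_D[OF op_of_chain[OF f]]
  note sX = shift_ops[OF F(1), of m] and sY = shift_ops[OF F(2), of m]
  note r = rep_shift[OF chain_map_gfam[OF f], of m]
  have st: "src f = X" "tgt f = Y" using f by (auto simp: Hom_CN)
  show op: "op_of (Sh_map m f) = to_sh m Y * op_of f * from_sh m X"
    using r(2) by (simp add: op_of_def Sh_map_def Sh_sel st)
  have "D (Sh m Y) * (to_sh m Y * op_of f * from_sh m X) = to_sh m Y * (D Y * op_of f) * from_sh m X"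
    by (simp add: mult.assoc[symmetric] sY(5))
  also have "\<dots> = to_sh m Y * op_of f * from_sh m X * D (Sh m X)"
    by (simp add: F(4) mult.assoc sX(6))
  finally show "Sh_map m f \<in> Hom \<C> (Sh m X) (Sh m Y)"
    using r(1) sX(7) sY(7) op
    by (simp add: Hom_CN is_chain_map_iff) (simp add: Sh_map_def st Sh_sel)
qed

lemma Sh_map_null:
  assumes X: "cx X" and Y: "cx Y" and f: "f \<in> Nh X Y"
  shows "to_sh m Y * f * from_sh m X \<in> Nh (Sh m X) (Sh m Y)"
proof -
  note sX = shift_ops[OF X, of m] and sY = shift_ops[OF Y, of m]
  obtain s where s: "s \<in> G (cob X) (cob Y) (1 - int N)" "f = hsum (D Y) (D X) s N"
    using f by (auto simp: Nh_def)
  have "to_sh m Y * f * from_sh m X = hsum (D (Sh m Y)) (D (Sh m X)) (to_sh m Y * s * from_sh m X) N"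
    unfolding s(2) by (simp only: mult.assoc[symmetric] mult_hsum[OF sY(5)[symmetric]] hsum_mult[OF sX(6)])
  moreover have "to_sh m Y * s * from_sh m X \<in> G (cob (Sh m X)) (cob (Sh m Y)) (1 - int N)"
    by (rule G_mult[OF G_mult[OF sY(2) s(1) refl] sX(1)]) simp
  ultimately show ?thesis by (auto simp: Nh_def)
qed

lemma Sh_contractible: assumes "contractible X" shows "contractible (Sh m X)"
proof -
  have X: "cx X" "E X \<in> Nh X X" using assms by (auto simp: contractible_def)
  note s = shift_ops[OF X(1), of m]
  have "to_sh m X * E X * from_sh m X = E (Sh m X)"
    using unit_right[OF s(2)] s(4) by simp
  then show ?thesis using Sh_map_null[OF X(1,1,2), of m] s(7) by (simp add: contractible_def)
qed

section \<open>A split sequence from the suspension to the shift\<close>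

lemma window_sum_eqI:
  assumes w: "window_sum X K S p i" and f: "unit S * f = f" and g: "unit S * g = g"
    and eq: "\<And>k. k \<in> K \<Longrightarrow> p k * f = p k * g"
  shows "f = g"
proof -
  have "unit S * f = (\<Sum>k\<in>K. i k * (p k * f))"
    using w by (simp add: window_sum_def sum_distrib_right[symmetric] mult.assoc[symmetric])
  also have "\<dots> = (\<Sum>k\<in>K. i k * (p k * g))" using eq by simp
  also have "\<dots> = unit S * g"
    using w by (simp add: window_sum_def sum_distrib_right[symmetric] mult.assoc[symmetric])
  finally show ?thesis using f g by simp
qed

text \<open>The chain map \<open>d'\<close> of degree \<open>1\<close> on the cofree complex that lifts the differential of \<open>X\<close>.\<close>

definition lifted_diff :: "('o, 'a) ncomplex \<Rightarrow> ('o, 'a) ncomplex \<Rightarrow> ('o, 'a) gelem endo \<Rightarrow> ('o, 'a) gelem endo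
    \<Rightarrow> ('o, 'a) gelem endo" where
  "lifted_diff X S e s = hsum (D S) (D S) (s * (D X * e)) N"

lemma lifted_diff:
  assumes X: "cx X" and c: "cofree (cob X) S e s"
  shows "lifted_diff X S e s \<in> G (cob S) (cob S) 1" "D S * lifted_diff X S e s = lifted_diff X S e s * D S"
    "e * lifted_diff X S e s = D X * e"
proof -
  note C = cofreeD[OF c]
  have "D X * e \<in> G (cob S) (cob X) 1" by (rule G_mult[OF cx_diff(3)[OF X] C(3)]) simp
  from cofree_lift[OF c C(2) this] show "lifted_diff X S e s \<in> G (cob S) (cob S) 1"
    "D S * lifted_diff X S e s = lifted_diff X S e s * D S" "e * lifted_diff X S e s = D X * e"
    by (simp_all add: lifted_diff_def)
qed

lemma hsum_lifted_diff:
  assumes X: "cx X" and c: "cofree (cob X) S e s"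
  shows "hsum (D X) (D S) e k * lifted_diff X S e s = D X * hsum (D X) (D S) e k"
proof -
  note d = lifted_diff[OF X c]
  have "hsum (D X) (D S) e k * lifted_diff X S e s = hsum (D X) (D S) (D X * e) k"
    using hsum_mult[of "D S" "lifted_diff X S e s" "D S" "D X" e k] d by simp
  also have "\<dots> = D X * hsum (D X) (D S) e k" by (rule mult_hsum[symmetric]) simp
  finally show ?thesis .
qed

lemma hsum_counit_commute:
  assumes X: "cx X" and c: "cofree (cob X) S e s"
  shows "D X * hsum (D X) (D S) e N = hsum (D X) (D S) e N * D S"
    "hsum (D X) (D S) e N \<in> G (cob S) (cob X) (int N - 1)"
    "hsum (D X) (D S) e N * s = E X"
proof -
  note C = cofreeD[OF c]
  have e: "e \<in> G (cob S) (cob X) ((int N - 1) + 1 - int N)" using C(3) by simp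
  show "D X * hsum (D X) (D S) e N = hsum (D X) (D S) e N * D S"
    "hsum (D X) (D S) e N \<in> G (cob S) (cob X) (int N - 1)"
    using hsum_chain[OF X C(2) e] by blast+
  show "hsum (D X) (D S) e N * s = E X"
    using hsum_free[OF c G_unit[OF C(1)], of "D X"] unit_left[OF C(3)] by simp
qed

text \<open>With the projections \<open>p\<^sub>k = e d\<^sup>k\<close> of \<open>S\<close> onto its summands, \<open>T\<close> is the map with components
  \<open>p\<^sub>k T = h\<^sub>k\<close>, the partial sums of the homotopy sum \<open>h\<^sub>N\<close>. On components, \<open>\<delta> T\<close> is
  \<open>h\<^sub>k\<^sub>+\<^sub>1 - d h\<^sub>k\<close>, which is \<open>p\<^sub>k\<close> by the left recursion of the sum, except that \<open>h\<^sub>N\<close> is missing for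
  \<open>k = N - 1\<close>; the term \<open>s h\<^sub>N\<close> supplies it. In the same way \<open>T \<delta>\<close> has components
  \<open>h\<^sub>k d - d h\<^sub>k\<close>, and the right recursion turns them into \<open>p\<^sub>k - d\<^sup>k e\<close>.\<close>

lemma difference_split:
  assumes X: "cx X" and c: "cofree (cob X) S e s" and l: "l \<in> Ch X S" "e * l = E X"
  defines "\<delta> \<equiv> D S - lifted_diff X S e s"
  obtains T where "T \<in> G (cob S) (cob S) (- 1)" "\<delta> * T + s * hsum (D X) (D S) e N = E S"
    "T * \<delta> = E S - l * e"
proof -
  note C = cofreeD[OF c] and d = lifted_diff[OF X c] and w = cofree_window_sum[OF c]
  define h where "h k = hsum (D X) (D S) e k" for k
  define T where "T = (\<Sum>k<N. D S ^ (N - 1 - k) * s * h k)"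
  have h: "h k \<in> G (cob S) (cob X) (int k - 1)" for k
    unfolding h_def by (rule G_hsum[OF cx_diff(3)[OF X] cx_diff(3)[OF C(2)] C(3)]) simp
  have typed: "T \<in> G (cob S) (cob S) (- 1)" unfolding T_def
  proof (rule G_sum[OF cx_diff(1)[OF C(2)] cx_diff(1)[OF C(2)]])
    fix k assume "k \<in> {..<N}"
    then have "D S ^ (N - 1 - k) * s \<in> G (cob X) (cob S) (- int k)" using w by (simp add: window_sum_def)
    then show "D S ^ (N - 1 - k) * s * h k \<in> G (cob S) (cob S) (- 1)"
      by (rule G_mult[OF _ h]) simp
  qed
  have pT: "e * D S ^ k * T = h k" if "k < N" for k
  proof -
    have "e * D S ^ k * T = (\<Sum>m<N. (e * D S ^ k * (D S ^ (N - 1 - m) * s)) * h m)"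
      by (simp add: T_def sum_distrib_left mult.assoc)
    also have "\<dots> = (\<Sum>m<N. if m = k then h k else 0)"
      using w that unit_left[OF h] by (intro sum.cong) (auto simp: window_sum_def)
    finally show ?thesis using that by (simp add: sum.delta)
  qed
  have hSuc: "h (Suc k) = D X * h k + e * D S ^ k" "h (Suc k) = h k * D S + D X ^ k * e" for k
    unfolding h_def by (simp, rule hsum_Suc_right)
  have pd: "e * D S ^ k * lifted_diff X S e s = D X * (e * D S ^ k)" for k
    using power_mult_commute[OF d(2), of k] d(3) by (simp add: mult.assoc) (simp add: mult.assoc[symmetric])
  have hN: "h N \<in> G (cob S) (cob X) (int N - 1)" by (rule h)
  have dS: "\<delta> \<in> G (cob S) (cob S) 1" unfolding \<delta>_def by (rule G_diff[OF cx_diff(3)[OF C(2)] d(1)])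
  have "\<delta> * T + s * h N = E S"
  proof (rule window_sum_eqI[OF w])
    have "\<delta> * T + s * h N \<in> G (cob S) (cob S) 0"
      by (intro G_add G_mult[OF dS typed] G_mult[OF C(4) hN]) simp_all
    then show "E S * (\<delta> * T + s * h N) = \<delta> * T + s * h N" by (rule unit_left)
    show "E S * E S = E S" by (rule D_typed[OF C(2)])
    fix k assume k: "k \<in> {..<N}"
    have "e * D S ^ k * (D S * T) = (if Suc k < N then h (Suc k) else 0)"
    proof (cases "Suc k < N")
      case True
      have "e * D S ^ k * (D S * T) = e * D S ^ Suc k * T"
        by (simp only: power_Suc2 mult.assoc)
      then show ?thesis using pT[OF True] True by simp
    next
      case False
      then have "e * D S ^ k * (D S * T) = e * D S ^ N * T"
        using k by (simp add: power_Suc2[symmetric] mult.assoc[symmetric] del: power_Suc)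
          (metis (no_types, lifting) Suc_lessI mult.assoc power_Suc2)
      then show ?thesis using False by (simp add: D_power_N[OF C(2)])
    qed
    moreover have "e * D S ^ k * (lifted_diff X S e s * T) = D X * h k"
    proof -
      have "e * D S ^ k * (lifted_diff X S e s * T) = (e * D S ^ k * lifted_diff X S e s) * T"
        by (simp only: mult.assoc)
      also have "\<dots> = (D X * (e * D S ^ k)) * T" by (simp only: pd)
      also have "\<dots> = D X * (e * D S ^ k * T)" by (simp only: mult.assoc)
      finally show ?thesis using pT k by simp
    qed
    moreover have "e * D S ^ k * (s * h N) = (if k = N - 1 then h N else 0)"
    proof -
      have "e * D S ^ k * (s * h N) = (e * (D S ^ k * s)) * h N" by (simp only: mult.assoc)
      then show ?thesis using C(5)[of k] k unit_left[OF hN] by simp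
    qed
    ultimately have eq: "e * D S ^ k * (\<delta> * T + s * h N) = (if Suc k < N then h (Suc k) else 0) - D X * h k
        + (if k = N - 1 then h N else 0)"
      by (simp only: \<delta>_def left_diff_distrib distrib_left right_diff_distrib)
    have "\<dots> = e * D S ^ k"
    proof (cases "Suc k < N")
      case True
      then have "k \<noteq> N - 1" by simp
      then show ?thesis using True by (simp add: hSuc(1))
    next
      case False
      then have "Suc k = N" using k by simp
      then show ?thesis using False hSuc(1)[of k] by auto
    qed
    also have "e * D S ^ k = e * D S ^ k * E S"
      using w k unit_right by (force simp: window_sum_def)
    finally show "e * D S ^ k * (\<delta> * T + s * h N) = e * D S ^ k * E S" using eq by simp
  qed
  moreover have "T * \<delta> = E S - l * e"
  proof (rule window_sum_eqI[OF w])
    have le: "l * e \<in> G (cob S) (cob S) 0" by (rule G_mult[OF Ch_D(3)[OF l(1)] C(3)]) simp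
    have "T * \<delta> \<in> G (cob S) (cob S) 0" by (rule G_mult[OF typed dS]) simp
    then show "E S * (T * \<delta>) = T * \<delta>" by (rule unit_left)
    show "E S * (E S - l * e) = E S - l * e"
      using unit_left[OF le] D_typed[OF C(2)] by (simp add: right_diff_distrib)
    fix k assume k: "k \<in> {..<N}"
    have "e * D S ^ k * (T * \<delta>) = h k * \<delta>" using pT k by (simp add: mult.assoc[symmetric])
    also have "\<dots> = h k * D S - D X * h k"
      using hsum_lifted_diff[OF X c, of k] by (simp add: \<delta>_def right_diff_distrib h_def)
    also have "\<dots> = e * D S ^ k - D X ^ k * e"
      using hSuc(1)[of k] hSuc(2)[of k] by (simp add: algebra_simps)
    also have "\<dots> = e * D S ^ k * (E S - l * e)"
    proof -
      have "e * D S ^ k * (l * e) = e * (D S ^ k * l) * e" by (simp only: mult.assoc)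
      also have "\<dots> = (e * l) * D X ^ k * e"
        by (simp only: power_mult_commute[OF Ch_D(4)[OF l(1)]] mult.assoc)
      also have "\<dots> = D X ^ k * (E X * e)"
        using power_mult_commute[of "D X" "E X" "D X" k] D_typed[OF X] by (simp add: l(2) mult.assoc[symmetric])
      finally have "e * D S ^ k * (l * e) = D X ^ k * e" using unit_left[OF C(3)] by simp
      moreover have "e * D S ^ k * E S = e * D S ^ k" using w k unit_right by (force simp: window_sum_def)
      ultimately show ?thesis by (simp add: right_diff_distrib)
    qed
    finally show "e * D S ^ k * (T * \<delta>) = e * D S ^ k * (E S - l * e)" .
  qed
  ultimately show thesis using typed that by (simp add: h_def)
qed

text \<open>Since \<open>\<delta>\<close> vanishes on \<open>X\<close>, it factors through \<open>Q\<close> as a map \<open>v\<close>. The map \<open>T\<close> of \<open>difference_split\<close>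
  gives the retraction \<open>q T\<close> of \<open>v\<close>, and the inclusion \<open>s\<close> of the last summand is a section of
  \<open>w\<close>. The factors \<open>to_sh\<close> and \<open>from_sh\<close> only turn maps of degree \<open>1\<close>, \<open>N - 1\<close> and \<open>N\<close> into maps of degree \<open>0\<close>
  between shifted complexes.\<close>

lemma second_split_seq:
  assumes X: "cx X" and c: "cofree (cob X) S e s" and l: "l \<in> Ch X S" "e * l = E X"
    and q: "split_seq X S Q l q"
  obtains v where "split_seq Q (Sh 1 S) (Sh (int N) X) v (to_sh (int N) X * hsum (D X) (D S) e N * from_sh 1 S)"
    "v * q = to_sh 1 S * (D S - lifted_diff X S e s)"
proof -
  note C = cofreeD[OF c] and d = lifted_diff[OF X c] and W = hsum_counit_commute[OF X c]
  define \<delta> where "\<delta> = D S - lifted_diff X S e s"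
  let ?W = "hsum (D X) (D S) e N"
  let ?w = "to_sh (int N) X * ?W * from_sh 1 S"
  note s1 = shift_ops[OF C(2), of 1] and sN = shift_ops[OF X, of "int N"]
  obtain T where T: "T \<in> G (cob S) (cob S) (- 1)" "\<delta> * T + s * ?W = E S" "T * \<delta> = E S - l * e"
    using difference_split[OF X c l] unfolding \<delta>_def .
  have dS: "\<delta> \<in> G (cob S) (cob S) 1" unfolding \<delta>_def by (rule G_diff[OF cx_diff(3)[OF C(2)] d(1)])
  have Ed: "E S * \<delta> = \<delta>" by (rule unit_left[OF dS])
  have Dd: "D S * \<delta> = \<delta> * D S" using d(2) by (simp add: \<delta>_def algebra_simps)
  have "lifted_diff X S e s * l = D S * l"
  proof (rule cofree_eqI[OF c])
    show "lifted_diff X S e s * l \<in> G (cob X) (cob S) 1" by (rule G_mult[OF d(1) Ch_D(3)[OF l(1)]]) simp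
    show "D S * l \<in> G (cob X) (cob S) 1" by (rule G_mult[OF cx_diff(3)[OF C(2)] Ch_D(3)[OF l(1)]]) simp
    show "D S * (lifted_diff X S e s * l) = lifted_diff X S e s * l * D X"
    proof -
      have "D S * (lifted_diff X S e s * l) = lifted_diff X S e s * (D S * l)"
        by (simp only: mult.assoc[symmetric] d(2))
      then show ?thesis by (simp only: Ch_D(4)[OF l(1)] mult.assoc)
    qed
    show "D S * (D S * l) = D S * l * D X" by (simp only: Ch_D(4)[OF l(1)] mult.assoc[symmetric])
    have "e * (lifted_diff X S e s * l) = D X * (e * l)" by (simp only: mult.assoc[symmetric] d(3))
    also have "\<dots> = e * (D S * l)"
      by (simp add: l(2) Ch_D(4)[OF l(1)] D_typed[OF X]) (simp add: mult.assoc[symmetric] l(2) D_typed[OF X])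
    finally show "e * (lifted_diff X S e s * l) = e * (D S * l)" .
  qed
  then have dl: "\<delta> * l = 0" by (simp add: \<delta>_def left_diff_distrib)
  have ud: "to_sh 1 S * \<delta> \<in> Ch S (Sh 1 S)"
  proof -
    have "to_sh 1 S * \<delta> \<in> G (cob S) (cob (Sh 1 S)) 0" by (rule G_mult[OF s1(2) dS]) simp
    moreover have "D (Sh 1 S) * (to_sh 1 S * \<delta>) = to_sh 1 S * \<delta> * D S"
      by (simp add: mult.assoc[symmetric] s1(5)) (simp add: mult.assoc Dd)
    ultimately show ?thesis using C(2) s1(7) by (simp add: Ch_def)
  qed
  have "(to_sh 1 S * \<delta>) * l = 0" by (simp add: mult.assoc dl)
  then obtain v where v: "v \<in> Ch Q (Sh 1 S)" "v * q = to_sh 1 S * \<delta>"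
    using split_seq_factor[OF q ud] by blast
  have Q: "q \<in> Ch S Q" "q * l = 0" using q by (auto elim: split_seqE)
  have w: "?w \<in> Ch (Sh 1 S) (Sh (int N) X)"
  proof -
    have "?w \<in> G (cob (Sh 1 S)) (cob (Sh (int N) X)) 0"
      by (rule G_mult[OF G_mult[OF sN(2) W(2) refl] s1(1)]) simp
    moreover have "D (Sh (int N) X) * ?w = ?w * D (Sh 1 S)"
    proof -
      have "D (Sh (int N) X) * ?w = to_sh (int N) X * (D X * ?W) * from_sh 1 S"
        by (simp only: mult.assoc[symmetric] sN(5))
      also have "\<dots> = ?w * D (Sh 1 S)" by (simp only: W(1) mult.assoc s1(6))
      finally show ?thesis .
    qed
    ultimately show ?thesis using sN(7) s1(7) by (simp add: Ch_def)
  qed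
  have wd: "?w * (to_sh 1 S * \<delta>) = 0"
  proof -
    have "?w * (to_sh 1 S * \<delta>) = to_sh (int N) X * (?W * (from_sh 1 S * to_sh 1 S * \<delta>))" by (simp only: mult.assoc)
    also have "\<dots> = to_sh (int N) X * (?W * \<delta>)" by (simp only: s1(3) Ed)
    also have "?W * \<delta> = 0"
      using hsum_lifted_diff[OF X c, of N] W(1) by (simp add: \<delta>_def right_diff_distrib)
    finally show ?thesis by simp
  qed
  have "(?w * v) * q = 0 * q" using wd by (simp add: mult.assoc v(2))
  then have wv: "?w * v = 0"
    by (rule split_seq_epi[OF q Ch_D(3)[OF Ch_mult[OF w v(1)]]
          Ch_D(3)[OF Ch_zero[OF Ch_D(2)[OF Q(1)] sN(7)]]])
  define r where "r = q * T * from_sh 1 S"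
  define t where "t = to_sh 1 S * s * from_sh (int N) X"
  have r: "r \<in> G (cob (Sh 1 S)) (cob Q) 0" unfolding r_def
    by (rule G_mult[OF G_mult[OF Ch_D(3)[OF Q(1)] T(1) refl] s1(1)]) simp
  have t: "t \<in> G (cob (Sh (int N) X)) (cob (Sh 1 S)) 0" unfolding t_def
    by (rule G_mult[OF G_mult[OF s1(2) C(4) refl] sN(1)]) simp
  have rv: "r * v = E Q"
  proof (rule split_seq_epi[OF q _ G_unit[OF G_obj(1)[OF Ch_D(3)[OF v(1)]]]])
    show "r * v \<in> G (cob Q) (cob Q) 0" by (rule G_mult[OF r Ch_D(3)[OF v(1)]]) simp
    have "(r * v) * q = q * T * (from_sh 1 S * to_sh 1 S) * \<delta>" by (simp add: r_def v(2) mult.assoc)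
    also have "\<dots> = q * (T * \<delta>)" using unit_right[OF T(1)] by (simp add: s1(3) mult.assoc Ed)
    also have "\<dots> = q"
      using Ch_D(6)[OF Q(1)] Q(2) by (simp add: T(3) right_diff_distrib mult.assoc[symmetric])
    finally show "(r * v) * q = E Q * q" using Ch_D(5)[OF Q(1)] by simp
  qed
  have wt: "?w * t = E (Sh (int N) X)"
  proof -
    have "?w * t = to_sh (int N) X * ?W * (from_sh 1 S * to_sh 1 S * s) * from_sh (int N) X" by (simp add: t_def mult.assoc)
    also have "\<dots> = to_sh (int N) X * (?W * s) * from_sh (int N) X"
      by (simp add: s1(3) unit_left[OF C(4)] mult.assoc)
    also have "\<dots> = E (Sh (int N) X)" by (simp add: W(3) unit_right[OF sN(2)] sN(4))
    finally show ?thesis .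
  qed
  have "v * r + t * ?w = E (Sh 1 S)"
  proof -
    have "v * r = to_sh 1 S * (\<delta> * T) * from_sh 1 S"
      by (simp only: r_def mult.assoc[symmetric] v(2))
    moreover have "t * ?w = to_sh 1 S * (s * (from_sh (int N) X * to_sh (int N) X * ?W)) * from_sh 1 S"
      by (simp only: t_def mult.assoc)
    ultimately have "v * r + t * ?w = to_sh 1 S * (\<delta> * T + s * ?W) * from_sh 1 S"
      by (simp add: sN(3) unit_left[OF W(2)] distrib_left distrib_right)
    then show ?thesis by (simp add: T(2) unit_right[OF s1(2)] s1(4))
  qed
  then have "split_seq Q (Sh 1 S) (Sh (int N) X) v ?w"
    using v(1) w wv r t rv wt unfolding split_seq_def by blast
  then show thesis using v(2) that by (simp add: \<delta>_def)
qed

text \<open>By \<open>cofree_eqI\<close> it is enough to compare the lifted differentials after composition with \<open>e'\<close>.\<close>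

lemma second_split_seq_natural:
  assumes X: "cx X" and cX: "cofree (cob X) S e s" and Y: "cx Y" and cY: "cofree (cob Y) S' e' s'"
    and f: "f \<in> Ch X Y" and I: "I \<in> Ch S S'" "e' * I = f * e"
  shows "(D S' - lifted_diff Y S' e' s') * I = I * (D S - lifted_diff X S e s)"
    "hsum (D Y) (D S') e' N * I = f * hsum (D X) (D S) e N"
proof -
  note dX = lifted_diff[OF X cX] and dY = lifted_diff[OF Y cY]
  have "lifted_diff Y S' e' s' * I = I * lifted_diff X S e s"
  proof (rule cofree_eqI[OF cY])
    show "lifted_diff Y S' e' s' * I \<in> G (cob S) (cob S') 1" by (rule G_mult[OF dY(1) Ch_D(3)[OF I(1)]]) simp
    show "I * lifted_diff X S e s \<in> G (cob S) (cob S') 1" by (rule G_mult[OF Ch_D(3)[OF I(1)] dX(1)]) simp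
    have "D S' * (lifted_diff Y S' e' s' * I) = lifted_diff Y S' e' s' * (D S' * I)"
      by (simp only: mult.assoc[symmetric] dY(2))
    then show "D S' * (lifted_diff Y S' e' s' * I) = lifted_diff Y S' e' s' * I * D S"
      by (simp only: Ch_D(4)[OF I(1)] mult.assoc)
    have "D S' * (I * lifted_diff X S e s) = I * (D S * lifted_diff X S e s)"
      by (simp only: mult.assoc[symmetric] Ch_D(4)[OF I(1)])
    then show "D S' * (I * lifted_diff X S e s) = I * lifted_diff X S e s * D S"
      by (simp only: dX(2) mult.assoc)
    have "e' * (lifted_diff Y S' e' s' * I) = D Y * (e' * I)" by (simp only: mult.assoc[symmetric] dY(3))
    also have "\<dots> = f * (D X * e)" by (simp only: I(2) mult.assoc[symmetric] Ch_D(4)[OF f])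
    also have "\<dots> = e' * (I * lifted_diff X S e s)" by (simp only: dX(3)[symmetric] mult.assoc[symmetric] I(2))
    finally show "e' * (lifted_diff Y S' e' s' * I) = e' * (I * lifted_diff X S e s)" .
  qed
  then show "(D S' - lifted_diff Y S' e' s') * I = I * (D S - lifted_diff X S e s)"
    using Ch_D(4)[OF I(1)] by (simp add: algebra_simps)
  show "hsum (D Y) (D S') e' N * I = f * hsum (D X) (D S) e N"
    using hsum_mult[OF Ch_D(4)[OF I(1)], of "D Y" e' N] mult_hsum[OF Ch_D(4)[OF f, symmetric], of "D S" e N]
    by (simp add: I(2))
qed

end

section \<open>Functors on quotient categories\<close>

lemma UN_eqI:
  assumes "x \<in> A" "\<And>y. y \<in> A \<Longrightarrow> F y = c" shows "(\<Union>y\<in>A. F y) = c"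
  using assms by blast

text \<open>The homotopy category is the quotient of the category of complexes by such a relation \<open>R\<close>.\<close>

locale congruence = category C for C :: "('o, 'a, 'm) category_scheme" (structure) +
  fixes R :: "'a rel"
  assumes equiv: "equiv (Arr C) R"
    and parallel: "(f, g) \<in> R \<Longrightarrow> Dom C f = Dom C g \<and> Cod C f = Cod C g"
    and compatible: "\<lbrakk>(f, f') \<in> R; (g, g') \<in> R; Cod C f = Dom C g\<rbrakk> \<Longrightarrow> (g \<cdot> f, g' \<cdot> f') \<in> R"
begin

abbreviation Q :: "('o, 'a set) category" where
  "Q \<equiv> quotient_category C R"

lemma R_Arr: "(f, g) \<in> R \<Longrightarrow> f \<in> Arr C \<and> g \<in> Arr C"
  using equiv by (auto simp: equiv_def)

lemma R_refl: "f \<in> Arr C \<Longrightarrow> (f, f) \<in> R"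
  using equiv by (auto simp: equiv_def refl_on_def)

lemma class_eq: "(f, g) \<in> R \<Longrightarrow> R `` {f} = R `` {g}"
  by (rule equiv_class_eq[OF equiv])

lemma class_Hom:
  assumes f: "f \<in> Hom C A A'" shows "R `` {f} \<in> Hom Q A A'"
proof -
  have F: "f \<in> Arr C" "Dom C f = A" "Cod C f = A'" using f by (auto simp: Hom_def)
  have "Dom C g = A \<and> Cod C g = A'" if "g \<in> R `` {f}" for g
    using parallel[of f g] that F by simp
  moreover have "f \<in> R `` {f}" using R_refl[OF F(1)] by simp
  ultimately have "Dom C ` (R `` {f}) = {A}" "Cod C ` (R `` {f}) = {A'}"
    by (metis (no_types, lifting) empty_iff image_cong image_constant_conv)+
  then show ?thesis using F by (simp add: Hom_def quotient_category_def quotientI)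
qed

lemma Hom_Q_E:
  assumes "\<phi> \<in> Hom Q A A'" obtains f where "f \<in> Hom C A A'" "\<phi> = R `` {f}"
proof -
  obtain f where f: "f \<in> Arr C" "\<phi> = R `` {f}"
    using assms by (auto simp: Hom_def quotient_category_def elim: quotientE)
  then have "\<phi> \<in> Hom Q (Dom C f) (Cod C f)" using class_Hom[of f] by (simp add: Hom_def)
  then have "f \<in> Hom C A A'" using assms f by (simp add: Hom_def)
  then show thesis using f that by blast
qed

lemma Comp_Q:
  assumes f: "f \<in> Hom C A A'" and g: "g \<in> Hom C A' A''"
  shows "Comp Q (R `` {g}) (R `` {f}) = R `` {g \<cdot> f}"
proof -
  have comp: "R `` {g' \<cdot> f'} = R `` {g \<cdot> f}" if "(f, f') \<in> R" "(g, g') \<in> R" for f' g'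
    by (rule class_eq[OF compatible[OF that], symmetric]) (use f g in \<open>simp add: Hom_def\<close>)
  have refl: "(f, f) \<in> R" "(g, g) \<in> R" using R_refl f g by (auto simp: Hom_def)
  show ?thesis
    unfolding quotient_category_def category.simps
    by (intro UN_eqI[of g "R `` {g}"] UN_eqI[of f "R `` {f}"] comp) (simp_all only: Image_singleton_iff refl)
qed

lemma Ident_Q: "Ident Q A = R `` {Ident C A}"
  by (simp add: quotient_category_def)

lemma Obj_Q: "Obj Q = Obj C"
  by (simp add: quotient_category_def)

lemma category_Q: "category Q"
proof
  show "Dom Q \<phi> \<in> Obj Q" "Cod Q \<phi> \<in> Obj Q" if "\<phi> \<in> Arr Q" for \<phi>
  proof -
    have "\<phi> \<in> Hom Q (Dom Q \<phi>) (Cod Q \<phi>)" using that by (simp add: Hom_def)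
    then obtain f where "f \<in> Hom C (Dom Q \<phi>) (Cod Q \<phi>)" by (rule Hom_Q_E)
    then show "Dom Q \<phi> \<in> Obj Q" "Cod Q \<phi> \<in> Obj Q"
      using Dom_closed[of f] Cod_closed[of f] by (auto simp: Obj_Q Hom_def)
  qed
  show "Ident Q A \<in> Hom Q A A" if "A \<in> Obj Q" for A
    using that class_Hom[OF Ident_Hom] by (simp add: Obj_Q Ident_Q)
  show "Comp Q \<psi> \<phi> \<in> Hom Q A A''" if "\<phi> \<in> Hom Q A A'" "\<psi> \<in> Hom Q A' A''" for \<phi> \<psi> A A' A''
    using that by (elim Hom_Q_E) (simp add: Comp_Q class_Hom Comp_Hom)
  show "Comp Q (Comp Q \<chi> \<psi>) \<phi> = Comp Q \<chi> (Comp Q \<psi> \<phi>)"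
    if \<phi>: "\<phi> \<in> Hom Q A A'" and \<psi>: "\<psi> \<in> Hom Q A' A''" and \<chi>: "\<chi> \<in> Hom Q A'' A'''" for \<phi> \<psi> \<chi> A A' A'' A'''
  proof -
    obtain f where f: "f \<in> Hom C A A'" "\<phi> = R `` {f}" using \<phi> by (rule Hom_Q_E)
    obtain g where g: "g \<in> Hom C A' A''" "\<psi> = R `` {g}" using \<psi> by (rule Hom_Q_E)
    obtain h where h: "h \<in> Hom C A'' A'''" "\<chi> = R `` {h}" using \<chi> by (rule Hom_Q_E)
    note fgh = f g h
    show ?thesis
      unfolding fgh(2,4,6) Comp_Q[OF fgh(1,3)] Comp_Q[OF fgh(3,5)]
        Comp_Q[OF fgh(1) Comp_Hom[OF fgh(3,5)]] Comp_Q[OF Comp_Hom[OF fgh(1,3)] fgh(5)]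
        Comp_assoc[OF fgh(1,3,5)] ..
  qed
  show "Comp Q (Ident Q A') \<phi> = \<phi>" "Comp Q \<phi> (Ident Q A) = \<phi>" if "\<phi> \<in> Hom Q A A'" for \<phi> A A'
  proof -
    obtain f where f: "f \<in> Hom C A A'" "\<phi> = R `` {f}" using \<open>\<phi> \<in> _\<close> by (rule Hom_Q_E)
    then have "A \<in> Obj C" "A' \<in> Obj C" using Dom_closed[of f] Cod_closed[of f] by (auto simp: Hom_def)
    then show "Comp Q (Ident Q A') \<phi> = \<phi>" "Comp Q \<phi> (Ident Q A) = \<phi>"
      using f Comp_Q[OF f(1) Ident_Hom] Comp_Q[OF Ident_Hom f(1)] Ident_left Ident_right
      by (simp_all add: Ident_Q)
  qed
qed

lemma induced_farr:
  assumes F: "\<And>f g. (f, g) \<in> R \<Longrightarrow> (farr F f, farr F g) \<in> R" and f: "f \<in> Arr C"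
  shows "farr (induced_functor R F) (R `` {f}) = R `` {farr F f}"
proof -
  have eq: "R `` {farr F g} = R `` {farr F f}" if "(f, g) \<in> R" for g
    by (rule class_eq[OF F[OF that], symmetric])
  show ?thesis
    unfolding induced_functor_def functor_data.simps
    by (intro UN_eqI[of f "R `` {f}"] eq) (simp_all only: Image_singleton_iff R_refl[OF f])
qed

lemma induced_cat_functor:
  assumes F: "cat_functor C C F" and R: "\<And>f g. (f, g) \<in> R \<Longrightarrow> (farr F f, farr F g) \<in> R"
  shows "cat_functor Q Q (induced_functor R F)"
proof -
  interpret F: cat_functor C C F by (rule F)
  have obj: "fobj (induced_functor R F) = fobj F" by (simp add: induced_functor_def)
  have arr: "farr (induced_functor R F) (R `` {f}) = R `` {farr F f}" if "f \<in> Hom C A A'" for f A A'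
    using induced_farr[OF R] that by (simp add: Hom_def)
  show ?thesis
  proof (intro cat_functor.intro category_Q cat_functor_axioms.intro)
    show "fobj (induced_functor R F) A \<in> Obj Q" if "A \<in> Obj Q" for A
      using that F.fobj_closed by (simp add: obj Obj_Q)
    show "farr (induced_functor R F) \<phi> \<in> Hom Q (fobj (induced_functor R F) A) (fobj (induced_functor R F) A')"
      if "\<phi> \<in> Hom Q A A'" for \<phi> A A'
      using that F.farr_Hom by (elim Hom_Q_E) (simp add: arr obj class_Hom)
    show "farr (induced_functor R F) (Ident Q A) = Ident Q (fobj (induced_functor R F) A)"
      if "A \<in> Obj Q" for A
      using that F.farr_Ident arr[OF Ident_Hom] by (simp add: obj Obj_Q Ident_Q)
    show "farr (induced_functor R F) (Comp Q \<psi> \<phi>)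
        = Comp Q (farr (induced_functor R F) \<psi>) (farr (induced_functor R F) \<phi>)"
      if \<phi>: "\<phi> \<in> Hom Q A A'" and \<psi>: "\<psi> \<in> Hom Q A' A''" for \<phi> \<psi> A A' A''
    proof -
      obtain f where f: "f \<in> Hom C A A'" "\<phi> = R `` {f}" using \<phi> by (rule Hom_Q_E)
      obtain g where g: "g \<in> Hom C A' A''" "\<psi> = R `` {g}" using \<psi> by (rule Hom_Q_E)
      show ?thesis
        unfolding f(2) g(2) Comp_Q[OF f(1) g(1)] arr[OF f(1)] arr[OF g(1)] arr[OF Comp_Hom[OF f(1) g(1)]]
          Comp_Q[OF F.farr_Hom[OF f(1)] F.farr_Hom[OF g(1)]] F.farr_Comp[OF f(1) g(1)] ..
    qed
  qed
qed

end

lemma cat_functor_comp: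
  assumes "cat_functor C D F" "cat_functor D E G"
  shows "cat_functor C E (functor_comp G F)"
proof -
  interpret F: cat_functor C D F by fact
  interpret G: cat_functor D E G by fact
  show ?thesis
    by unfold_locales
      (simp_all add: functor_comp_def F.fobj_closed G.fobj_closed F.farr_Ident G.farr_Ident
        G.farr_Hom[OF F.farr_Hom] F.farr_Comp G.farr_Comp[OF F.farr_Hom F.farr_Hom])
qed

lemma cat_functor_fpower:
  assumes "cat_functor C C F"
  shows "cat_functor C C (fpower F n)"
proof (induction n)
  case 0
  interpret cat_functor C C F by fact
  show ?case by unfold_locales (simp_all add: fpower_def fident_def)
next
  case (Suc n)
  then show ?case using cat_functor_comp[OF Suc assms] by (simp add: fpower_def)
qed

section \<open>The natural isomorphism\<close>

context ncomplexes
begin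

lemma congruence_homotopy: "congruence \<C> (homotopy_rel N B)"
proof -
  interpret CN: category \<C> by (rule category_CN)
  note R = homotopy_rel_iff
  have neg: "op_of g - op_of f \<in> Nh X Y" if "op_of f - op_of g \<in> Nh X Y" "f \<in> Hom \<C> X Y" for f g X Y
    using Nh_closed(3)[OF Ch_D(1,2)[OF op_of_chain[OF that(2)]] that(1)] by simp
  have add: "op_of f - op_of h \<in> Nh X Y"
    if "op_of f - op_of g \<in> Nh X Y" "op_of g - op_of h \<in> Nh X Y" "f \<in> Hom \<C> X Y" for f g h X Y
    using Nh_closed(2)[OF Ch_D(1,2)[OF op_of_chain[OF that(3)]] that(1,2)] by simp
  show ?thesis
  proof
    show "equiv (Arr \<C>) (homotopy_rel N B)"
    proof (rule equivI)
      show "homotopy_rel N B \<subseteq> Arr \<C> \<times> Arr \<C>" by (auto simp: R Hom_def)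
      show "refl_on (Arr \<C>) (homotopy_rel N B)"
      proof (rule refl_onI)
        fix f assume "f \<in> Arr \<C>"
        then have f: "f \<in> Hom \<C> (src f) (tgt f)" by (simp add: Hom_def CN_def)
        then have "op_of f - op_of f \<in> Nh (src f) (tgt f)"
          using Nh_closed(1) Ch_D(1,2)[OF op_of_chain[OF f]] by simp
        then show "(f, f) \<in> homotopy_rel N B" using f unfolding R by blast
      qed
      show "sym (homotopy_rel N B)" using neg unfolding sym_def R by blast
      show "trans (homotopy_rel N B)"
      proof (rule transI)
        fix f g h assume "(f, g) \<in> homotopy_rel N B" "(g, h) \<in> homotopy_rel N B"
        then show "(f, h) \<in> homotopy_rel N B" using add unfolding R by (metis Hom_CN)
      qed
    qed
    show "Dom \<C> f = Dom \<C> g \<and> Cod \<C> f = Cod \<C> g"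
      if "(f, g) \<in> homotopy_rel N B" for f g
      using that by (auto simp: R Hom_def)
    show "(Comp \<C> g f, Comp \<C> g' f') \<in> homotopy_rel N B"
      if related: "(f, f') \<in> homotopy_rel N B" "(g, g') \<in> homotopy_rel N B" "Cod \<C> f = Dom \<C> g"
      for f f' g g'
    proof -
      obtain X Y where H1: "f \<in> Hom \<C> X Y" "f' \<in> Hom \<C> X Y" "op_of f - op_of f' \<in> Nh X Y"
        using related(1) unfolding R by blast
      obtain Y' Z where H2: "g \<in> Hom \<C> Y' Z" "g' \<in> Hom \<C> Y' Z" "op_of g - op_of g' \<in> Nh Y' Z"
        using related(2) unfolding R by blast
      have "Y' = Y" using related(3) H1(1) H2(1) by (simp add: Hom_def)
      note H = H1 H2[unfolded this]
      have "op_of g * op_of f - op_of g' * op_of f'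
          = op_of g * (op_of f - op_of f') + (op_of g - op_of g') * op_of f'"
        by (simp add: algebra_simps)
      also have "\<dots> \<in> Nh X Z"
        using Nh_closed(2)[OF Ch_D(1)[OF op_of_chain[OF H(1)]] Ch_D(2)[OF op_of_chain[OF H(4)]]]
          Nh_mult_left[OF op_of_chain[OF H(4)] H(3)] Nh_mult_right[OF op_of_chain[OF H(2)] H(6)] by blast
      finally show ?thesis
        using H op_of_Comp[OF H(1,4)] op_of_Comp[OF H(2,5)] unfolding R by auto
    qed
  qed
qed

sublocale homotopy: congruence \<C> "homotopy_rel N B"
  by (rule congruence_homotopy)

abbreviation cls :: "('o, 'a) chain_map \<Rightarrow> ('o, 'a) chain_map set" where
  "cls f \<equiv> homotopy_rel N B `` {f}"

lemma cls_eqI: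
  "f \<in> Hom \<C> X Y \<Longrightarrow> g \<in> Hom \<C> X Y \<Longrightarrow> op_of f - op_of g \<in> Nh X Y \<Longrightarrow> cls f = cls g"
  by (intro homotopy.class_eq) (auto simp: homotopy_rel_iff)

lemma susp_functor: "cat_functor \<C> \<C> \<lparr>fobj = \<S>, farr = Smap\<rparr>"
  by (intro cat_functor.intro category_CN cat_functor_axioms.intro)
    (simp_all add: Obj_CN susp_map_Hom(1) susp_map_Ident susp_map_Comp
      Ch_D(2)[OF op_of_chain[OF susp_split_seq(2)]])

lemma susp_homotopy:
  "(f, g) \<in> homotopy_rel N B \<Longrightarrow> (Smap f, Smap g) \<in> homotopy_rel N B"
  unfolding homotopy_rel_iff using susp_map_homotopy susp_map_Hom(1) by blast

lemma suspension_functor: "cat_functor (KN N B) (KN N B) (suspension N B)"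
  unfolding KN_def suspension_def
  by (rule homotopy.induced_cat_functor[OF susp_functor]) (simp add: susp_homotopy)

lemma suspension_cls:
  assumes "f \<in> Hom \<C> X Y" shows "farr (suspension N B) (cls f) = cls (Smap f)"
  using homotopy.induced_farr[of "\<lparr>fobj = \<S>, farr = Smap\<rparr>" f] assms susp_homotopy
  by (simp add: suspension_def Hom_def)

lemma shift_CN_eq: "fobj shift_CN = Sh 1" "farr shift_CN = Sh_map 1"
  by (simp_all add: shift_CN_def Let_def Sh_map_def Sh_def shifted_def[abs_def] fun_eq_iff)

lemma Sh_map_Ident: "Sh_map m (Ident \<C> X) = Ident \<C> (Sh m X)"
  by (simp add: Sh_map_def CN_simps Sh_def shifted_def)

lemma Sh_map_Comp: "Sh_map m (Comp \<C> g f) = Comp \<C> (Sh_map m g) (Sh_map m f)"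
  by (simp add: Sh_map_def CN_simps)

lemma shift_CN_functor: "cat_functor \<C> \<C> shift_CN"
  by (intro cat_functor.intro category_CN cat_functor_axioms.intro)
    (simp_all add: shift_CN_eq Obj_CN shift_ops(7) Sh_map_Hom(1) Sh_map_Ident Sh_map_Comp)

lemma Sh_map_homotopy:
  assumes "(f, g) \<in> homotopy_rel N B" shows "(Sh_map m f, Sh_map m g) \<in> homotopy_rel N B"
proof -
  obtain X Y where H: "f \<in> Hom \<C> X Y" "g \<in> Hom \<C> X Y" "op_of f - op_of g \<in> Nh X Y"
    using assms unfolding homotopy_rel_iff by blast
  have "op_of (Sh_map m f) - op_of (Sh_map m g) = to_sh m Y * (op_of f - op_of g) * from_sh m X"
    by (simp add: Sh_map_Hom(2)[OF H(1)] Sh_map_Hom(2)[OF H(2)] algebra_simps)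
  then have "op_of (Sh_map m f) - op_of (Sh_map m g) \<in> Nh (Sh m X) (Sh m Y)"
    using Sh_map_null[OF Ch_D(1,2)[OF op_of_chain[OF H(1)]] H(3)] by simp
  then show ?thesis
    unfolding homotopy_rel_iff using Sh_map_Hom(1)[OF H(1)] Sh_map_Hom(1)[OF H(2)] by blast
qed

lemma shift_functor: "cat_functor (KN N B) (KN N B) (shift N B)"
  unfolding KN_def shift_def
  by (rule homotopy.induced_cat_functor[OF shift_CN_functor]) (simp add: shift_CN_eq Sh_map_homotopy)

lemma fpower_shift:
  "fobj (fpower (shift N B) n) X = Sh (int n) X"
  "f \<in> Hom \<C> X Y \<Longrightarrow> farr (fpower (shift N B) n) (cls f) = cls (Sh_map (int n) f)"
proof -
  have step: "fobj (fpower (shift N B) (Suc n)) X = fobj (shift N B) (fobj (fpower (shift N B) n) X)"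
    "farr (fpower (shift N B) (Suc n)) \<phi> = farr (shift N B) (farr (fpower (shift N B) n) \<phi>)" for n X \<phi>
    by (simp_all add: fpower_def functor_comp_def)
  have zero: "fpower (shift N B) 0 = fident" by (simp add: fpower_def)
  have add: "Sh 1 (Sh (int n) X) = Sh (int (Suc n)) X" for n X
    by (simp add: Sh_def shifted_def[abs_def] add_ac)
  show obj: "fobj (fpower (shift N B) n) X = Sh (int n) X"
  proof (induction n)
    case (Suc n)
    have "fobj (shift N B) = Sh 1" by (simp add: shift_def induced_functor_def shift_CN_eq)
    then show ?case by (simp only: step(1) Suc.IH add)
  qed (simp add: zero fident_def Sh_def shifted_def[abs_def])
  assume f: "f \<in> Hom \<C> X Y"
  show "farr (fpower (shift N B) n) (cls f) = cls (Sh_map (int n) f)"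
  proof (induction n)
    case 0
    have "Sh_map 0 f = f" by (simp add: Sh_map_def Sh_def shifted_def[abs_def])
    then show ?case by (simp add: zero fident_def)
  next
    case (Suc n)
    have "Sh_map (int n) f \<in> Arr \<C>" using Sh_map_Hom(1)[OF f] by (simp add: Hom_def)
    then have "farr (shift N B) (cls (Sh_map (int n) f)) = cls (Sh_map 1 (Sh_map (int n) f))"
      using homotopy.induced_farr[of shift_CN] Sh_map_homotopy by (simp add: shift_def shift_CN_eq)
    moreover have "Sh_map 1 (Sh_map (int n) f) = Sh_map (int (Suc n)) f"
      by (simp only: add[symmetric] Sh_map_def chain_map.simps) (simp add: add_ac)
    ultimately show ?case by (simp only: Suc.IH step(2))
  qed
qed

lemma suspension_squared:
  "fobj (fpower (suspension N B) 2) X = \<S> (\<S> X)"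
  "f \<in> Hom \<C> X Y \<Longrightarrow>
    farr (fpower (suspension N B) 2) (cls f) = cls (Smap (Smap f))"
  using suspension_cls[of f X Y] suspension_cls[OF susp_map_Hom(1), of f X Y]
  by (simp_all add: fpower_def numeral_2_eq_2 functor_comp_def fident_def suspension_def induced_functor_def)

text \<open>Schanuel's argument: the maps of sequences over the identity of \<open>X\<close>, in both directions,
  have composites that differ from the identity by maps over \<open>0\<close>.\<close>

lemma split_seq_comparison:
  assumes 1: "split_seq X S Q u q" "contractible S" and 2: "split_seq X S' Q' u' q'" "contractible S'"
  obtains k g h where "k \<in> Ch S S'" "g \<in> Ch Q Q'" "k * u = u'" "g * q = q' * k"
    "h \<in> Ch Q' Q" "h * g - E Q \<in> Nh Q Q" "g * h - E Q' \<in> Nh Q' Q'"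
proof -
  have u: "u \<in> Ch X S" "q \<in> Ch S Q" using 1(1) by (auto elim: split_seqE)
  have u': "u' \<in> Ch X S'" "q' \<in> Ch S' Q'" using 2(1) by (auto elim: split_seqE)
  have X: "cx X" and id: "E X \<in> Ch X X" using Ch_D(1)[OF u(1)] Ch_unit by auto
  have 0: "0 \<in> Nh X X" by (rule Nh_closed(1)[OF X X])
  obtain k g where k: "k \<in> Ch S S'" "g \<in> Ch Q Q'" "k * u = u' * E X" "g * q = q' * k"
    using split_seq_map[OF 1(1) 2(1,2) id] .
  obtain m h where m: "m \<in> Ch S' S" "h \<in> Ch Q' Q" "m * u' = u * E X" "h * q' = q * m"
    using split_seq_map[OF 2(1) 1(1,2) id] .
  have ku: "k * u = u'" "m * u' = u" using k(3) m(3) Ch_D(6)[OF u(1)] Ch_D(6)[OF u'(1)] by auto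
  have "h * g - E Q \<in> Nh Q Q"
  proof (rule split_seq_map_null[OF 1(1) 1(1,2) 0])
    show "m * k - E S \<in> Ch S S" by (intro Ch_diff Ch_mult[OF m(1) k(1)] Ch_unit[OF Ch_D(2)[OF u(1)]])
    show "(m * k - E S) * u = u * 0" by (simp add: left_diff_distrib mult.assoc ku Ch_D(5)[OF u(1)])
    show "h * g - E Q \<in> Ch Q Q" by (intro Ch_diff Ch_mult[OF m(2) k(2)] Ch_unit[OF Ch_D(2)[OF u(2)]])
    have "h * g * q = q * (m * k)" by (simp add: mult.assoc k(4)) (simp add: mult.assoc[symmetric] m(4))
    then show "(h * g - E Q) * q = q * (m * k - E S)"
      by (simp add: left_diff_distrib right_diff_distrib Ch_D(5,6)[OF u(2)])
  qed
  moreover have "g * h - E Q' \<in> Nh Q' Q'"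
  proof (rule split_seq_map_null[OF 2(1) 2(1,2) 0])
    show "k * m - E S' \<in> Ch S' S'" by (intro Ch_diff Ch_mult[OF k(1) m(1)] Ch_unit[OF Ch_D(2)[OF u'(1)]])
    show "(k * m - E S') * u' = u' * 0" by (simp add: left_diff_distrib mult.assoc ku Ch_D(5)[OF u'(1)])
    show "g * h - E Q' \<in> Ch Q' Q'" by (intro Ch_diff Ch_mult[OF k(2) m(2)] Ch_unit[OF Ch_D(2)[OF u'(2)]])
    have "g * h * q' = q' * (k * m)" by (simp add: mult.assoc m(4)) (simp add: mult.assoc[symmetric] k(4))
    then show "(g * h - E Q') * q' = q' * (k * m - E S')"
      by (simp add: left_diff_distrib right_diff_distrib Ch_D(5,6)[OF u'(2)])
  qed
  ultimately show thesis using k(1,2,4) ku(1) m(2) that by blast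
qed

lemma second_split_seq_susp:
  obtains v w where
    "\<And>X. cx X \<Longrightarrow> split_seq (\<S> X) (Sh 1 (\<I> X)) (Sh (int N) X) (v X) (w X)"
    "\<And>X Y f. f \<in> Hom \<C> X Y \<Longrightarrow> op_of (Sh_map 1 (Imap f)) * v X = v Y * op_of (Smap f)"
    "\<And>X Y f. f \<in> Hom \<C> X Y \<Longrightarrow> op_of (Sh_map (int N) f) * w X = w Y * op_of (Sh_map 1 (Imap f))"
proof -
  let ?S = "\<I>"
  have "\<forall>X. \<exists>s. cx X \<longrightarrow> cofree (cob X) (?S X) (counit X) s" using mu_sum_cofree by metis
  then obtain s where s: "\<And>X. cx X \<Longrightarrow> cofree (cob X) (?S X) (counit X) (s X)" by metis
  define w where "w X = to_sh (int N) X * hsum (D X) (D (?S X)) (counit X) N * from_sh 1 (?S X)" for X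
  define \<delta> where "\<delta> X = D (?S X) - lifted_diff X (?S X) (counit X) (s X)" for X
  have "\<exists>v. split_seq (\<S> X) (Sh 1 (?S X)) (Sh (int N) X) v (w X) \<and>
      v * op_of (Sproj X) = to_sh 1 (?S X) * \<delta> X" if X: "cx X" for X
    using second_split_seq[OF X s[OF X] op_of_chain[OF lam_Hom(1)[OF X]] lam_Hom(2)[OF X] susp_split_seq(1)[OF X]]
    unfolding w_def \<delta>_def by metis
  then obtain v where v: "\<And>X. cx X \<Longrightarrow> split_seq (\<S> X) (Sh 1 (?S X)) (Sh (int N) X) (v X) (w X)"
      "\<And>X. cx X \<Longrightarrow> v X * op_of (Sproj X) = to_sh 1 (?S X) * \<delta> X"
    by metis
  have nat: "op_of (Sh_map 1 (Imap f)) * v X = v Y * op_of (Smap f)"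
    "op_of (Sh_map (int N) f) * w X = w Y * op_of (Sh_map 1 (Imap f))"
    if f: "f \<in> Hom \<C> X Y" for X Y f
  proof -
    note F = Ch_D[OF op_of_chain[OF f]]
    note I = mu_sum_map_Hom[OF f] and sf = susp_map_Hom[OF f]
    let ?I = "op_of (Imap f)" and ?q = "\<lambda>X. op_of (Sproj X)"
    note CI = Ch_D[OF op_of_chain[OF I(1)]]
    note sI = Sh_map_Hom[OF I(1), of 1]
    note n = second_split_seq_natural[OF F(1) s[OF F(1)] F(2) s[OF F(2)] op_of_chain[OF f] op_of_chain[OF I(1)] I(2)]
    note X1 = shift_ops[OF CI(1), of 1] and Y1 = shift_ops[OF CI(2), of 1]
    note XN = shift_ops[OF F(1), of "int N"]
    have vX: "v X \<in> Ch (\<S> X) (Sh 1 (?S X))" using v(1)[OF F(1)] by (rule split_seqE)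
    have vY: "v Y \<in> Ch (\<S> Y) (Sh 1 (?S Y))" using v(1)[OF F(2)] by (rule split_seqE)
    show "op_of (Sh_map 1 (Imap f)) * v X = v Y * op_of (Smap f)"
    proof (rule split_seq_epi[OF susp_split_seq(1)[OF F(1)]
          Ch_D(3)[OF Ch_mult[OF op_of_chain[OF sI(1)] vX]] Ch_D(3)[OF Ch_mult[OF vY op_of_chain[OF sf(1)]]]])
      have "op_of (Sh_map 1 (Imap f)) * v X * ?q X = to_sh 1 (?S Y) * ?I * (from_sh 1 (?S X) * to_sh 1 (?S X)) * \<delta> X"
        by (simp add: sI(2) mult.assoc v(2)[OF F(1)])
      also have "\<dots> = to_sh 1 (?S Y) * (?I * \<delta> X)"
        by (simp add: X1(3) mult.assoc) (simp add: mult.assoc[symmetric], simp add: mult.assoc CI(6))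
      also have "\<dots> = v Y * ?q Y * ?I"
        by (simp add: v(2)[OF F(2)] n(1)[folded \<delta>_def] mult.assoc)
      also have "\<dots> = v Y * op_of (Smap f) * ?q X" by (simp add: mult.assoc sf(2))
      finally show "op_of (Sh_map 1 (Imap f)) * v X * ?q X = v Y * op_of (Smap f) * ?q X" .
    qed
    let ?W = "\<lambda>X. hsum (D X) (D (?S X)) (counit X) N"
    have "op_of (Sh_map (int N) f) * w X = to_sh (int N) Y * (op_of f * (from_sh (int N) X * to_sh (int N) X)) * ?W X * from_sh 1 (?S X)"
      by (simp add: Sh_map_Hom(2)[OF f] w_def mult.assoc)
    also have "\<dots> = to_sh (int N) Y * (op_of f * ?W X) * from_sh 1 (?S X)"
      by (simp add: XN(3) F(6) mult.assoc)
    also have "\<dots> = to_sh (int N) Y * (?W Y * ?I) * from_sh 1 (?S X)" by (simp add: n(2))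
    also have "\<dots> = to_sh (int N) Y * ?W Y * (from_sh 1 (?S Y) * to_sh 1 (?S Y) * ?I) * from_sh 1 (?S X)"
      by (simp add: Y1(3) CI(5) mult.assoc)
    also have "\<dots> = w Y * op_of (Sh_map 1 (Imap f))" by (simp add: sI(2) w_def mult.assoc)
    finally show "op_of (Sh_map (int N) f) * w X = w Y * op_of (Sh_map 1 (Imap f))" .
  qed
  show thesis by (rule that[of v w]) (use v nat in auto)
qed

text \<open>The isomorphism at \<open>X\<close> compares the two sequences that start at \<open>\<Sigma>X\<close>. A morphism \<open>f\<close> induces strict maps
  of both sequences, so the two composites in the naturality square are induced by the same map
  \<open>\<Sigma>X \<rightarrow> \<Sigma>Y\<close>, and \<open>split_seq_map_null\<close> shows that they are homotopic.\<close>

lemma suspension_squared_shift: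
  "naturally_isomorphic (KN N B) (KN N B) (fpower (suspension N B) 2) (fpower (shift N B) N)"
proof -
  let ?S = "\<I>" and ?SS = "\<lambda>X. \<S> (\<S> X)"
  obtain v w where vw:
    "\<And>X. cx X \<Longrightarrow> split_seq (\<S> X) (Sh 1 (?S X)) (Sh (int N) X) (v X) (w X)"
    "\<And>X Y f. f \<in> Hom \<C> X Y \<Longrightarrow> op_of (Sh_map 1 (Imap f)) * v X = v Y * op_of (Smap f)"
    "\<And>X Y f. f \<in> Hom \<C> X Y \<Longrightarrow> op_of (Sh_map (int N) f) * w X = w Y * op_of (Sh_map 1 (Imap f))"
    by (rule second_split_seq_susp) blast
  have susp: "cx (\<S> X)" if "cx X" for X
    using Ch_D(2)[OF op_of_chain[OF susp_split_seq(2)[OF that]]] .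
  let ?P = "\<lambda>X k a b. k \<in> Ch (?S (\<S> X)) (Sh 1 (?S X)) \<and>
      a \<in> Hom \<C> (?SS X) (Sh (int N) X) \<and> b \<in> Hom \<C> (Sh (int N) X) (?SS X) \<and>
      k * op_of (lam N B (\<S> X)) = v X \<and>
      op_of a * op_of (Sproj (\<S> X)) = w X * k \<and>
      op_of b * op_of a - E (?SS X) \<in> Nh (?SS X) (?SS X) \<and>
      op_of a * op_of b - E (Sh (int N) X) \<in> Nh (Sh (int N) X) (Sh (int N) X)"
  have "\<exists>k a b. ?P X k a b" if X: "cx X" for X
  proof -
    note s = susp_split_seq[OF susp[OF X]]
    obtain k g h where k: "k \<in> Ch (?S (\<S> X)) (Sh 1 (?S X))" "g \<in> Ch (?SS X) (Sh (int N) X)"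
      "k * op_of (lam N B (\<S> X)) = v X" "g * op_of (Sproj (\<S> X)) = w X * k"
      "h \<in> Ch (Sh (int N) X) (?SS X)" "h * g - E (?SS X) \<in> Nh (?SS X) (?SS X)"
      "g * h - E (Sh (int N) X) \<in> Nh (Sh (int N) X) (Sh (int N) X)"
      using split_seq_comparison[OF s(1,3) vw(1)[OF X] Sh_contractible[OF susp_split_seq(3)[OF X]]] .
    obtain a where "a \<in> Hom \<C> (?SS X) (Sh (int N) X)" "op_of a = g" using op_of_surj[OF k(2)] .
    moreover obtain b where "b \<in> Hom \<C> (Sh (int N) X) (?SS X)" "op_of b = h" using op_of_surj[OF k(5)] .
    ultimately show ?thesis using k by blast
  qed
  then have "\<forall>X. \<exists>k a b. cx X \<longrightarrow> ?P X k a b" by blast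
  then obtain k a b where P: "\<And>X. cx X \<Longrightarrow> ?P X (k X) (a X) (b X)" by metis
  define \<eta> where "\<eta> X = cls (a X)" for X
  have Obj: "X \<in> Obj (KN N B) \<longleftrightarrow> cx X" for X by (simp add: KN_def homotopy.Obj_Q Obj_CN)
  have iso: "is_iso (KN N B) (?SS X) (Sh (int N) X) (\<eta> X)" if X: "cx X" for X
  proof -
    note p = P[OF X]
    have a: "a X \<in> Hom \<C> (?SS X) (Sh (int N) X)" and b: "b X \<in> Hom \<C> (Sh (int N) X) (?SS X)"
      using p by auto
    note ba = op_of_Comp[OF a b] and ab = op_of_Comp[OF b a]
    note i1 = op_of_Ident[OF susp[OF susp[OF X]]] and i2 = op_of_Ident[OF shift_ops(7)[OF X, of "int N"]]
    have "Comp (KN N B) (cls (b X)) (cls (a X)) = Ident (KN N B) (?SS X)"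
      unfolding KN_def homotopy.Comp_Q[OF a b] homotopy.Ident_Q
      by (rule cls_eqI[OF ba(1) i1(1)]) (simp add: ba(2) i1(2) p)
    moreover have "Comp (KN N B) (cls (a X)) (cls (b X)) = Ident (KN N B) (Sh (int N) X)"
      unfolding KN_def homotopy.Comp_Q[OF b a] homotopy.Ident_Q
      by (rule cls_eqI[OF ab(1) i2(1)]) (simp add: ab(2) i2(2) p)
    ultimately show ?thesis
      using homotopy.class_Hom[OF a] homotopy.class_Hom[OF b] unfolding is_iso_def \<eta>_def KN_def by blast
  qed
  have natural: "Comp (KN N B) (\<eta> Y) (farr (fpower (suspension N B) 2) \<phi>)
      = Comp (KN N B) (farr (fpower (shift N B) N) \<phi>) (\<eta> X)" if \<phi>: "\<phi> \<in> Hom (KN N B) X Y" for X Y \<phi>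
  proof -
    obtain f where f: "f \<in> Hom \<C> X Y" "\<phi> = cls f"
      using \<phi> unfolding KN_def by (rule homotopy.Hom_Q_E)
    note F = Ch_D[OF op_of_chain[OF f(1)]]
    note pX = P[OF F(1)] and pY = P[OF F(2)]
    note sf = susp_map_Hom(1)[OF f(1)]
    note ssf = susp_map_Hom[OF sf] and If = mu_sum_map_Hom[OF sf] and J = mu_sum_map_Hom[OF f(1)]
    note shf = Sh_map_Hom(1)[OF f(1), of "int N"] and shJ = Sh_map_Hom(1)[OF J(1), of 1]
    have aX: "a X \<in> Hom \<C> (?SS X) (Sh (int N) X)" and aY: "a Y \<in> Hom \<C> (?SS Y) (Sh (int N) Y)"
      using pX pY by auto
    have kX: "k X \<in> Ch (?S (\<S> X)) (Sh 1 (?S X))" and kY: "k Y \<in> Ch (?S (\<S> Y)) (Sh 1 (?S Y))"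
      using pX pY by auto
    note l = op_of_Comp[OF ssf(1) aY] and r = op_of_Comp[OF aX shf]
    let ?l = "\<lambda>X. op_of (lam N B (\<S> X))" and ?q = "\<lambda>X. op_of (Sproj (\<S> X))"
      and ?I = "op_of (Imap (Smap f))" and ?J = "op_of (Sh_map 1 (Imap f))"
    have "op_of (a Y) * op_of (Smap (Smap f)) - op_of (Sh_map (int N) f) * op_of (a X)
        \<in> Nh (?SS X) (Sh (int N) Y)"
    proof (rule split_seq_map_null[OF susp_split_seq(1)[OF susp[OF F(1)]] vw(1)[OF F(2)]
          Sh_contractible[OF susp_split_seq(3)[OF F(2)]] Nh_closed(1)[OF susp[OF F(1)] susp[OF F(2)]]])
      show "k Y * ?I - ?J * k X \<in> Ch (?S (\<S> X)) (Sh 1 (?S Y))"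
        by (intro Ch_diff Ch_mult[OF kY op_of_chain[OF If(1)]] Ch_mult[OF op_of_chain[OF shJ] kX])
      have "k Y * (?I * ?l X) = (k Y * ?l Y) * op_of (Smap f)"
        by (simp add: mu_sum_map_lam[OF sf] mult.assoc)
      then show "(k Y * ?I - ?J * k X) * ?l X = v Y * 0"
        using pX pY vw(2)[OF f(1)] by (simp add: left_diff_distrib mult.assoc)
      show "op_of (a Y) * op_of (Smap (Smap f)) - op_of (Sh_map (int N) f) * op_of (a X)
          \<in> Ch (?SS X) (Sh (int N) Y)"
        using Ch_diff[OF op_of_chain[OF l(1)] op_of_chain[OF r(1)]] by (simp add: l(2) r(2))
      have "op_of (a Y) * (op_of (Smap (Smap f)) * ?q X) = (op_of (a Y) * ?q Y) * ?I"
        by (simp add: ssf(2) mult.assoc)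
      then have 1: "op_of (a Y) * (op_of (Smap (Smap f)) * ?q X) = w Y * (k Y * ?I)"
        using pY by (simp add: mult.assoc)
      have "op_of (Sh_map (int N) f) * (op_of (a X) * ?q X) = (op_of (Sh_map (int N) f) * w X) * k X"
        using pX by (simp add: mult.assoc)
      then have 2: "op_of (Sh_map (int N) f) * (op_of (a X) * ?q X) = w Y * (?J * k X)"
        by (simp add: vw(3)[OF f(1)] mult.assoc)
      show "(op_of (a Y) * op_of (Smap (Smap f)) - op_of (Sh_map (int N) f) * op_of (a X)) * ?q X
          = w Y * (k Y * ?I - ?J * k X)"
        by (simp add: left_diff_distrib right_diff_distrib mult.assoc 1 2)
    qed
    then have "cls (Comp \<C> (a Y) (Smap (Smap f))) = cls (Comp \<C> (Sh_map (int N) f) (a X))"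
      by (intro cls_eqI[OF l(1) r(1)]) (simp add: l(2) r(2))
    then show ?thesis
      by (simp add: f(2) suspension_squared(2)[OF f(1)] fpower_shift(2)[OF f(1)] \<eta>_def KN_def
          homotopy.Comp_Q[OF ssf(1) aY] homotopy.Comp_Q[OF aX shf])
  qed
  have "natural_iso (KN N B) (KN N B) (fpower (suspension N B) 2) (fpower (shift N B) N) \<eta>"
    unfolding natural_iso_def
    using cat_functor_fpower[OF suspension_functor] cat_functor_fpower[OF shift_functor] iso natural
    by (simp add: Obj suspension_squared(1) fpower_shift(1))
  then show ?thesis unfolding naturally_isomorphic_def by blast
qed

end

theorem theorem0p2:
  fixes B :: "('o, 'a) ab_category" and N :: nat
  assumes "N \<ge> 2" and "additive_category B"
  shows "naturally_isomorphic (KN N B) (KN N B) (fpower (suspension N B) 2) (fpower (shift N B) N)"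
proof -
  interpret ncomplexes B N
    using assms by (simp add: ncomplexes_def graded_def ncomplexes_axioms_def)
  show ?thesis by (rule suspension_squared_shift)
qed

end
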